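(* Let $\mathcal{C}$ be a nilpotent fusion category. Then for each simple object $X$ in $\mathcal{C}$, $\mathrm{FPdim}(X)^2$ divides $\mathrm{FPdim}(\mathcal{C}_{ad})$.
   Context: $k$ is an algebraically closed field of characteristic $0$. A fusion category is a $k$-linear semisimple rigid tensor category with finitely many isomorphism classes of simple objects, finite-dimensional morphism spaces, and simple unit object. $\mathcal{C}_{ad}$ is the full tensor subcategory of $\mathcal{C}$ generated by all subobjects of $X\otimes X^*$, where $X$ runs through simple objects of $\mathcal{C}$. Put $\mathcal{C}^{(0)}=\mathcal{C}$ and $\mathcal{C}^{(n)}=(\mathcal{C}^{(n-1)})_{ad}$ for $n\ge1$; $\mathcal{C}$ is nilpotent if $\mathcal{C}^{(n)}=\mathrm{Vec}$ (the fusion subcategory generated by the unit object) for some $n$. $\mathrm{FPdim}$ of objects is given by the unique ring homomorphism $K_0(\mathcal{C})\to\mathbb{R}$ taking positive values on classes of simple objects; $\mathrm{FPdim}$ of a fusion category is the sum of the squares of the dimensions of its simple objects (up to isomorphism). "Divides" means that the quotient $\mathrm{FPdim}(\mathcal{C}_{ad})/\mathrm{FPdim}(X)^2$ is an integer. *)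

theory Defs
  imports "HOL-Algebra.Algebraic_Closure_Type"
begin

section \<open>Linear categories\<close>

text \<open>
  A (small) category with objects \<open>Obj C\<close>. The morphisms from \<open>V\<close> to \<open>Y\<close> are the carrier of the
  vector space \<open>Hom C V Y\<close>, a record of the library type of modules; the ring multiplication and
  unit that this type also provides carry no meaning here.
  All structure maps are constrained on \<open>Obj C\<close> only, so that a full subcategory is obtained by
  replacing \<open>Obj C\<close> by a smaller set.
\<close>

record ('o, 'm, 'k) tensor_data =
  Obj :: "'o set"
  Hom :: "'o \<Rightarrow> 'o \<Rightarrow> ('k, 'm) module"
  Id :: "'o \<Rightarrow> 'm"
  Comp :: "'m \<Rightarrow> 'm \<Rightarrow> 'm"  (infixr \<open>\<bullet>\<index>\<close> 75)
  Unit :: "'o"  (\<open>\<one>\<^sub>o\<index>\<close>)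
  Tens :: "'o \<Rightarrow> 'o \<Rightarrow> 'o"  (infixl \<open>\<otimes>\<^sub>o\<index>\<close> 80)
  TensMor :: "'m \<Rightarrow> 'm \<Rightarrow> 'm"  (infixl \<open>\<otimes>\<^sub>m\<index>\<close> 80)
  Assoc :: "'o \<Rightarrow> 'o \<Rightarrow> 'o \<Rightarrow> 'm"
  LUnit :: "'o \<Rightarrow> 'm"
  RUnit :: "'o \<Rightarrow> 'm"

abbreviation Mor :: "('o, 'm, 'k) tensor_data \<Rightarrow> 'o \<Rightarrow> 'o \<Rightarrow> 'm set"
  where "Mor C V Y \<equiv> carrier (Hom C V Y)"

abbreviation Zero :: "('o, 'm, 'k) tensor_data \<Rightarrow> 'o \<Rightarrow> 'o \<Rightarrow> 'm"
  where "Zero C V Y \<equiv> \<zero>\<^bsub>Hom C V Y\<^esub>"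

locale linear_category =
  fixes C :: "('o, 'm, 'k::field) tensor_data" (structure)
  assumes Id_in: "V \<in> Obj C \<Longrightarrow> Id C V \<in> Mor C V V"
    and Comp_in: "\<lbrakk>V \<in> Obj C; Y \<in> Obj C; Z \<in> Obj C; f \<in> Mor C V Y; g \<in> Mor C Y Z\<rbrakk>
      \<Longrightarrow> g \<bullet> f \<in> Mor C V Z"
    and Comp_Id: "\<lbrakk>V \<in> Obj C; Y \<in> Obj C; f \<in> Mor C V Y\<rbrakk> \<Longrightarrow> f \<bullet> Id C V = f"
    and Id_Comp: "\<lbrakk>V \<in> Obj C; Y \<in> Obj C; f \<in> Mor C V Y\<rbrakk> \<Longrightarrow> Id C Y \<bullet> f = f"
    and Comp_assoc: "\<lbrakk>W \<in> Obj C; V \<in> Obj C; Y \<in> Obj C; Z \<in> Obj C;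
        f \<in> Mor C W V; g \<in> Mor C V Y; h \<in> Mor C Y Z\<rbrakk>
      \<Longrightarrow> (h \<bullet> g) \<bullet> f = h \<bullet> (g \<bullet> f)"
    and Hom_vector_space: "\<lbrakk>V \<in> Obj C; Y \<in> Obj C\<rbrakk>
      \<Longrightarrow> Module.module (ring_of_type_algebra :: 'k ring) (Hom C V Y)"
    and Comp_add_left: "\<lbrakk>V \<in> Obj C; Y \<in> Obj C; Z \<in> Obj C; f \<in> Mor C V Y;
        g \<in> Mor C Y Z; h \<in> Mor C Y Z\<rbrakk>
      \<Longrightarrow> (g \<oplus>\<^bsub>Hom C Y Z\<^esub> h) \<bullet> f = (g \<bullet> f) \<oplus>\<^bsub>Hom C V Z\<^esub> (h \<bullet> f)"
    and Comp_add_right: "\<lbrakk>V \<in> Obj C; Y \<in> Obj C; Z \<in> Obj C; f \<in> Mor C V Y;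
        g \<in> Mor C V Y; h \<in> Mor C Y Z\<rbrakk>
      \<Longrightarrow> h \<bullet> (f \<oplus>\<^bsub>Hom C V Y\<^esub> g) = (h \<bullet> f) \<oplus>\<^bsub>Hom C V Z\<^esub> (h \<bullet> g)"
    and Comp_smult_left: "\<lbrakk>V \<in> Obj C; Y \<in> Obj C; Z \<in> Obj C; f \<in> Mor C V Y; g \<in> Mor C Y Z\<rbrakk>
      \<Longrightarrow> (a \<odot>\<^bsub>Hom C Y Z\<^esub> g) \<bullet> f = a \<odot>\<^bsub>Hom C V Z\<^esub> (g \<bullet> f)"
    and Comp_smult_right: "\<lbrakk>V \<in> Obj C; Y \<in> Obj C; Z \<in> Obj C; f \<in> Mor C V Y; g \<in> Mor C Y Z\<rbrakk>
      \<Longrightarrow> g \<bullet> (a \<odot>\<^bsub>Hom C V Y\<^esub> f) = a \<odot>\<^bsub>Hom C V Z\<^esub> (g \<bullet> f)"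

definition is_inverse :: "('o, 'm, 'k) tensor_data \<Rightarrow> 'o \<Rightarrow> 'o \<Rightarrow> 'm \<Rightarrow> 'm \<Rightarrow> bool"
  where "is_inverse C V Y f g \<longleftrightarrow> f \<in> Mor C V Y \<and> g \<in> Mor C Y V
    \<and> Comp C g f = Id C V \<and> Comp C f g = Id C Y"

definition is_iso :: "('o, 'm, 'k) tensor_data \<Rightarrow> 'o \<Rightarrow> 'o \<Rightarrow> 'm \<Rightarrow> bool"
  where "is_iso C V Y f \<longleftrightarrow> (\<exists>g. is_inverse C V Y f g)"

definition isomorphic :: "('o, 'm, 'k) tensor_data \<Rightarrow> 'o \<Rightarrow> 'o \<Rightarrow> bool"
  where "isomorphic C V Y \<longleftrightarrow> V \<in> Obj C \<and> Y \<in> Obj C \<and> (\<exists>f. is_iso C V Y f)"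

definition monic :: "('o, 'm, 'k) tensor_data \<Rightarrow> 'o \<Rightarrow> 'o \<Rightarrow> 'm \<Rightarrow> bool"
  where "monic C V Y f \<longleftrightarrow> f \<in> Mor C V Y
    \<and> (\<forall>W\<in>Obj C. \<forall>g\<in>Mor C W V. \<forall>h\<in>Mor C W V. Comp C f g = Comp C f h \<longrightarrow> g = h)"

definition epic :: "('o, 'm, 'k) tensor_data \<Rightarrow> 'o \<Rightarrow> 'o \<Rightarrow> 'm \<Rightarrow> bool"
  where "epic C V Y f \<longleftrightarrow> f \<in> Mor C V Y
    \<and> (\<forall>Z\<in>Obj C. \<forall>g\<in>Mor C Y Z. \<forall>h\<in>Mor C Y Z. Comp C g f = Comp C h f \<longrightarrow> g = h)"

definition is_kernel :: "('o, 'm, 'k) tensor_data \<Rightarrow> 'o \<Rightarrow> 'm \<Rightarrow> 'o \<Rightarrow> 'o \<Rightarrow> 'm \<Rightarrow> bool"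
  where "is_kernel C K k V Y f \<longleftrightarrow> K \<in> Obj C \<and> k \<in> Mor C K V \<and> f \<in> Mor C V Y
    \<and> Comp C f k = Zero C K Y
    \<and> (\<forall>W\<in>Obj C. \<forall>h\<in>Mor C W V. Comp C f h = Zero C W Y
         \<longrightarrow> (\<exists>!u. u \<in> Mor C W K \<and> Comp C k u = h))"

definition is_cokernel :: "('o, 'm, 'k) tensor_data \<Rightarrow> 'o \<Rightarrow> 'm \<Rightarrow> 'o \<Rightarrow> 'o \<Rightarrow> 'm \<Rightarrow> bool"
  where "is_cokernel C Q q V Y f \<longleftrightarrow> Q \<in> Obj C \<and> q \<in> Mor C Y Q \<and> f \<in> Mor C V Y
    \<and> Comp C q f = Zero C V Q
    \<and> (\<forall>W\<in>Obj C. \<forall>h\<in>Mor C Y W. Comp C h f = Zero C V W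
         \<longrightarrow> (\<exists>!u. u \<in> Mor C Q W \<and> Comp C u q = h))"

definition zero_object :: "('o, 'm, 'k) tensor_data \<Rightarrow> 'o \<Rightarrow> bool"
  where "zero_object C V \<longleftrightarrow> V \<in> Obj C
    \<and> (\<forall>Y\<in>Obj C. Mor C V Y = {Zero C V Y} \<and> Mor C Y V = {Zero C Y V})"

text \<open>\<open>V\<close> is a direct sum of the finite family \<open>Ys\<close>, with injections \<open>i\<close> and projections \<open>p\<close>.
  For the empty list this says that the identity of \<open>V\<close> is zero.\<close>

definition direct_sum :: "('o, 'm, 'k) tensor_data \<Rightarrow> 'o \<Rightarrow> 'o list \<Rightarrow> bool"
  where "direct_sum C V Ys \<longleftrightarrow> V \<in> Obj C \<and> set Ys \<subseteq> Obj C \<and>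
    (\<exists>i p. (\<forall>j<length Ys. i j \<in> Mor C (Ys ! j) V \<and> p j \<in> Mor C V (Ys ! j))
      \<and> (\<forall>j<length Ys. \<forall>l<length Ys. Comp C (p l) (i j) =
            (if j = l then Id C (Ys ! j) else Zero C (Ys ! j) (Ys ! l)))
      \<and> finsum (Hom C V V) (\<lambda>j. Comp C (i j) (p j)) {..<length Ys} = Id C V)"

locale abelian_category = linear_category C
  for C :: "('o, 'm, 'k::field) tensor_data" (structure) +
  assumes ex_zero_object: "\<exists>V. zero_object C V"
    and ex_direct_sum: "\<lbrakk>V \<in> Obj C; Y \<in> Obj C\<rbrakk> \<Longrightarrow> \<exists>Z. direct_sum C Z [V, Y]"
    and ex_kernel: "\<lbrakk>V \<in> Obj C; Y \<in> Obj C; f \<in> Mor C V Y\<rbrakk> \<Longrightarrow> \<exists>K k. is_kernel C K k V Y f"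
    and ex_cokernel: "\<lbrakk>V \<in> Obj C; Y \<in> Obj C; f \<in> Mor C V Y\<rbrakk> \<Longrightarrow> \<exists>Q q. is_cokernel C Q q V Y f"
    and monic_normal: "\<lbrakk>V \<in> Obj C; Y \<in> Obj C; monic C V Y f\<rbrakk>
      \<Longrightarrow> \<exists>Z\<in>Obj C. \<exists>g. is_kernel C V f Y Z g"
    and epic_normal: "\<lbrakk>V \<in> Obj C; Y \<in> Obj C; epic C V Y f\<rbrakk>
      \<Longrightarrow> \<exists>W\<in>Obj C. \<exists>g. is_cokernel C Y f W V g"

definition simple_object :: "('o, 'm, 'k) tensor_data \<Rightarrow> 'o \<Rightarrow> bool"
  where "simple_object C V \<longleftrightarrow> V \<in> Obj C \<and> \<not> zero_object C V
    \<and> (\<forall>Y\<in>Obj C. \<forall>f. monic C Y V f \<longrightarrow> zero_object C Y \<or> is_iso C Y V f)"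

definition simple_decomposition :: "('o, 'm, 'k) tensor_data \<Rightarrow> 'o \<Rightarrow> 'o list \<Rightarrow> bool"
  where "simple_decomposition C V Ys \<longleftrightarrow> direct_sum C V Ys \<and> (\<forall>Y\<in>set Ys. simple_object C Y)"

definition iso_class :: "('o, 'm, 'k) tensor_data \<Rightarrow> 'o \<Rightarrow> 'o set"
  where "iso_class C V = {Y. isomorphic C V Y}"

definition Irr :: "('o, 'm, 'k) tensor_data \<Rightarrow> 'o set set"
  where "Irr C = iso_class C ` {V. simple_object C V}"


section \<open>Fusion categories\<close>

locale monoidal_linear_category = linear_category C
  for C :: "('o, 'm, 'k::field) tensor_data" (structure) +
  assumes Unit_in: "\<one>\<^sub>o \<in> Obj C"
    and Tens_in: "\<lbrakk>V \<in> Obj C; Y \<in> Obj C\<rbrakk> \<Longrightarrow> V \<otimes>\<^sub>o Y \<in> Obj C"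
    and TensMor_in: "\<lbrakk>V \<in> Obj C; Y \<in> Obj C; V' \<in> Obj C; Y' \<in> Obj C;
        f \<in> Mor C V Y; f' \<in> Mor C V' Y'\<rbrakk>
      \<Longrightarrow> f \<otimes>\<^sub>m f' \<in> Mor C (V \<otimes>\<^sub>o V') (Y \<otimes>\<^sub>o Y')"
    and TensMor_Id: "\<lbrakk>V \<in> Obj C; Y \<in> Obj C\<rbrakk> \<Longrightarrow> Id C V \<otimes>\<^sub>m Id C Y = Id C (V \<otimes>\<^sub>o Y)"
    and TensMor_Comp: "\<lbrakk>V \<in> Obj C; Y \<in> Obj C; Z \<in> Obj C; V' \<in> Obj C; Y' \<in> Obj C; Z' \<in> Obj C;
        f \<in> Mor C V Y; g \<in> Mor C Y Z; f' \<in> Mor C V' Y'; g' \<in> Mor C Y' Z'\<rbrakk>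
      \<Longrightarrow> (g \<bullet> f) \<otimes>\<^sub>m (g' \<bullet> f') = (g \<otimes>\<^sub>m g') \<bullet> (f \<otimes>\<^sub>m f')"
    and TensMor_add_left: "\<lbrakk>V \<in> Obj C; Y \<in> Obj C; V' \<in> Obj C; Y' \<in> Obj C;
        f \<in> Mor C V Y; g \<in> Mor C V Y; f' \<in> Mor C V' Y'\<rbrakk>
      \<Longrightarrow> (f \<oplus>\<^bsub>Hom C V Y\<^esub> g) \<otimes>\<^sub>m f'
        = (f \<otimes>\<^sub>m f') \<oplus>\<^bsub>Hom C (V \<otimes>\<^sub>o V') (Y \<otimes>\<^sub>o Y')\<^esub> (g \<otimes>\<^sub>m f')"
    and TensMor_add_right: "\<lbrakk>V \<in> Obj C; Y \<in> Obj C; V' \<in> Obj C; Y' \<in> Obj C;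
        f \<in> Mor C V Y; f' \<in> Mor C V' Y'; g' \<in> Mor C V' Y'\<rbrakk>
      \<Longrightarrow> f \<otimes>\<^sub>m (f' \<oplus>\<^bsub>Hom C V' Y'\<^esub> g')
        = (f \<otimes>\<^sub>m f') \<oplus>\<^bsub>Hom C (V \<otimes>\<^sub>o V') (Y \<otimes>\<^sub>o Y')\<^esub> (f \<otimes>\<^sub>m g')"
    and TensMor_smult_left: "\<lbrakk>V \<in> Obj C; Y \<in> Obj C; V' \<in> Obj C; Y' \<in> Obj C;
        f \<in> Mor C V Y; f' \<in> Mor C V' Y'\<rbrakk>
      \<Longrightarrow> (a \<odot>\<^bsub>Hom C V Y\<^esub> f) \<otimes>\<^sub>m f' = a \<odot>\<^bsub>Hom C (V \<otimes>\<^sub>o V') (Y \<otimes>\<^sub>o Y')\<^esub> (f \<otimes>\<^sub>m f')"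
    and TensMor_smult_right: "\<lbrakk>V \<in> Obj C; Y \<in> Obj C; V' \<in> Obj C; Y' \<in> Obj C;
        f \<in> Mor C V Y; f' \<in> Mor C V' Y'\<rbrakk>
      \<Longrightarrow> f \<otimes>\<^sub>m (a \<odot>\<^bsub>Hom C V' Y'\<^esub> f') = a \<odot>\<^bsub>Hom C (V \<otimes>\<^sub>o V') (Y \<otimes>\<^sub>o Y')\<^esub> (f \<otimes>\<^sub>m f')"
    and Assoc_iso: "\<lbrakk>V \<in> Obj C; Y \<in> Obj C; Z \<in> Obj C\<rbrakk>
      \<Longrightarrow> is_iso C ((V \<otimes>\<^sub>o Y) \<otimes>\<^sub>o Z) (V \<otimes>\<^sub>o (Y \<otimes>\<^sub>o Z)) (Assoc C V Y Z)"
    and Assoc_natural: "\<lbrakk>V \<in> Obj C; Y \<in> Obj C; Z \<in> Obj C; V' \<in> Obj C; Y' \<in> Obj C; Z' \<in> Obj C;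
        f \<in> Mor C V V'; g \<in> Mor C Y Y'; h \<in> Mor C Z Z'\<rbrakk>
      \<Longrightarrow> Assoc C V' Y' Z' \<bullet> ((f \<otimes>\<^sub>m g) \<otimes>\<^sub>m h) = (f \<otimes>\<^sub>m (g \<otimes>\<^sub>m h)) \<bullet> Assoc C V Y Z"
    and LUnit_iso: "V \<in> Obj C \<Longrightarrow> is_iso C (\<one>\<^sub>o \<otimes>\<^sub>o V) V (LUnit C V)"
    and LUnit_natural: "\<lbrakk>V \<in> Obj C; Y \<in> Obj C; f \<in> Mor C V Y\<rbrakk>
      \<Longrightarrow> LUnit C Y \<bullet> (Id C \<one>\<^sub>o \<otimes>\<^sub>m f) = f \<bullet> LUnit C V"
    and RUnit_iso: "V \<in> Obj C \<Longrightarrow> is_iso C (V \<otimes>\<^sub>o \<one>\<^sub>o) V (RUnit C V)"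
    and RUnit_natural: "\<lbrakk>V \<in> Obj C; Y \<in> Obj C; f \<in> Mor C V Y\<rbrakk>
      \<Longrightarrow> RUnit C Y \<bullet> (f \<otimes>\<^sub>m Id C \<one>\<^sub>o) = f \<bullet> RUnit C V"
    and pentagon: "\<lbrakk>W \<in> Obj C; V \<in> Obj C; Y \<in> Obj C; Z \<in> Obj C\<rbrakk>
      \<Longrightarrow> Assoc C W V (Y \<otimes>\<^sub>o Z) \<bullet> Assoc C (W \<otimes>\<^sub>o V) Y Z
        = (Id C W \<otimes>\<^sub>m Assoc C V Y Z) \<bullet> Assoc C W (V \<otimes>\<^sub>o Y) Z \<bullet> (Assoc C W V Y \<otimes>\<^sub>m Id C Z)"
    and triangle: "\<lbrakk>V \<in> Obj C; Y \<in> Obj C\<rbrakk>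
      \<Longrightarrow> (Id C V \<otimes>\<^sub>m LUnit C Y) \<bullet> Assoc C V \<one>\<^sub>o Y = RUnit C V \<otimes>\<^sub>m Id C Y"

text \<open>\<open>D\<close> is a left dual \<open>V\<^sup>*\<close> of \<open>V\<close>, with evaluation \<open>D \<otimes> V \<rightarrow> \<one>\<close> and coevaluation
  \<open>\<one> \<rightarrow> V \<otimes> D\<close>; the last two conditions are the zig-zag identities, with \<open>a\<close> the inverse of the
  associator of \<open>D, V, D\<close>. Equivalently, \<open>V\<close> is a right dual of \<open>D\<close>.\<close>

definition left_dual :: "('o, 'm, 'k) tensor_data \<Rightarrow> 'o \<Rightarrow> 'o \<Rightarrow> bool"
  where "left_dual C V D \<longleftrightarrow> V \<in> Obj C \<and> D \<in> Obj C \<and>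
    (\<exists>ev coev a. ev \<in> Mor C (Tens C D V) (Unit C)
      \<and> coev \<in> Mor C (Unit C) (Tens C V D)
      \<and> is_inverse C (Tens C (Tens C D V) D) (Tens C D (Tens C V D)) (Assoc C D V D) a
      \<and> Comp C (RUnit C V) (Comp C (TensMor C (Id C V) ev)
          (Comp C (Assoc C V D V) (TensMor C coev (Id C V)))) = LUnit C V
      \<and> Comp C (LUnit C D) (Comp C (TensMor C ev (Id C D))
          (Comp C a (TensMor C (Id C D) coev))) = RUnit C D)"

locale fusion_category = abelian_category C + monoidal_linear_category C
  for C :: "('o, 'm, 'k::{alg_closed_field, field_char_0}) tensor_data" (structure) +
  assumes semisimple: "V \<in> Obj C \<Longrightarrow> \<exists>Ys. simple_decomposition C V Ys"
    and finite_Irr: "finite (Irr C)"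
    and finite_dim: "\<lbrakk>V \<in> Obj C; Y \<in> Obj C\<rbrakk>
      \<Longrightarrow> \<exists>B. finite B \<and> B \<subseteq> Mor C V Y
        \<and> (\<forall>f\<in>Mor C V Y. \<exists>c. f = finsum (Hom C V Y) (\<lambda>b. c b \<odot>\<^bsub>Hom C V Y\<^esub> b) B)"
    and simple_Unit: "simple_object C \<one>\<^sub>o"
    and ex_left_dual: "V \<in> Obj C \<Longrightarrow> \<exists>D. left_dual C V D"
    and ex_right_dual: "V \<in> Obj C \<Longrightarrow> \<exists>D. left_dual C D V"


section \<open>The adjoint subcategory and nilpotency\<close>

definition full_subcategory :: "('o, 'm, 'k) tensor_data \<Rightarrow> 'o set \<Rightarrow> ('o, 'm, 'k) tensor_data"
  where "full_subcategory C S = C\<lparr>Obj := S\<rparr>"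

text \<open>Object sets of full (replete, abelian, rigid) tensor subcategories. Repleteness is included
  in closure under direct sums, with one summand.\<close>

definition tensor_subcategory :: "('o, 'm, 'k) tensor_data \<Rightarrow> 'o set \<Rightarrow> bool"
  where "tensor_subcategory C S \<longleftrightarrow> S \<subseteq> Obj C \<and> Unit C \<in> S
    \<and> (\<forall>V\<in>S. \<forall>Y\<in>S. Tens C V Y \<in> S)
    \<and> (\<forall>V Ys. direct_sum C V Ys \<and> set Ys \<subseteq> S \<longrightarrow> V \<in> S)
    \<and> (\<forall>V Ys. direct_sum C V Ys \<and> V \<in> S \<longrightarrow> set Ys \<subseteq> S)
    \<and> (\<forall>V D. left_dual C V D \<longrightarrow> (V \<in> S \<longleftrightarrow> D \<in> S))"

definition generated_subcategory ::
    "('o, 'm, 'k) tensor_data \<Rightarrow> 'o set \<Rightarrow> ('o, 'm, 'k) tensor_data"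
  where "generated_subcategory C A = full_subcategory C (\<Inter>{S. tensor_subcategory C S \<and> A \<subseteq> S})"

definition adjoint_subcategory :: "('o, 'm, 'k) tensor_data \<Rightarrow> ('o, 'm, 'k) tensor_data"
  where "adjoint_subcategory C = generated_subcategory C
    {Z \<in> Obj C. \<exists>V D f. simple_object C V \<and> left_dual C V D \<and> monic C Z (Tens C V D) f}"

definition Vec_subcategory :: "('o, 'm, 'k) tensor_data \<Rightarrow> ('o, 'm, 'k) tensor_data"
  where "Vec_subcategory C = generated_subcategory C {Unit C}"

definition nilpotent :: "('o, 'm, 'k) tensor_data \<Rightarrow> bool"
  where "nilpotent C \<longleftrightarrow> (\<exists>n. (adjoint_subcategory ^^ n) C = Vec_subcategory C)"


section \<open>The Grothendieck ring and Frobenius-Perron dimensions\<close>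

text \<open>\<open>[V : c]\<close>, the multiplicity of the isomorphism class \<open>c\<close> of simple objects in \<open>V\<close>. By the
  Krull-Schmidt theorem it does not depend on the chosen decomposition.\<close>

definition multiplicity_in :: "('o, 'm, 'k) tensor_data \<Rightarrow> 'o \<Rightarrow> 'o set \<Rightarrow> nat"
  where "multiplicity_in C V c =
    length (filter (\<lambda>Y. Y \<in> c) (SOME Ys. simple_decomposition C V Ys))"

definition representative :: "'o set \<Rightarrow> 'o"
  where "representative c = (SOME V. V \<in> c)"

definition K0_class :: "('o, 'm, 'k) tensor_data \<Rightarrow> 'o \<Rightarrow> ('o set \<Rightarrow> int)"
  where "K0_class C V = (\<lambda>c. if c \<in> Irr C then int (multiplicity_in C V c) else 0)"

text \<open>The free abelian group on the (finitely many) isomorphism classes of simple objects, with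
  multiplication extending \<open>[V] [Y] = [V \<otimes> Y]\<close> bilinearly.\<close>

definition K0 :: "('o, 'm, 'k) tensor_data \<Rightarrow> ('o set \<Rightarrow> int) ring"
  where "K0 C = \<lparr>carrier = {u. \<forall>c. c \<notin> Irr C \<longrightarrow> u c = 0},
    monoid.mult = (\<lambda>u v c. \<Sum>x\<in>Irr C. \<Sum>y\<in>Irr C.
      u x * v y * K0_class C (Tens C (representative x) (representative y)) c),
    one = K0_class C (Unit C),
    ring.zero = (\<lambda>c. 0),
    add = (\<lambda>u v c. u c + v c)\<rparr>"

definition FP_character :: "('o, 'm, 'k) tensor_data \<Rightarrow> ('o set \<Rightarrow> int) \<Rightarrow> real"
  where "FP_character C = (THE \<phi>. \<phi> \<in> ring_hom (K0 C) (ring_of_type_algebra :: real ring)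
    \<and> \<phi> \<in> extensional (carrier (K0 C))
    \<and> (\<forall>V. simple_object C V \<longrightarrow> 0 < \<phi> (K0_class C V)))"

definition FPdim :: "('o, 'm, 'k) tensor_data \<Rightarrow> 'o \<Rightarrow> real"
  where "FPdim C V = FP_character C (K0_class C V)"

definition FPdim_cat :: "('o, 'm, 'k) tensor_data \<Rightarrow> real"
  where "FPdim_cat C = (\<Sum>c\<in>Irr C. (FPdim C (representative c))\<^sup>2)"

end

theory Submission
  imports Defs "HOL-Analysis.Function_Topology"
begin

text \<open>
  The quotient is an integer for reasons that concern only the multiplicities \<open>N x y z\<close> of \<open>z\<close> in
  \<open>x \<otimes> y\<close>, for classes of simple objects, and the dimension function \<open>d\<close>. Let \<open>T\<close> be a set of classes
  closed under products, duals and constituents. Calling \<open>y\<close> and \<open>z\<close> equivalent when \<open>z\<close> occurs in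
  \<open>s \<otimes> y\<close> for some \<open>s\<close> in \<open>T\<close> partitions the classes into components. Put \<open>D Y\<close> for the sum of
  the \<open>(d m)\<^sup>2\<close> over \<open>m\<close> in \<open>Y\<close>. Suppose that \<open>T\<close> is normal in a larger closed set \<open>S\<close>: all
  constituents of \<open>x \<otimes> s \<otimes> x\<^sup>*\<close> are in \<open>T\<close> for \<open>x\<close> in \<open>S\<close> and \<open>s\<close> in \<open>T\<close>. Then multiplication by
  \<open>x\<close> sends a component \<open>Y\<close> into a single component \<open>Z\<close> and \<open>x\<^sup>*\<close> sends \<open>Z\<close> back into \<open>Y\<close>. Summing
  \<open>d m * N x m n * d n\<close> over \<open>m\<close> in \<open>Y\<close> and \<open>n\<close> in \<open>Z\<close> in the two possible orders gives
  \<open>d x * D Y = d x\<^sup>* * D Z\<close>, hence \<open>D Y = D Z\<close> (\<open>component_dim_sum\<close>). So every component of \<open>S\<close> is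
  a disjoint union of components of \<open>T\<close> with the same value of \<open>D\<close>.

  The adjoint series of a nilpotent category descends to the unit class, whose components are
  singletons \<open>{y}\<close> with \<open>D {y} = (d y)\<^sup>2\<close>. Climbing the series, \<open>D Y / (d y)\<^sup>2\<close> is multiplied by an
  integer at each step, so it is an integer for the component \<open>Y\<close> of \<open>y\<close> under the adjoint
  subcategory (\<open>component_divisibility\<close>). One more comparison, now inside the whole category, shows
  that this component has the same \<open>D\<close> as the component of the unit, which is the adjoint
  subcategory itself and has \<open>D = FPdim\<close>.

  The adjoint subcategory is normal for the following reason. If \<open>z\<close> and \<open>z'\<close> both occur in \<open>x \<otimes> y\<close>,
  then \<open>z\<close> occurs in \<open>b \<otimes> z'\<close> for some \<open>b\<close> in \<open>x \<otimes> x\<^sup>*\<close>, so \<open>z \<otimes> z'\<^sup>*\<close> is contained in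
  \<open>(x \<otimes> x\<^sup>*) \<otimes> (z' \<otimes> z'\<^sup>*)\<close>. Therefore \<open>x \<otimes> (y \<otimes> y\<^sup>*) \<otimes> x\<^sup>*\<close>, which is built from such products, lies in
  the adjoint subcategory. The classes all of whose conjugates lie there form a closed set that
  contains the generators, so they are everything by minimality (\<open>conj_closed_subrule\<close>,
  \<open>adjoint_in_conj_closed\<close>).

  Two bridges connect this with the categorical definitions. First, over an algebraically closed field
  Schur's lemma turns multiplicities into dimensions of spaces of morphisms, and rigidity gives
  Frobenius reciprocity \<open>[A \<otimes> Y : Z] = [A\<^sup>* \<otimes> Z : Y]\<close> (\<open>mult_adjunction\<close>); with associativity and the unit
  this is all that the combinatorial part, the locale \<open>fusion_rule\<close>, presupposes. Second, the
  Frobenius-Perron character is defined by a unique description, so its existence (a Perron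
  eigenvector) and uniqueness have to be established for the category and for its subcategories;
  uniqueness identifies the dimensions computed in a subcategory with those of the whole category.
\<close>


section \<open>Positive matrices\<close>

text \<open>
  The argument of Collatz and Wielandt: among all probability vectors \<open>v\<close> and numbers \<open>l\<close> with
  \<open>v M \<ge> l v\<close> there is a pair with \<open>l\<close> maximal, by compactness. If the inequality were strict in some
  coordinate, then \<open>u = v M\<close> would satisfy \<open>u M > l u\<close> in every coordinate, because \<open>M\<close> is strictly
  positive, and \<open>l\<close> could be increased.
\<close>

lemma positive_matrix_left_eigenvector:
  fixes M :: "'a \<Rightarrow> 'a \<Rightarrow> real"
  assumes fin: "finite I" and ne: "I \<noteq> {}" and pos: "\<And>x y. x \<in> I \<Longrightarrow> y \<in> I \<Longrightarrow> 0 < M x y"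
  shows "\<exists>v l. (\<forall>x\<in>I. 0 < v x) \<and> (\<forall>y\<in>I. (\<Sum>x\<in>I. v x * M x y) = l * v y)"
proof -
  define K :: "('a \<Rightarrow> real) set" where
    "K = PiE UNIV (\<lambda>x. if x \<in> I then {0..1} else {0}) \<inter> {v. (\<Sum>x\<in>I. v x) = 1}"
  have cont: "continuous_on UNIV (\<lambda>v :: 'a \<Rightarrow> real. v x)" for x
    by (rule continuous_on_product_coordinates)
  have "compactin (product_topology (\<lambda>_::'a. euclideanreal) UNIV)
      (PiE UNIV (\<lambda>x. if x \<in> I then {0..1} else {0}))"
    by (subst compactin_PiE) auto
  hence "compact (PiE UNIV (\<lambda>x::'a. if x \<in> I then {0..1::real} else {0}))"
    by (simp add: euclidean_product_topology compactin_euclidean_iff)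
  moreover have "closed {v :: 'a \<Rightarrow> real. (\<Sum>x\<in>I. v x) = 1}"
    by (intro closed_Collect_eq continuous_on_sum cont continuous_on_const)
  ultimately have K: "compact K"
    unfolding K_def by (rule compact_Int_closed)
  have v0: "0 \<le> v x" if "v \<in> K" for v x
    using that unfolding K_def by (auto simp: PiE_iff Pi_iff split: if_splits dest!: spec[of _ x])
  have vs: "(\<Sum>x\<in>I. v x) = 1" if "v \<in> K" for v
    using that by (simp add: K_def)
  define B where "B = (\<Sum>x\<in>I. \<Sum>y\<in>I. M x y)"
  \<comment> \<open>the pairs with \<open>v M \<ge> l v\<close>; \<open>B\<close> bounds \<open>l\<close> because \<open>v\<close> has sum \<open>1\<close>\<close>
  define Q where "Q = (K \<times> {0..B}) \<inter> (\<Inter>y\<in>I. {p. snd p * fst p y \<le> (\<Sum>x\<in>I. fst p x * M x y)})"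
  have cont2: "continuous_on UNIV (\<lambda>p :: ('a \<Rightarrow> real) \<times> real. fst p x)" for x
    by (rule continuous_on_compose2[OF cont continuous_on_fst]) (auto intro: continuous_on_id)
  have "compact Q" unfolding Q_def
    by (intro compact_Int_closed compact_Times K compact_Icc closed_INT ballI closed_Collect_le
        continuous_on_mult continuous_on_sum cont2 continuous_on_snd continuous_on_id continuous_on_const)
  have B0: "0 \<le> B" unfolding B_def by (intro sum_nonneg less_imp_le pos)
  define u0 :: "'a \<Rightarrow> real" where "u0 = (\<lambda>x. if x \<in> I then 1 / card I else 0)"
  have cI: "card I > 0" using fin ne by (simp add: card_gt_0_iff)
  have "u0 \<in> K" using cI fin unfolding K_def u0_def by (auto simp: PiE_iff divide_simps)
  hence "(u0, 0) \<in> Q" unfolding Q_def using B0 v0 less_imp_le[OF pos]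
    by (auto intro!: sum_nonneg mult_nonneg_nonneg)
  hence "Q \<noteq> {}" by auto
  obtain p where p: "p \<in> Q" and pmax: "\<And>q. q \<in> Q \<Longrightarrow> snd q \<le> snd p"
    using continuous_attains_sup[OF \<open>compact Q\<close> \<open>Q \<noteq> {}\<close> continuous_on_snd[OF continuous_on_id]] by auto
  define v l where "v = fst p" and "l = snd p"
  have vK: "v \<in> K" and l0: "0 \<le> l" and ineq: "\<And>y. y \<in> I \<Longrightarrow> l * v y \<le> (\<Sum>x\<in>I. v x * M x y)"
    using p unfolding Q_def v_def l_def by auto
  define u where "u = (\<lambda>y. \<Sum>x\<in>I. v x * M x y)"
  have upos_gen: "0 < (\<Sum>x\<in>I. w x * M x y)"
    if y: "y \<in> I" and w: "\<And>x. x \<in> I \<Longrightarrow> 0 \<le> w x" "x0 \<in> I" "0 < w x0" for w y x0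
    by (rule sum_pos2[OF fin w(2)]) (use w y in \<open>auto intro!: mult_pos_pos mult_nonneg_nonneg pos less_imp_le[OF pos]\<close>)
  have "\<exists>x0\<in>I. 0 < v x0"
  proof (rule ccontr)
    assume "\<not> (\<exists>x0\<in>I. 0 < v x0)"
    hence "v x = 0" if "x \<in> I" for x using that v0[OF vK, of x] by force
    hence "(\<Sum>x\<in>I. v x) = 0" by simp
    thus False using vs[OF vK] by simp
  qed
  then obtain x0 where x0: "x0 \<in> I" "0 < v x0" by blast
  have upos: "0 < u y" if "y \<in> I" for y
    unfolding u_def by (rule upos_gen[of _ _ x0]) (use that x0 v0[OF vK] in auto)
  have eq: "u y = l * v y" if yI: "y \<in> I" for y
  proof (rule ccontr)
    assume "u y \<noteq> l * v y"
    with ineq[OF yI] have y: "0 < u y - l * v y" by (simp add: u_def)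
    have strict: "l * u z < (\<Sum>x\<in>I. u x * M x z)" if z: "z \<in> I" for z
    proof -
      have "0 < (\<Sum>x\<in>I. (u x - l * v x) * M x z)"
        by (rule upos_gen[of _ _ y]) (use z yI y ineq in \<open>auto simp: u_def\<close>)
      also have "\<dots> = (\<Sum>x\<in>I. u x * M x z) - l * u z"
        by (simp add: u_def algebra_simps sum_subtractf sum_distrib_left)
      finally show ?thesis by simp
    qed
    \<comment> \<open>the largest admissible value of \<open>l\<close> for the improved vector \<open>u\<close>\<close>
    define l' where "l' = Min ((\<lambda>z. (\<Sum>x\<in>I. u x * M x z) / u z) ` I)"
    have l'1: "l < l'"
      unfolding l'_def using fin ne strict upos by (subst Min_gr_iff) (auto simp: field_simps)
    have l'2: "l' * u z \<le> (\<Sum>x\<in>I. u x * M x z)" if "z \<in> I" for z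
    proof -
      have "l' \<le> (\<Sum>x\<in>I. u x * M x z) / u z"
        unfolding l'_def using fin that by (intro Min_le) auto
      thus ?thesis using upos[OF that] by (simp add: field_simps)
    qed
    define s where "s = (\<Sum>x\<in>I. u x)"
    have s: "0 < s" unfolding s_def using fin ne upos by (intro sum_pos) auto
    define w where "w = (\<lambda>x. if x \<in> I then u x / s else 0)"
    have ws: "(\<Sum>x\<in>I. w x) = 1" using s by (simp add: w_def s_def flip: sum_divide_distrib)
    have w0: "0 \<le> w x" for x using upos s by (auto simp: w_def less_imp_le)
    have w1: "w x \<le> 1" if "x \<in> I" for x
      using member_le_sum[of x I w] that fin w0 ws by auto
    have wK: "w \<in> K" unfolding K_def using ws w0 w1 by (auto simp: PiE_iff) (simp add: w_def)
    have wle: "l' * w z \<le> (\<Sum>x\<in>I. w x * M x z)" if "z \<in> I" for z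
      using l'2[OF that] s that by (simp add: w_def divide_right_mono field_simps flip: sum_divide_distrib)
    have "l' = (\<Sum>z\<in>I. l' * w z)" using ws by (simp flip: sum_distrib_left)
    also have "\<dots> \<le> (\<Sum>z\<in>I. \<Sum>x\<in>I. w x * M x z)" using wle by (intro sum_mono)
    also have "\<dots> \<le> (\<Sum>z\<in>I. \<Sum>x\<in>I. M x z)"
      using w1 w0 pos by (intro sum_mono) (simp add: less_imp_le mult_left_le_one_le)
    also have "\<dots> = B" unfolding B_def by (rule sum.swap)
    finally have "(w, l') \<in> Q" unfolding Q_def using wK wle l'1 l0 by auto
    from pmax[OF this] l'1 show False by (simp add: l_def)
  qed
  have lpos: "0 < l" using upos[OF x0(1)] eq[OF x0(1)] l0 by (metis less_eq_real_def mult_zero_left)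
  have "0 < v x" if "x \<in> I" for x
    using upos[OF that] eq[OF that] lpos by (simp add: zero_less_mult_iff)
  moreover have "(\<Sum>x\<in>I. v x * M x y) = l * v y" if "y \<in> I" for y
    using eq[OF that] by (simp add: u_def)
  ultimately show ?thesis by blast
qed

text \<open>
  Subtracting from \<open>w\<close> the largest multiple of \<open>v\<close> that stays below it leaves a nonnegative
  eigenvector with a zero coordinate, which a strictly positive matrix forces to vanish.
\<close>

lemma positive_matrix_eigenvector_unique:
  fixes M :: "'a \<Rightarrow> 'a \<Rightarrow> real"
  assumes fin: "finite I" and ne: "I \<noteq> {}" and pos: "\<And>x y. x \<in> I \<Longrightarrow> y \<in> I \<Longrightarrow> 0 < M x y"
    and v: "\<And>x. x \<in> I \<Longrightarrow> 0 < v x" "\<And>y. y \<in> I \<Longrightarrow> (\<Sum>x\<in>I. v x * M x y) = l * v y"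
    and w: "\<And>y. y \<in> I \<Longrightarrow> (\<Sum>x\<in>I. w x * M x y) = l * w y"
  shows "\<exists>c. \<forall>x\<in>I. w x = c * v x"
proof -
  define c where "c = Min ((\<lambda>x. w x / v x) ` I)"
  have "c \<in> (\<lambda>x. w x / v x) ` I" unfolding c_def using fin ne by (intro Min_in) auto
  then obtain y where y: "y \<in> I" "w y = c * v y" using v(1) by force
  have ge: "c * v x \<le> w x" if "x \<in> I" for x
  proof -
    have "c \<le> w x / v x" unfolding c_def using fin that by (intro Min_le) auto
    thus ?thesis using v(1)[OF that] by (simp add: field_simps)
  qed
  have "(\<Sum>x\<in>I. (w x - c * v x) * M x y) = l * (w y - c * v y)"
    using v(2)[OF y(1)] w[OF y(1)]
    by (simp add: left_diff_distrib right_diff_distrib sum_subtractf mult.assoc flip: sum_distrib_left)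
  also have "\<dots> = 0" using y by simp
  finally have "\<forall>x\<in>I. (w x - c * v x) * M x y = 0"
    using ge less_imp_le[OF pos[OF _ y(1)]] fin by (subst (asm) sum_nonneg_eq_0_iff) auto
  hence "\<forall>x\<in>I. w x = c * v x" using pos[OF _ y(1)] by force
  thus ?thesis by blast
qed


section \<open>Fusion rules\<close>

text \<open>
  The structure constants of a based ring, such as the Grothendieck ring of a fusion category. Duality
  enters only through the last assumption. It is what an adjunction between tensoring with \<open>x\<close> and
  with its dual \<open>D\<close> says when \<open>N x d e\<close> is read as the multiplicity of \<open>d\<close> in \<open>D\<close>; that \<open>D\<close> is again
  simple, and that duality is an involution, are consequences.
\<close>

locale fusion_rule =
  fixes I :: "'a set" and N :: "'a \<Rightarrow> 'a \<Rightarrow> 'a \<Rightarrow> nat" and e :: 'a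
  assumes finite_I: "finite I" and e_in: "e \<in> I"
    and N_assoc: "\<lbrakk>x \<in> I; y \<in> I; z \<in> I; t \<in> I\<rbrakk>
      \<Longrightarrow> (\<Sum>w\<in>I. N x y w * N w z t) = (\<Sum>w\<in>I. N y z w * N x w t)"
    and N_unit_left: "\<lbrakk>y \<in> I; z \<in> I\<rbrakk> \<Longrightarrow> N e y z = (if y = z then 1 else 0)"
    and N_unit_right: "\<lbrakk>y \<in> I; z \<in> I\<rbrakk> \<Longrightarrow> N y e z = (if y = z then 1 else 0)"
    and N_frobenius: "\<lbrakk>x \<in> I; y \<in> I; z \<in> I\<rbrakk> \<Longrightarrow> N x y z = (\<Sum>d\<in>I. N x d e * N d z y)"
begin

text \<open>
  Reciprocity for the unit says that the matrix \<open>(N x d e)\<close> is its own inverse. A nonnegative integer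
  matrix with this property is a permutation matrix.
\<close>

lemma ex_dual: "x \<in> I \<Longrightarrow> \<exists>x'\<in>I. N x' x e = 1 \<and> (\<forall>d\<in>I. N x d e = (if d = x' then 1 else 0))"
proof -
  have square: "(\<Sum>d\<in>I. N a d e * N d b e) = (if a = b then 1 else 0)" if "a \<in> I" "b \<in> I" for a b
    using N_frobenius[OF that(1) e_in that(2)] N_unit_right[OF that] by simp
  have zero: "a = b" if "a \<in> I" "b \<in> I" "d \<in> I" "0 < N a d e" "0 < N d b e" for a b d
  proof (rule ccontr)
    assume "a \<noteq> b"
    hence "(\<Sum>d\<in>I. N a d e * N d b e) = 0" using square[OF that(1,2)] by simp
    hence "N a d e * N d b e = 0" using finite_I that(3) by simp
    thus False using that by simp
  qed
  assume x: "x \<in> I"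
  have "(\<Sum>d\<in>I. N x d e * N d x e) \<noteq> 0" using square[OF x x] by simp
  then obtain x' where x': "x' \<in> I" "0 < N x x' e" "0 < N x' x e"
    using finite_I by auto
  have unique: "N x d e = 0" if "d \<in> I" "d \<noteq> x'" for d
    using zero[OF x'(1) that(1) x x'(3)] that(2) by auto
  have "1 = (\<Sum>d\<in>I. N x d e * N d x e)" using square[OF x x] by simp
  also have "\<dots> = (\<Sum>d\<in>{x'}. N x d e * N d x e)"
    by (rule sum.mono_neutral_right) (use finite_I x' unique in auto)
  finally have "N x x' e = 1" "N x' x e = 1" by auto
  thus ?thesis using x'(1) unique by auto
qed

definition dual :: "'a \<Rightarrow> 'a" where
  "dual x = (SOME x'. x' \<in> I \<and> N x' x e = 1 \<and> (\<forall>d\<in>I. N x d e = (if d = x' then 1 else 0)))"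

lemma dual: "x \<in> I \<Longrightarrow> dual x \<in> I \<and> N (dual x) x e = 1 \<and> (\<forall>d\<in>I. N x d e = (if d = dual x then 1 else 0))"
  unfolding dual_def by (rule someI_ex) (use ex_dual in blast)

lemma dual_in [simp]: "x \<in> I \<Longrightarrow> dual x \<in> I"
  and N_dual: "x \<in> I \<Longrightarrow> d \<in> I \<Longrightarrow> N x d e = (if d = dual x then 1 else 0)"
  using dual by blast+

lemma dual_dual [simp]: "x \<in> I \<Longrightarrow> dual (dual x) = x"
  by (metis dual N_dual zero_neq_one)

lemma dual_eq_iff: "\<lbrakk>x \<in> I; y \<in> I\<rbrakk> \<Longrightarrow> dual x = dual y \<longleftrightarrow> x = y"
  using dual_dual by metis

lemma N_left: "\<lbrakk>x \<in> I; y \<in> I; z \<in> I\<rbrakk> \<Longrightarrow> N x y z = N (dual x) z y"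
  using finite_I by (simp add: N_frobenius[of x y z] N_dual if_distrib[of "\<lambda>t. t * _"] cong: if_cong)

text \<open>
  Both sides are the multiplicity of the unit in the triple product of \<open>x\<close>, \<open>y\<close> and the dual of \<open>z\<close>.
\<close>

lemma N_cyclic:
  assumes "x \<in> I" "y \<in> I" "z \<in> I"
  shows "N x y z = N y (dual z) (dual x)"
proof -
  have "N x y z = (\<Sum>w\<in>I. N x y w * N w (dual z) e)"
    using assms finite_I by (subst sum.remove[of _ z]) (auto simp: N_dual dual_eq_iff intro!: sum.neutral)
  also have "\<dots> = (\<Sum>w\<in>I. N y (dual z) w * N x w e)"
    using assms e_in by (intro N_assoc) auto
  also have "\<dots> = N y (dual z) (dual x)"
    using assms finite_I by (subst sum.remove[of _ "dual x"]) (auto simp: N_dual dual_eq_iff intro!: sum.neutral)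
  finally show ?thesis .
qed

lemma N_antihom: "\<lbrakk>x \<in> I; y \<in> I; z \<in> I\<rbrakk> \<Longrightarrow> N x y z = N (dual y) (dual x) (dual z)"
  using N_cyclic[of x y z] N_left[of y "dual z" "dual x"] by simp

lemma N_right: "\<lbrakk>x \<in> I; y \<in> I; z \<in> I\<rbrakk> \<Longrightarrow> N x y z = N z (dual y) x"
  using N_antihom[of x y z] N_left[of "dual y" "dual x" "dual z"] N_antihom[of y "dual z" "dual x"]
  by simp

text \<open>
  Since \<open>N x y z > 0\<close> means that \<open>z\<close> is a constituent of \<open>x \<otimes> y\<close>, associativity and reciprocity become
  rules about this ternary relation, and most of the combinatorics needs no more than them.
\<close>

definition in_product :: "'a \<Rightarrow> 'a \<Rightarrow> 'a \<Rightarrow> bool" where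
  "in_product x y z \<longleftrightarrow> x \<in> I \<and> y \<in> I \<and> z \<in> I \<and> 0 < N x y z"

lemma in_product_in: "in_product x y z \<Longrightarrow> x \<in> I \<and> y \<in> I \<and> z \<in> I"
  by (simp add: in_product_def)

lemma in_product_assoc:
  "(\<exists>w. in_product x y w \<and> in_product w z t) \<longleftrightarrow> (\<exists>w. in_product y z w \<and> in_product x w t)"
proof (cases "x \<in> I \<and> y \<in> I \<and> z \<in> I \<and> t \<in> I")
  case True
  have "(\<exists>w. in_product x y w \<and> in_product w z t) \<longleftrightarrow> (\<Sum>w\<in>I. N x y w * N w z t) \<noteq> 0"
    using True finite_I by (auto simp: in_product_def)
  also have "\<dots> \<longleftrightarrow> (\<Sum>w\<in>I. N y z w * N x w t) \<noteq> 0"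
    using True by (simp add: N_assoc)
  also have "\<dots> \<longleftrightarrow> (\<exists>w. in_product y z w \<and> in_product x w t)"
    using True finite_I by (auto simp: in_product_def)
  finally show ?thesis .
qed (auto simp: in_product_def)

lemma in_product_assocE1:
  assumes "in_product x y w" "in_product w z t"
  obtains v where "in_product y z v" "in_product x v t"
  using in_product_assoc assms by blast

lemma in_product_assocE2:
  assumes "in_product y z v" "in_product x v t"
  obtains w where "in_product x y w" "in_product w z t"
  using in_product_assoc assms by blast

lemma in_product_left: "in_product x y z \<Longrightarrow> in_product (dual x) z y"
  unfolding in_product_def using N_left[of x y z] by simp

lemma in_product_right: "in_product x y z \<Longrightarrow> in_product z (dual y) x"
  unfolding in_product_def using N_right[of x y z] by simp

lemma in_product_antihom: "in_product x y z \<Longrightarrow> in_product (dual y) (dual x) (dual z)"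
  unfolding in_product_def using N_antihom[of x y z] by simp

lemma in_product_unit: "x \<in> I \<Longrightarrow> in_product e x x" "x \<in> I \<Longrightarrow> in_product x e x"
  unfolding in_product_def using e_in by (simp_all add: N_unit_left N_unit_right)

lemma in_product_unitD: "in_product e x y \<Longrightarrow> x = y" "in_product x e y \<Longrightarrow> x = y"
  unfolding in_product_def by (auto simp: N_unit_left N_unit_right split: if_splits)

lemma in_product_dual: "x \<in> I \<Longrightarrow> in_product x (dual x) e" "x \<in> I \<Longrightarrow> in_product (dual x) x e"
  using in_product_left in_product_right in_product_unit by blast+

lemma dual_e [simp]: "dual e = e"
  using in_product_dual(1)[OF e_in] in_product_unitD by blast

lemma ex_in_product: "\<lbrakk>x \<in> I; y \<in> I\<rbrakk> \<Longrightarrow> \<exists>z. in_product x y z"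
  using in_product_assocE1[OF in_product_dual(2) in_product_unit(1), of x y] by blast

lemma ex_middle_factor: "\<lbrakk>x \<in> I; z \<in> I\<rbrakk> \<Longrightarrow> \<exists>y. in_product x y z"
proof -
  assume "x \<in> I" "z \<in> I"
  then obtain y where "in_product (dual x) z y" using ex_in_product[of "dual x" z] by auto
  from in_product_left[OF this] \<open>x \<in> I\<close> show ?thesis by auto
qed

definition character :: "('a \<Rightarrow> real) \<Rightarrow> bool" where
  "character d \<longleftrightarrow> (\<forall>x\<in>I. 0 < d x) \<and> (\<forall>x\<in>I. \<forall>y\<in>I. d x * d y = (\<Sum>z\<in>I. real (N x y z) * d z))"

lemma character_pos: "character d \<Longrightarrow> x \<in> I \<Longrightarrow> 0 < d x"
  and character_mult: "character d \<Longrightarrow> x \<in> I \<Longrightarrow> y \<in> I \<Longrightarrow> d x * d y = (\<Sum>z\<in>I. real (N x y z) * d z)"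
  by (auto simp: character_def)

text \<open>
  Right multiplication by the sum of all basis elements has a strictly positive matrix. Left
  multiplications commute with it, so they preserve its Perron eigenspace, a line; the scalar by which
  \<open>x\<close> acts on that line is \<open>d x\<close>.
\<close>

lemma ex_character: "\<exists>d. character d"
proof -
  \<comment> \<open>right multiplication by the sum of all basis elements\<close>
  define M where "M = (\<lambda>x y. real (\<Sum>s\<in>I. N x s y))"
  have Mpos: "0 < M x y" if xy: "x \<in> I" "y \<in> I" for x y
  proof -
    obtain s where "in_product x s y" using ex_middle_factor[OF xy] by blast
    hence "s \<in> I" "0 < N x s y" by (auto simp: in_product_def)
    hence "0 < (\<Sum>s\<in>I. N x s y)" using finite_I by (meson sum_pos2 zero_le)
    thus ?thesis by (simp only: M_def of_nat_0_less_iff)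
  qed
  have ne: "I \<noteq> {}" using e_in by auto
  obtain v l where v: "\<And>x. x \<in> I \<Longrightarrow> 0 < v x" and eig: "\<And>y. y \<in> I \<Longrightarrow> (\<Sum>x\<in>I. v x * M x y) = l * v y"
    using positive_matrix_left_eigenvector[of I M] finite_I ne Mpos by blast
  \<comment> \<open>\<open>T x\<close> is the eigenvector \<open>v\<close> multiplied by \<open>x\<close> from the left\<close>
  define T where "T x z = (\<Sum>y\<in>I. v y * real (N x y z))" for x z
  have Tpos: "0 < T x z" if xz: "x \<in> I" "z \<in> I" for x z
  proof -
    obtain y where y: "in_product x y z" using ex_middle_factor[OF xz] by blast
    show ?thesis unfolding T_def
      by (rule sum_pos2[OF finite_I, of y])
        (use y v in \<open>auto simp: in_product_def intro!: mult_nonneg_nonneg less_imp_le[OF v]\<close>)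
  qed
  have "\<exists>c. \<forall>z\<in>I. T x z = c * v z" if x: "x \<in> I" for x
  proof -
    have "(\<Sum>z\<in>I. T x z * M z w) = l * T x w" if w: "w \<in> I" for w
    proof -
      \<comment> \<open>left and right multiplication commute\<close>
      have assoc: "(\<Sum>z\<in>I. real (N x y z) * M z w) = (\<Sum>z\<in>I. M y z * real (N x z w))" if y: "y \<in> I" for y
      proof -
        have "(\<Sum>z\<in>I. N x y z * (\<Sum>s\<in>I. N z s w)) = (\<Sum>s\<in>I. \<Sum>z\<in>I. N x y z * N z s w)"
          by (subst sum.swap) (simp add: sum_distrib_left)
        also have "\<dots> = (\<Sum>s\<in>I. \<Sum>z\<in>I. N y s z * N x z w)"
          using x y w by (intro sum.cong refl N_assoc)
        also have "\<dots> = (\<Sum>z\<in>I. (\<Sum>s\<in>I. N y s z) * N x z w)"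
          by (subst sum.swap) (simp add: sum_distrib_right)
        finally show ?thesis unfolding M_def
          by (simp only: of_nat_mult[symmetric] of_nat_sum[symmetric])
      qed
      have "(\<Sum>z\<in>I. T x z * M z w) = (\<Sum>y\<in>I. v y * (\<Sum>z\<in>I. real (N x y z) * M z w))"
        unfolding T_def sum_distrib_right sum_distrib_left
        by (subst sum.swap) (simp add: mult.assoc)
      also have "\<dots> = (\<Sum>y\<in>I. v y * (\<Sum>z\<in>I. M y z * real (N x z w)))"
        using assoc by simp
      also have "\<dots> = (\<Sum>z\<in>I. (\<Sum>y\<in>I. v y * M y z) * real (N x z w))"
        unfolding sum_distrib_right sum_distrib_left
        by (subst sum.swap) (simp add: mult.assoc)
      also have "\<dots> = l * T x w" unfolding T_def by (simp add: eig sum_distrib_left mult.assoc)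
      finally show ?thesis .
    qed
    thus ?thesis
      by (intro positive_matrix_eigenvector_unique[of I M v l "T x"]) (simp_all add: finite_I ne Mpos v eig)
  qed
  then obtain d where d: "\<And>x z. x \<in> I \<Longrightarrow> z \<in> I \<Longrightarrow> T x z = d x * v z" by metis
  have "0 < d x" if "x \<in> I" for x
    using Tpos[OF that e_in] d[OF that e_in] v[OF e_in] by (simp add: zero_less_mult_iff)
  moreover have "d x * d y = (\<Sum>z\<in>I. real (N x y z) * d z)" if x: "x \<in> I" and y: "y \<in> I" for x y
  proof -
    have "d x * d y * v e = d y * T x e" using d[OF x e_in] by simp
    also have "\<dots> = (\<Sum>u\<in>I. T y u * real (N x u e))"
      unfolding T_def[of x] using d[OF y] by (simp add: sum_distrib_left mult.assoc)
    also have "\<dots> = (\<Sum>s\<in>I. v s * real (\<Sum>u\<in>I. N y s u * N x u e))"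
      unfolding T_def sum_distrib_right of_nat_sum sum_distrib_left
      by (subst sum.swap) (simp add: mult.assoc)
    also have "\<dots> = (\<Sum>s\<in>I. v s * real (\<Sum>z\<in>I. N x y z * N z s e))"
      using N_assoc[OF x y _ e_in] by simp
    also have "\<dots> = (\<Sum>z\<in>I. real (N x y z) * T z e)"
      unfolding T_def of_nat_sum sum_distrib_left
      by (subst sum.swap) (simp add: mult_ac)
    also have "\<dots> = (\<Sum>z\<in>I. real (N x y z) * d z) * v e"
      using d[OF _ e_in] by (simp add: sum_distrib_right mult.assoc)
    finally show ?thesis using v[OF e_in] by simp
  qed
  ultimately show ?thesis unfolding character_def by blast
qed

text \<open>
  By reciprocity the sum of all \<open>d y y\<close> is an eigenvector of left multiplication by \<open>x\<close>, with eigenvalue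
  \<open>d (dual x)\<close>.
\<close>

lemma character_dual_eigen:
  assumes d: "character d" and x: "x \<in> I" and z: "z \<in> I"
  shows "(\<Sum>y\<in>I. d y * real (N x y z)) = d (dual x) * d z"
  unfolding character_mult[OF d dual_in[OF x] z]
  by (intro sum.cong refl) (use x z in \<open>simp add: N_left[of x _ z]\<close>)

text \<open>
  Let \<open>r\<close> be the sum of all \<open>d y y\<close>, so that \<open>x r = d (dual x) r\<close>. Applying the character \<open>f\<close> gives
  \<open>f x f r = d (dual x) f r\<close> with \<open>f r > 0\<close>. For \<open>f = d\<close> this is invariance under
  duality, and the general case then is uniqueness.
\<close>

lemma character_unique_dual:
  assumes d: "character d" and f: "character f" and x: "x \<in> I"
  shows "f x = d (dual x)"
proof -
  define R where "R = (\<Sum>y\<in>I. d y * f y)"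
  have R: "0 < R" unfolding R_def
    by (rule sum_pos[OF finite_I]) (use e_in in \<open>auto intro!: mult_pos_pos character_pos[OF d] character_pos[OF f]\<close>)
  have "f x * R = (\<Sum>y\<in>I. d y * (f x * f y))" by (simp add: R_def sum_distrib_left mult_ac)
  also have "\<dots> = (\<Sum>z\<in>I. (\<Sum>y\<in>I. d y * real (N x y z)) * f z)"
    unfolding sum_distrib_right
    by (subst sum.swap) (simp add: character_mult[OF f x] sum_distrib_left mult.assoc)
  also have "\<dots> = d (dual x) * R"
    using character_dual_eigen[OF d x] by (simp add: R_def sum_distrib_left mult.assoc)
  finally show ?thesis using R by simp
qed

lemma character_dual: "character d \<Longrightarrow> x \<in> I \<Longrightarrow> d (dual x) = d x"
  using character_unique_dual[of d d x] by simp

lemma character_unique: "character d \<Longrightarrow> character f \<Longrightarrow> x \<in> I \<Longrightarrow> f x = d x"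
  using character_unique_dual[of d f x] character_dual by simp

lemma character_e: "character d \<Longrightarrow> d e = 1"
proof -
  assume d: "character d"
  have "d e * d e = (\<Sum>z\<in>I. real (N e e z) * d z)" using character_mult[OF d e_in e_in] .
  also have "\<dots> = (\<Sum>z\<in>I. if z = e then d z else 0)"
    by (intro sum.cong refl) (auto simp: N_unit_left e_in)
  also have "\<dots> = d e" using finite_I e_in by simp
  finally show ?thesis using character_pos[OF d e_in] by simp
qed

text \<open>
  The combinatorial shadow of a fusion subcategory.
\<close>

definition subrule :: "'a set \<Rightarrow> bool" where
  "subrule T \<longleftrightarrow> T \<subseteq> I \<and> e \<in> T \<and> (\<forall>x\<in>T. \<forall>y\<in>T. \<forall>z. in_product x y z \<longrightarrow> z \<in> T) \<and> (\<forall>x\<in>T. dual x \<in> T)"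

lemma subruleD:
  assumes "subrule T"
  shows "T \<subseteq> I" "e \<in> T" "\<And>x y z. x \<in> T \<Longrightarrow> y \<in> T \<Longrightarrow> in_product x y z \<Longrightarrow> z \<in> T"
    "\<And>x. x \<in> T \<Longrightarrow> dual x \<in> T"
  using assms unfolding subrule_def by blast+

lemma subrule_N_outside:
  "subrule T \<Longrightarrow> x \<in> T \<Longrightarrow> y \<in> T \<Longrightarrow> z \<in> I \<Longrightarrow> z \<notin> T \<Longrightarrow> N x y z = 0"
  using subruleD(3)[of T x y z] subruleD(1)[of T] unfolding in_product_def by (auto simp: subset_iff)

lemma subrule_I: "subrule I"
  unfolding subrule_def in_product_def using e_in by auto

lemma subrule_e: "subrule {e}"
  unfolding subrule_def using e_in in_product_unitD by auto

lemma subrule_fusion_rule: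
  assumes T: "subrule T"
  shows "fusion_rule T N e"
proof
  note TI = subruleD(1)[OF T]
  show "finite T" using finite_subset[OF TI finite_I] .
  show "e \<in> T" using subruleD(2)[OF T] .
  fix y z assume yz: "y \<in> T" "z \<in> T"
  show "N e y z = (if y = z then 1 else 0)" "N y e z = (if y = z then 1 else 0)"
    using N_unit_left N_unit_right TI yz by blast+
  fix x assume x: "x \<in> T"
  have "N x d e = 0" if "d \<in> I" "d \<notin> T" for d
    using that x N_dual[of x d] subruleD(4)[OF T x] TI by auto
  thus "N x y z = (\<Sum>d\<in>T. N x d e * N d z y)"
    using x yz TI
    by (subst N_frobenius) (auto intro!: sum.mono_neutral_right finite_I)
  fix t assume t: "t \<in> T"
  have restrict: "(\<Sum>w\<in>T. N a b w * f w) = (\<Sum>w\<in>I. N a b w * f w)" if "a \<in> T" "b \<in> T" for a b and f :: "'a \<Rightarrow> nat"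
    by (rule sum.mono_neutral_left[OF finite_I TI]) (use subrule_N_outside[OF T that] in auto)
  show "(\<Sum>w\<in>T. N x y w * N w z t) = (\<Sum>w\<in>T. N y z w * N x w t)"
    unfolding restrict[OF x yz(1)] restrict[OF yz] using N_assoc x yz t TI by blast
qed

lemma subrule_character:
  assumes T: "subrule T" and d: "character d"
  shows "fusion_rule.character T N d"
proof -
  interpret T: fusion_rule T N e by (rule subrule_fusion_rule[OF T])
  have "(\<Sum>z\<in>T. real (N x y z) * d z) = (\<Sum>z\<in>I. real (N x y z) * d z)" if "x \<in> T" "y \<in> T" for x y
    by (rule sum.mono_neutral_left[OF finite_I subruleD(1)[OF T]]) (use subrule_N_outside[OF T that] in auto)
  thus ?thesis unfolding T.character_def
    using subruleD(1)[OF T] character_mult[OF d] character_pos[OF d] by (auto simp: subset_iff)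
qed

text \<open>
  The indecomposable \<open>T\<close>-submodule generated by \<open>y\<close>; reciprocity makes membership symmetric.
\<close>

definition component :: "'a set \<Rightarrow> 'a \<Rightarrow> 'a set" where
  "component T y = {z. \<exists>s\<in>T. in_product s y z}"

lemma component_subset: "component T y \<subseteq> I"
  unfolding component_def in_product_def by auto

lemma component_refl: "subrule T \<Longrightarrow> y \<in> I \<Longrightarrow> y \<in> component T y"
  unfolding component_def using in_product_unit subruleD(2) by auto

lemma component_sym: "subrule T \<Longrightarrow> z \<in> component T y \<Longrightarrow> y \<in> component T z"
  unfolding component_def using in_product_left subruleD(4) by blast

lemma component_trans:
  assumes T: "subrule T" and "w \<in> component T z" "z \<in> component T y"
  shows "w \<in> component T y"
proof -
  obtain s t where st: "s \<in> T" "t \<in> T" "in_product t z w" "in_product s y z"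
    using assms unfolding component_def by blast
  obtain u where "in_product t s u" "in_product u y w" using in_product_assocE2[OF st(4,3)] .
  thus ?thesis unfolding component_def using subruleD(3)[OF T] st by blast
qed

lemma component_eq: "subrule T \<Longrightarrow> z \<in> component T y \<Longrightarrow> component T z = component T y"
  using component_trans component_sym by blast

lemma component_e: "subrule T \<Longrightarrow> component T e = T"
  unfolding component_def using in_product_unit in_product_unitD subruleD(1) by blast

definition normal_in :: "'a set \<Rightarrow> 'a set \<Rightarrow> bool" where
  "normal_in T S \<longleftrightarrow> (\<forall>x\<in>S. \<forall>s\<in>T. \<forall>w v. in_product x s w \<longrightarrow> in_product w (dual x) v \<longrightarrow> v \<in> T)"

definition dim_sum :: "('a \<Rightarrow> real) \<Rightarrow> 'a set \<Rightarrow> real" where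
  "dim_sum d Y = (\<Sum>m\<in>Y. (d m)\<^sup>2)"

text \<open>
  If \<open>z\<close> occurs in \<open>x \<otimes> y\<close> and \<open>n\<close> in \<open>x \<otimes> s \<otimes> y\<close> with \<open>s\<close> in \<open>T\<close>, then \<open>y\<close> occurs in \<open>x\<^sup>* \<otimes> z\<close>, so \<open>n\<close> occurs in
  \<open>(x \<otimes> s \<otimes> x\<^sup>*) \<otimes> z\<close>, and normality applies to the first factor.
\<close>

lemma component_action:
  assumes T: "subrule T" and nrm: "normal_in T S" and x: "x \<in> S"
    and xyz: "in_product x y z" and xmn: "in_product x m n" and m: "m \<in> component T y"
  shows "n \<in> component T z"
proof -
  obtain s where s: "s \<in> T" "in_product s y m" using m by (auto simp: component_def)
  obtain w where w: "in_product x s w" "in_product w y n" using in_product_assocE2[OF s(2) xmn] .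
  obtain v where v: "in_product w (dual x) v" "in_product v z n"
    using in_product_assocE2[OF in_product_left[OF xyz] w(2)] .
  have "v \<in> T" using nrm x s(1) w(1) v(1) unfolding normal_in_def by blast
  thus ?thesis using v(2) by (auto simp: component_def)
qed

text \<open>
  Multiplication by \<open>x\<close> maps the component of \<open>y\<close> to that of \<open>z\<close> and multiplication by the dual of \<open>x\<close> maps
  it back, so in the double sum of \<open>d m * N x m n * d n\<close> each inner sum can be extended over all
  classes, where it is evaluated by multiplicativity of \<open>d\<close>.
\<close>

lemma component_dim_sum:
  assumes T: "subrule T" and S: "subrule S" and nrm: "normal_in T S" and d: "character d"
    and x: "x \<in> S" and xyz: "in_product x y z"
  shows "dim_sum d (component T y) = dim_sum d (component T z)"
proof -
  let ?Y = "component T y" and ?Z = "component T z"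
  have xI: "x \<in> I" using x subruleD(1)[OF S] by auto
  have fwd: "n \<in> ?Z" if "in_product x m n" "m \<in> ?Y" for m n
    using component_action[OF T nrm x xyz that] .
  have bwd: "m \<in> ?Y" if "in_product x m n" "n \<in> ?Z" for m n
    using component_action[OF T nrm subruleD(4)[OF S x] in_product_left[OF xyz] in_product_left[OF that(1)] that(2)] .
  have "d x * dim_sum d ?Y = (\<Sum>m\<in>?Y. d m * (d x * d m))"
    by (simp add: dim_sum_def sum_distrib_left power2_eq_square mult_ac)
  also have "\<dots> = (\<Sum>m\<in>?Y. \<Sum>n\<in>?Z. d m * (real (N x m n) * d n))"
  proof (rule sum.cong[OF refl])
    fix m assume m: "m \<in> ?Y"
    hence mI: "m \<in> I" using component_subset by blast
    have zero: "N x m n = 0" if "n \<in> I" "n \<notin> ?Z" for n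
      using fwd[OF _ m, of n] that xI mI by (auto simp: in_product_def)
    have "d x * d m = (\<Sum>n\<in>?Z. real (N x m n) * d n)"
      unfolding character_mult[OF d xI mI]
      by (rule sum.mono_neutral_right[OF finite_I component_subset]) (simp add: zero)
    thus "d m * (d x * d m) = (\<Sum>n\<in>?Z. d m * (real (N x m n) * d n))"
      by (simp add: sum_distrib_left)
  qed
  also have "\<dots> = (\<Sum>n\<in>?Z. \<Sum>m\<in>?Y. d m * (real (N x m n) * d n))" by (rule sum.swap)
  also have "\<dots> = (\<Sum>n\<in>?Z. d n * (d (dual x) * d n))"
  proof (rule sum.cong[OF refl])
    fix n assume n: "n \<in> ?Z"
    hence nI: "n \<in> I" using component_subset by blast
    have zero: "N x m n = 0" if "m \<in> I" "m \<notin> ?Y" for m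
      using bwd[OF _ n, of m] that xI nI by (auto simp: in_product_def)
    have "d (dual x) * d n = (\<Sum>m\<in>?Y. d m * real (N x m n))"
      unfolding character_dual_eigen[OF d xI nI, symmetric]
      by (rule sum.mono_neutral_right[OF finite_I component_subset]) (simp add: zero)
    thus "(\<Sum>m\<in>?Y. d m * (real (N x m n) * d n)) = d n * (d (dual x) * d n)"
      by (simp add: sum_distrib_left mult_ac)
  qed
  also have "\<dots> = d x * dim_sum d ?Z"
    using character_dual[OF d xI] by (simp add: dim_sum_def sum_distrib_left power2_eq_square mult_ac)
  finally show ?thesis using character_pos[OF d xI] by simp
qed

text \<open>
  Only the existence of some normal chain down to the unit is recorded; the adjoint series is one.
\<close>

inductive nilpotent_rule :: "'a set \<Rightarrow> bool" where
  trivial: "nilpotent_rule {e}"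
| extend: "\<lbrakk>nilpotent_rule T; subrule T; subrule S; T \<subseteq> S; normal_in T S\<rbrakk> \<Longrightarrow> nilpotent_rule S"

lemma component_divisibility:
  assumes "nilpotent_rule S" and d: "character d" and "y \<in> I"
  shows "dim_sum d (component S y) / (d y)\<^sup>2 \<in> \<int>"
  using assms(1,3)
proof (induction arbitrary: y)
  case trivial
  have "component {e} y = {y}"
    unfolding component_def using in_product_unit in_product_unitD trivial by blast
  thus ?case using character_pos[OF d trivial] by (simp add: dim_sum_def)
next
  case (extend T S)
  \<comment> \<open>the \<open>T\<close>-components into which the \<open>S\<close>-component of \<open>y\<close> decomposes\<close>
  define P where "P = component T ` component S y"
  have sub: "component T z \<subseteq> component S y" if "z \<in> component S y" for z
    using component_eq[OF extend.hyps(3) that] \<open>T \<subseteq> S\<close> unfolding component_def by blast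
  have un: "component S y = \<Union>P"
  proof (intro equalityI subsetI)
    fix z assume z: "z \<in> component S y"
    hence "z \<in> component T z" using component_refl[OF extend.hyps(2)] component_subset by blast
    thus "z \<in> \<Union>P" unfolding P_def using z by blast
  qed (use sub in \<open>auto simp: P_def\<close>)
  have fin: "finite (component S y)" using finite_subset[OF component_subset finite_I] .
  have eq: "dim_sum d A = dim_sum d (component T y)" if "A \<in> P" for A
  proof -
    obtain z where z: "z \<in> component S y" and A: "A = component T z"
      using \<open>A \<in> P\<close> unfolding P_def by blast
    then obtain s where "s \<in> S" "in_product s y z" unfolding component_def by blast
    thus ?thesis unfolding A using component_dim_sum[OF extend.hyps(2,3,5) d] by simp
  qed
  have "dim_sum d (component S y) = (\<Sum>A\<in>P. dim_sum d A)"
    unfolding dim_sum_def un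
  proof (subst sum.Union_disjoint)
    show "\<forall>A\<in>P. finite A" using fin sub finite_subset unfolding P_def by blast
    show "\<forall>A\<in>P. \<forall>B\<in>P. A \<noteq> B \<longrightarrow> A \<inter> B = {}"
      unfolding P_def using component_eq[OF extend.hyps(2)] by blast
  qed (simp add: comp_def)
  also have "\<dots> = real (card P) * dim_sum d (component T y)" using eq by simp
  finally show ?case using extend.IH[OF extend.prems] by (auto simp flip: times_divide_eq_right)
qed

theorem nilpotent_rule_divisibility:
  assumes "nilpotent_rule T" "subrule T" "normal_in T I" and d: "character d" and x: "x \<in> I"
  shows "dim_sum d T / (d x)\<^sup>2 \<in> \<int>"
  using component_divisibility[OF assms(1) d x]
    component_dim_sum[OF assms(2) subrule_I assms(3) d x in_product_unit(2)[OF x]]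
    component_e[OF assms(2)] by simp

text \<open>
  The part of \<open>T\<close> all of whose conjugates by \<open>S\<close> stay in \<open>T\<close>; it equals \<open>T\<close> exactly when \<open>T\<close> is normal
  in \<open>S\<close>.
\<close>

definition conj_closed :: "'a set \<Rightarrow> 'a set \<Rightarrow> 'a set" where
  "conj_closed S T = {s \<in> T. \<forall>x\<in>S. \<forall>w v. in_product x s w \<longrightarrow> in_product w (dual x) v \<longrightarrow> v \<in> T}"

text \<open>
  For a product, \<open>x \<otimes> s \<otimes> t \<otimes> x\<^sup>*\<close> is contained in \<open>(x \<otimes> s \<otimes> x\<^sup>*) \<otimes> (x \<otimes> t \<otimes> x\<^sup>*)\<close>. The hypothesis on
  \<open>x \<otimes> x\<^sup>*\<close> is what puts the unit into the set.
\<close>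

lemma conj_closed_subrule:
  assumes S: "subrule S" and T: "subrule T"
    and adj: "\<And>x c. x \<in> S \<Longrightarrow> in_product x (dual x) c \<Longrightarrow> c \<in> T"
  shows "subrule (conj_closed S T)"
  unfolding subrule_def
proof (intro conjI ballI allI impI)
  show "conj_closed S T \<subseteq> I" using subruleD(1)[OF T] by (auto simp: conj_closed_def)
  show "e \<in> conj_closed S T"
    unfolding conj_closed_def using subruleD(2)[OF T] in_product_unitD adj by blast
next
  fix s assume s: "s \<in> conj_closed S T"
  hence sT: "s \<in> T" by (simp add: conj_closed_def)
  hence sI: "s \<in> I" using subruleD(1)[OF T] by auto
  have "v \<in> T" if x: "x \<in> S" and w: "in_product x (dual s) w" and v: "in_product w (dual x) v" for x w v
  proof -
    have xI: "x \<in> I" using x subruleD(1)[OF S] by auto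
    have "in_product s (dual x) (dual w)" using in_product_antihom[OF w] sI by simp
    moreover have "in_product x (dual w) (dual v)" using in_product_antihom[OF v] xI by simp
    ultimately obtain u where "in_product x s u" "in_product u (dual x) (dual v)"
      by (rule in_product_assocE2)
    hence "dual v \<in> T" using s x by (auto simp: conj_closed_def)
    thus ?thesis using subruleD(4)[OF T, of "dual v"] in_product_in[OF v] by simp
  qed
  thus "dual s \<in> conj_closed S T" using subruleD(4)[OF T sT] by (auto simp: conj_closed_def)
next
  fix s t c assume s: "s \<in> conj_closed S T" and t: "t \<in> conj_closed S T" and c: "in_product s t c"
  have "v \<in> T" if x: "x \<in> S" and w: "in_product x c w" and v: "in_product w (dual x) v" for x w v
  proof -
    have xI: "x \<in> I" using x subruleD(1)[OF S] by auto
    obtain a where a: "in_product x s a" "in_product a t w" using in_product_assocE2[OF c w] .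
    \<comment> \<open>insert \<open>x\<^sup>* \<otimes> x\<close>, which contains the unit, between \<open>s\<close> and \<open>t\<close>\<close>
    obtain b where b: "in_product a (dual x) b" "in_product b x a"
      using in_product_right[of a "dual x"] ex_in_product[of a "dual x"] in_product_in[OF a(1)] xI by force
    obtain u where u: "in_product x t u" "in_product b u w" using in_product_assocE1[OF b(2) a(2)] .
    obtain r where r: "in_product u (dual x) r" "in_product b r v" using in_product_assocE1[OF u(2) v] .
    have "b \<in> T" "r \<in> T" using s t x a b u r by (auto simp: conj_closed_def)
    thus ?thesis using subruleD(3)[OF T] r by blast
  qed
  moreover have "c \<in> T" using s t c subruleD(3)[OF T] by (auto simp: conj_closed_def)
  ultimately show "c \<in> conj_closed S T" by (auto simp: conj_closed_def)
qed

text \<open>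
  Conjugating a constituent of \<open>y \<otimes> y\<^sup>*\<close> by \<open>x\<close> lands in products \<open>z \<otimes> z'\<^sup>*\<close> of constituents \<open>z\<close>, \<open>z'\<close> of
  \<open>x \<otimes> y\<close>. For \<open>z = z'\<close> these are in \<open>T\<close> by hypothesis; the mixed ones follow because \<open>z\<close> occurs in
  \<open>x \<otimes> x\<^sup>* \<otimes> z'\<close>.
\<close>

lemma adjoint_in_conj_closed:
  assumes S: "subrule S" and T: "subrule T"
    and adj: "\<And>x c. x \<in> S \<Longrightarrow> in_product x (dual x) c \<Longrightarrow> c \<in> T"
    and y: "y \<in> S" and c: "in_product y (dual y) c"
  shows "c \<in> conj_closed S T"
proof -
  have "v \<in> T" if x: "x \<in> S" and w: "in_product x c w" and v: "in_product w (dual x) v" for x w v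
  proof -
    have xI: "x \<in> I" and yI: "y \<in> I" using x y subruleD(1)[OF S] by auto
    \<comment> \<open>\<open>v\<close> lies in \<open>z (x y)*\<close> for some \<open>z\<close> in \<open>x y\<close>\<close>
    obtain z where z: "in_product x y z" "in_product z (dual y) w" using in_product_assocE2[OF c w] .
    obtain u where u: "in_product (dual y) (dual x) u" "in_product z u v"
      using in_product_assocE1[OF z(2) v] .
    define z' where "z' = dual u"
    have uI: "u \<in> I" using in_product_in u(1) by blast
    have z': "in_product x y z'" using in_product_antihom[OF u(1)] xI yI by (simp add: z'_def)
    have zS: "z' \<in> S" "z' \<in> I" using subruleD(3)[OF S x y z'] in_product_in[OF z'] by auto
    \<comment> \<open>\<open>z\<close> lies in \<open>(x x*) z'\<close>\<close>
    obtain b where b: "in_product x (dual x) b" "in_product b z' z"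
      using in_product_assocE2[OF in_product_left[OF z'] z(1)] .
    have "in_product z (dual z') v" using u(2) uI by (simp add: z'_def)
    then obtain r where r: "in_product z' (dual z') r" "in_product b r v"
      using in_product_assocE1[OF b(2)] by blast
    have "b \<in> T" "r \<in> T" using adj x zS b r by blast+
    thus ?thesis using subruleD(3)[OF T] r by blast
  qed
  thus ?thesis using adj[OF y c] by (auto simp: conj_closed_def)
qed

end


section \<open>Dimensions of spaces of morphisms\<close>

text \<open>
  Gaussian elimination, one equation at a time.
\<close>

lemma homogeneous_system_solution:
  fixes A :: "'i \<Rightarrow> 'j \<Rightarrow> 'k::field"
  assumes "finite E" "finite J" "card E < card J"
  shows "\<exists>c. (\<exists>j\<in>J. c j \<noteq> 0) \<and> (\<forall>i\<in>E. (\<Sum>j\<in>J. A i j * c j) = 0)"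
  using assms
proof (induction E arbitrary: J A rule: finite_induct)
  case empty
  hence "J \<noteq> {}" by auto
  thus ?case by (intro exI[of _ "\<lambda>_. 1"]) auto
next
  case (insert r E)
  show ?case
  proof (cases "\<forall>j\<in>J. A r j = 0")
    case True
    thus ?thesis using insert.IH[of J A] insert.prems insert.hyps by auto
  next
    case False
    then obtain q where q: "q \<in> J" "A r q \<noteq> 0" by blast
    \<comment> \<open>eliminate the unknown \<open>q\<close> by means of the equation \<open>r\<close>\<close>
    define A' where "A' i j = A i j - A i q * A r j / A r q" for i j
    have "card E < card (J - {q})" using insert.prems insert.hyps q by simp
    from insert.IH[OF _ this, of A'] obtain c where
      c: "\<exists>j\<in>J - {q}. c j \<noteq> 0" "\<And>i. i \<in> E \<Longrightarrow> (\<Sum>j\<in>J - {q}. A' i j * c j) = 0"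
      using insert.prems by auto
    define s where "s = (\<Sum>j\<in>J - {q}. A r j * c j)"
    define c' where "c' = c(q := - s / A r q)"
    have split: "(\<Sum>j\<in>J. A i j * c' j) = (\<Sum>j\<in>J - {q}. A i j * c j) - A i q * s / A r q" for i
    proof -
      have "(\<Sum>j\<in>J - {q}. A i j * c' j) = (\<Sum>j\<in>J - {q}. A i j * c j)"
        by (intro sum.cong) (auto simp: c'_def)
      thus ?thesis using q insert.prems by (simp add: sum.remove[of J q] c'_def)
    qed
    have "(\<Sum>j\<in>J. A i j * c' j) = 0" if "i \<in> E" for i
      unfolding split using c(2)[OF that]
      by (simp add: A'_def s_def right_diff_distrib left_diff_distrib sum_subtractf sum_distrib_left sum_divide_distrib mult_ac)
    moreover have "(\<Sum>j\<in>J. A r j * c' j) = 0" unfolding split using q by (simp add: s_def)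
    moreover have "\<exists>j\<in>J. c' j \<noteq> 0" using c(1) by (auto simp: c'_def)
    ultimately show ?thesis by blast
  qed
qed

definition linear_on :: "('k, 'm) module \<Rightarrow> ('k, 'n) module \<Rightarrow> ('m \<Rightarrow> 'n) \<Rightarrow> bool" where
  "linear_on M M' L \<longleftrightarrow> L ` carrier M \<subseteq> carrier M'
    \<and> (\<forall>x\<in>carrier M. \<forall>y\<in>carrier M. L (x \<oplus>\<^bsub>M\<^esub> y) = L x \<oplus>\<^bsub>M'\<^esub> L y)
    \<and> (\<forall>a. \<forall>x\<in>carrier M. L (a \<odot>\<^bsub>M\<^esub> x) = a \<odot>\<^bsub>M'\<^esub> L x)"

text \<open>
  A linear isomorphism from \<open>M\<close> onto the functions on \<open>B\<close> with values in the field. These functions are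
  taken on the whole index type and vanish off \<open>B\<close>, so that sums and multiples of coordinate vectors
  are plain pointwise operations and no sum inside the module has to be formed.
\<close>

definition coordinates :: "('k::field, 'm) module \<Rightarrow> 'b set \<Rightarrow> ('m \<Rightarrow> 'b \<Rightarrow> 'k) \<Rightarrow> bool" where
  "coordinates M B \<phi> \<longleftrightarrow> finite B \<and> bij_betw \<phi> (carrier M) {c. \<forall>b. b \<notin> B \<longrightarrow> c b = 0}
    \<and> (\<forall>x\<in>carrier M. \<forall>y\<in>carrier M. \<phi> (x \<oplus>\<^bsub>M\<^esub> y) = (\<lambda>b. \<phi> x b + \<phi> y b))
    \<and> (\<forall>a. \<forall>x\<in>carrier M. \<phi> (a \<odot>\<^bsub>M\<^esub> x) = (\<lambda>b. a * \<phi> x b))"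

text \<open>
  In coordinates an injective linear map becomes a matrix; if it had more columns than rows, a nonzero
  solution of the homogeneous system would lie in its kernel.
\<close>

lemma linear_injective_card_le:
  fixes M :: "('k::field, 'm) module"
  assumes M: "Module.module (ring_of_type_algebra :: 'k ring) M"
    and phi: "coordinates M B \<phi>" and psi: "coordinates M' B' \<psi>"
    and L: "linear_on M M' L" "inj_on L (carrier M)"
  shows "card B \<le> card B'"
proof (rule ccontr)
  assume "\<not> card B \<le> card B'"
  hence less: "card B' < card B" by simp
  interpret M: Module.module "ring_of_type_algebra :: 'k ring" M by fact
  have UN: "carrier (ring_of_type_algebra :: 'k ring) = UNIV" by (simp add: ring_of_type_algebra_def)
  have fin: "finite B" "finite B'" and bij: "bij_betw \<phi> (carrier M) {c. \<forall>b. b \<notin> B \<longrightarrow> c b = 0}"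
    and bij': "bij_betw \<psi> (carrier M') {c. \<forall>b. b \<notin> B' \<longrightarrow> c b = 0}"
    using phi psi by (auto simp: coordinates_def)
  define \<theta> where "\<theta> = inv_into (carrier M) \<phi>"
  have theta: "\<theta> c \<in> carrier M" "\<phi> (\<theta> c) = c" if "\<forall>b. b \<notin> B \<longrightarrow> c b = 0" for c
    using that bij bij_betw_inv_into_right[OF bij, of c] bij_betwE[OF bij_betw_inv_into[OF bij]]
    by (auto simp: \<theta>_def)
  have theta_phi: "\<theta> (\<phi> x) = x" if "x \<in> carrier M" for x
    using bij_betw_inv_into_left[OF bij that] by (simp add: \<theta>_def)
  have theta_add: "\<theta> (\<lambda>b. c b + c' b) = \<theta> c \<oplus>\<^bsub>M\<^esub> \<theta> c'"
    if "\<forall>b. b \<notin> B \<longrightarrow> c b = 0" "\<forall>b. b \<notin> B \<longrightarrow> c' b = 0" for c c'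
  proof -
    have "\<phi> (\<theta> c \<oplus>\<^bsub>M\<^esub> \<theta> c') = (\<lambda>b. c b + c' b)"
      using phi theta that by (simp add: coordinates_def)
    thus ?thesis using theta_phi[of "\<theta> c \<oplus>\<^bsub>M\<^esub> \<theta> c'"] theta(1)[OF that(1)] theta(1)[OF that(2)] by simp
  qed
  have theta_smult: "\<theta> (\<lambda>b. a * c b) = a \<odot>\<^bsub>M\<^esub> \<theta> c" if "\<forall>b. b \<notin> B \<longrightarrow> c b = 0" for a c
  proof -
    have "\<phi> (a \<odot>\<^bsub>M\<^esub> \<theta> c) = (\<lambda>b. a * c b)"
      using phi theta that by (simp add: coordinates_def)
    thus ?thesis using theta_phi[of "a \<odot>\<^bsub>M\<^esub> \<theta> c"] theta(1)[OF that] UN by simp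
  qed
  define g where "g c = \<psi> (L (\<theta> c))" for c
  have LM: "L x \<in> carrier M'" if "x \<in> carrier M" for x using L(1) that by (auto simp: linear_on_def)
  have g_add: "g (\<lambda>b. c b + c' b) = (\<lambda>b. g c b + g c' b)"
    if "\<forall>b. b \<notin> B \<longrightarrow> c b = 0" "\<forall>b. b \<notin> B \<longrightarrow> c' b = 0" for c c'
    using L(1) psi theta LM that by (simp add: g_def theta_add linear_on_def coordinates_def)
  have g_smult: "g (\<lambda>b. a * c b) = (\<lambda>b. a * g c b)" if "\<forall>b. b \<notin> B \<longrightarrow> c b = 0" for a c
    using L(1) psi theta LM that by (simp add: g_def theta_smult linear_on_def coordinates_def)
  have g_zero: "g (\<lambda>b. 0) = (\<lambda>b. 0)" using g_smult[of "\<lambda>b. 0" 0] by simp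
  have g_inj: "c = c'" if "\<forall>b. b \<notin> B \<longrightarrow> c b = 0" "\<forall>b. b \<notin> B \<longrightarrow> c' b = 0" "g c = g c'" for c c'
  proof -
    have "L (\<theta> c) = L (\<theta> c')"
      using that(3) bij' LM theta that unfolding g_def bij_betw_def inj_on_def by blast
    hence "\<theta> c = \<theta> c'" using L(2) theta that unfolding inj_on_def by blast
    thus ?thesis using theta that by metis
  qed
  have g_out: "g c b = 0" if "\<forall>b. b \<notin> B \<longrightarrow> c b = 0" "b \<notin> B'" for c b
    using bij_betwE[OF bij'] LM theta(1)[OF that(1)] that(2) unfolding g_def by blast
  define A where "A i j = g (\<lambda>b. if b = j then 1 else 0) i" for i j
  have g_sum: "g (\<lambda>b. if b \<in> U then c b else 0) = (\<lambda>i. \<Sum>j\<in>U. A i j * c j)" if "U \<subseteq> B" for U c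
    using finite_subset[OF that fin(1)] that
  proof (induction U rule: finite_induct)
    case empty
    thus ?case using g_zero by simp
  next
    case (insert u U)
    have "(\<lambda>b. if b \<in> insert u U then c b else 0)
        = (\<lambda>b. (if b \<in> U then c b else 0) + c u * (if b = u then 1 else 0))"
      using insert.hyps by auto
    hence "g (\<lambda>b. if b \<in> insert u U then c b else 0)
        = g (\<lambda>b. (if b \<in> U then c b else 0) + c u * (if b = u then 1 else 0))" by simp
    also have "\<dots> = (\<lambda>i. g (\<lambda>b. if b \<in> U then c b else 0) i + g (\<lambda>b. c u * (if b = u then 1 else 0)) i)"
      using insert.prems by (intro g_add) auto
    also have "g (\<lambda>b. c u * (if b = u then 1 else 0)) = (\<lambda>i. c u * A i u)"
      unfolding A_def using insert.prems by (intro g_smult) auto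
    finally show ?case using insert by (auto simp: mult.commute add.commute)
  qed
  obtain c where c: "\<exists>j\<in>B. c j \<noteq> 0" "\<And>i. i \<in> B' \<Longrightarrow> (\<Sum>j\<in>B. A i j * c j) = 0"
    using homogeneous_system_solution[OF fin(2) fin(1) less, of A] by blast
  let ?c = "\<lambda>b. if b \<in> B then c b else 0"
  have "g ?c i = 0" for i
  proof (cases "i \<in> B'")
    case True
    thus ?thesis using g_sum[of B c] c(2) by simp
  qed (simp add: g_out)
  hence "g ?c = g (\<lambda>b. 0)" using g_zero by auto
  hence "?c = (\<lambda>b. 0)" by (intro g_inj) auto
  thus False using c(1) by metis
qed

text \<open>
  The maps \<open>r j\<close> exhibit \<open>M\<close> as the product of the \<open>M' j\<close>.
\<close>

lemma coordinates_sum: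
  fixes M :: "('k::field, 'm) module" and M' :: "'j \<Rightarrow> ('k, 'n) module" and B :: "'j \<Rightarrow> 'b set"
  assumes J: "finite J" and phi: "\<And>j. j \<in> J \<Longrightarrow> coordinates (M' j) (B j) (\<phi> j)"
    and r: "\<And>j. j \<in> J \<Longrightarrow> linear_on M (M' j) (r j)"
    and inj: "\<And>f g. \<lbrakk>f \<in> carrier M; g \<in> carrier M; \<And>j. j \<in> J \<Longrightarrow> r j f = r j g\<rbrakk> \<Longrightarrow> f = g"
    and surj: "\<And>h. (\<And>j. j \<in> J \<Longrightarrow> h j \<in> carrier (M' j)) \<Longrightarrow> \<exists>f\<in>carrier M. \<forall>j\<in>J. r j f = h j"
  shows "coordinates M (Sigma J B) (\<lambda>f (j, b). if j \<in> J then \<phi> j (r j f) b else 0)"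
    (is "coordinates M _ ?\<Phi>")
  unfolding coordinates_def
proof (intro conjI ballI allI)
  show "finite (Sigma J B)" using J phi by (auto simp: coordinates_def)
  have rM: "r j f \<in> carrier (M' j)" if "j \<in> J" "f \<in> carrier M" for j f
    using r[OF that(1)] that(2) by (auto simp: linear_on_def)
  have bij: "bij_betw (\<phi> j) (carrier (M' j)) {c. \<forall>b. b \<notin> B j \<longrightarrow> c b = 0}" if "j \<in> J" for j
    using phi[OF that] by (simp add: coordinates_def)
  show "bij_betw ?\<Phi> (carrier M) {c. \<forall>b. b \<notin> Sigma J B \<longrightarrow> c b = 0}"
    unfolding bij_betw_def
  proof (intro conjI inj_onI equalityI subsetI)
    fix f g assume fg: "f \<in> carrier M" "g \<in> carrier M" "?\<Phi> f = ?\<Phi> g"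
    show "f = g"
    proof (rule inj[OF fg(1,2)])
      fix j assume j: "j \<in> J"
      have "\<phi> j (r j f) b = \<phi> j (r j g) b" for b using fun_cong[OF fg(3), of "(j, b)"] j by simp
      hence "\<phi> j (r j f) = \<phi> j (r j g)" by auto
      thus "r j f = r j g"
        using bij_betw_imp_inj_on[OF bij[OF j]] rM[OF j] fg by (simp add: inj_on_def)
    qed
  next
    fix c :: "'j \<times> 'b \<Rightarrow> 'k" assume "c \<in> ?\<Phi> ` carrier M"
    then obtain f where "f \<in> carrier M" "c = ?\<Phi> f" by blast
    thus "c \<in> {c. \<forall>b. b \<notin> Sigma J B \<longrightarrow> c b = 0}" using bij_betwE[OF bij] rM by auto
  next
    fix c :: "'j \<times> 'b \<Rightarrow> 'k" assume c: "c \<in> {c. \<forall>b. b \<notin> Sigma J B \<longrightarrow> c b = 0}"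
    define h where "h j = inv_into (carrier (M' j)) (\<phi> j) (\<lambda>b. c (j, b))" for j
    have h: "h j \<in> carrier (M' j)" "\<phi> j (h j) = (\<lambda>b. c (j, b))" if j: "j \<in> J" for j
    proof -
      have c_j: "(\<lambda>b. c (j, b)) \<in> {c. \<forall>b. b \<notin> B j \<longrightarrow> c b = 0}" using c j by auto
      show "h j \<in> carrier (M' j)"
        unfolding h_def by (rule bij_betw_apply[OF bij_betw_inv_into[OF bij[OF j]] c_j])
      show "\<phi> j (h j) = (\<lambda>b. c (j, b))"
        unfolding h_def by (rule bij_betw_inv_into_right[OF bij[OF j] c_j])
    qed
    obtain f where f: "f \<in> carrier M" "\<And>j. j \<in> J \<Longrightarrow> r j f = h j" using surj h(1) by blast
    have "?\<Phi> f = c" using f(2) h(2) c by (auto simp: fun_eq_iff)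
    thus "c \<in> ?\<Phi> ` carrier M" using f(1) by blast
  qed
  show "?\<Phi> (f \<oplus>\<^bsub>M\<^esub> g) = (\<lambda>b. ?\<Phi> f b + ?\<Phi> g b)" if "f \<in> carrier M" "g \<in> carrier M" for f g
    using that r phi rM by (auto simp: fun_eq_iff linear_on_def coordinates_def)
  show "?\<Phi> (a \<odot>\<^bsub>M\<^esub> f) = (\<lambda>b. a * ?\<Phi> f b)" if "f \<in> carrier M" for a f
    using that r phi rM by (auto simp: fun_eq_iff linear_on_def coordinates_def)
qed

definition has_dim :: "('k::field, 'm) module \<Rightarrow> nat \<Rightarrow> bool" where
  "has_dim M n \<longleftrightarrow> (\<exists>\<phi>. coordinates M {..<n} \<phi>)"

lemma coordinates_has_dim:
  fixes M :: "('k::field, 'm) module" and B :: "'b set"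
  assumes "coordinates M B \<phi>"
  shows "has_dim M (card B)"
proof -
  have fin: "finite B" and bij: "bij_betw \<phi> (carrier M) {c. \<forall>b. b \<notin> B \<longrightarrow> c b = 0}"
    using assms by (auto simp: coordinates_def)
  obtain h where h: "bij_betw h {..<card B} B" using ex_bij_betw_nat_finite[OF fin] atLeast0LessThan by metis
  define r where "r = (\<lambda>(c :: 'b \<Rightarrow> 'k) i. if i < card B then c (h i) else 0)"
  have "bij_betw r {c. \<forall>b. b \<notin> B \<longrightarrow> c b = 0} {c. \<forall>b. b \<notin> {..<card B} \<longrightarrow> c b = 0}"
  proof (rule bij_betwI[where g = "\<lambda>c b. if b \<in> B then c (inv_into {..<card B} h b) else 0"])
    show "(\<lambda>b. if b \<in> B then r c (inv_into {..<card B} h b) else 0) = c"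
      if "c \<in> {c. \<forall>b. b \<notin> B \<longrightarrow> c b = 0}" for c
      using that bij_betw_inv_into_right[OF h] bij_betwE[OF bij_betw_inv_into[OF h]] by (auto simp: r_def fun_eq_iff)
    show "r (\<lambda>b. if b \<in> B then c (inv_into {..<card B} h b) else 0) = c"
      if "c \<in> {c. \<forall>b. b \<notin> {..<card B} \<longrightarrow> c b = 0}" for c
      using that bij_betw_inv_into_left[OF h] bij_betwE[OF h] by (auto simp: r_def fun_eq_iff)
  qed (auto simp: r_def)
  hence "bij_betw (r \<circ> \<phi>) (carrier M) {c. \<forall>b. b \<notin> {..<card B} \<longrightarrow> c b = 0}"
    using bij bij_betw_trans by blast
  hence "coordinates M {..<card B} (r \<circ> \<phi>)"
    using assms by (auto simp: coordinates_def r_def fun_eq_iff)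
  thus ?thesis unfolding has_dim_def by blast
qed

lemma has_dim_le:
  fixes M :: "('k::field, 'm) module"
  assumes "Module.module (ring_of_type_algebra :: 'k ring) M" "has_dim M n" "has_dim M' n'"
    and "linear_on M M' L" "inj_on L (carrier M)"
  shows "n \<le> n'"
  using assms linear_injective_card_le[OF assms(1)] unfolding has_dim_def by (metis card_lessThan)

lemma has_dim_unique:
  fixes M :: "('k::field, 'm) module"
  assumes M: "Module.module (ring_of_type_algebra :: 'k ring) M" and "has_dim M n" "has_dim M n'"
  shows "n = n'"
  using has_dim_le[OF M, of n M n' "\<lambda>x. x"] has_dim_le[OF M, of n' M n "\<lambda>x. x"] assms
  by (simp add: linear_on_def)

lemma has_dim_0:
  fixes M :: "('k::field, 'm) module"
  assumes "has_dim M 0" and xy: "x \<in> carrier M" "y \<in> carrier M"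
  shows "x = y"
proof -
  obtain \<phi> :: "'m \<Rightarrow> nat \<Rightarrow> 'k" where bij: "bij_betw \<phi> (carrier M) {\<lambda>b. 0}"
    using assms(1) by (auto simp: has_dim_def coordinates_def fun_eq_iff[symmetric])
  hence "\<phi> x = \<phi> y" using xy bij_betwE[OF bij] by (metis singletonD)
  thus "x = y" using bij_betw_imp_inj_on[OF bij] xy by (simp add: inj_on_def)
qed


section \<open>Biproducts in linear categories\<close>

text \<open>
  Direct sums over an arbitrary finite index set instead of a list, since sums that arise from a functor
  or are regrouped have no preferred order.
\<close>

definition biproduct :: "('o, 'm, 'k) tensor_data \<Rightarrow> 'o \<Rightarrow> 'j set \<Rightarrow> ('j \<Rightarrow> 'o) \<Rightarrow> ('j \<Rightarrow> 'm) \<Rightarrow> ('j \<Rightarrow> 'm) \<Rightarrow> bool" where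
  "biproduct C V J Y i p \<longleftrightarrow> V \<in> Obj C \<and> finite J
    \<and> (\<forall>j\<in>J. Y j \<in> Obj C \<and> i j \<in> Mor C (Y j) V \<and> p j \<in> Mor C V (Y j))
    \<and> (\<forall>j\<in>J. \<forall>l\<in>J. Comp C (p l) (i j) = (if j = l then Id C (Y j) else Zero C (Y j) (Y l)))
    \<and> finsum (Hom C V V) (\<lambda>j. Comp C (i j) (p j)) J = Id C V"

lemma direct_sum_biproduct:
  "direct_sum C V Ys \<longleftrightarrow> (\<exists>i p. biproduct C V {..<length Ys} ((!) Ys) i p)"
proof -
  have sub: "set Ys \<subseteq> Obj C \<longleftrightarrow> (\<forall>j<length Ys. Ys ! j \<in> Obj C)"
    by (auto simp: in_set_conv_nth subset_iff)
  have "biproduct C V {..<length Ys} ((!) Ys) i p \<longleftrightarrow> V \<in> Obj C \<and> set Ys \<subseteq> Obj C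
      \<and> (\<forall>j<length Ys. i j \<in> Mor C (Ys ! j) V \<and> p j \<in> Mor C V (Ys ! j))
      \<and> (\<forall>j<length Ys. \<forall>l<length Ys. Comp C (p l) (i j) =
            (if j = l then Id C (Ys ! j) else Zero C (Ys ! j) (Ys ! l)))
      \<and> finsum (Hom C V V) (\<lambda>j. Comp C (i j) (p j)) {..<length Ys} = Id C V" for i p
    unfolding biproduct_def sub by blast
  thus ?thesis unfolding direct_sum_def by simp
qed

context linear_category
begin

lemma carrier_scalars [simp]: "carrier (ring_of_type_algebra :: 'k ring) = UNIV"
  by (simp add: ring_of_type_algebra_def)

lemma scalar_simps [simp]:
  "\<zero>\<^bsub>ring_of_type_algebra :: 'k ring\<^esub> = 0" "\<one>\<^bsub>ring_of_type_algebra :: 'k ring\<^esub> = 1"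
  "a \<oplus>\<^bsub>ring_of_type_algebra :: 'k ring\<^esub> b = a + b" "a \<otimes>\<^bsub>ring_of_type_algebra :: 'k ring\<^esub> b = a * b"
  by (simp_all add: ring_of_type_algebra_def)

context
  fixes V Y
  assumes VY: "V \<in> Obj C" "Y \<in> Obj C"
begin

interpretation H: Module.module "ring_of_type_algebra :: 'k ring" "Hom C V Y"
  by (rule Hom_vector_space[OF VY])

lemma Hom_abelian_group: "abelian_group (Hom C V Y)" by (rule H.abelian_group_axioms)

lemma Zero_in: "Zero C V Y \<in> Mor C V Y" by simp

lemma add_in: "f \<in> Mor C V Y \<Longrightarrow> g \<in> Mor C V Y \<Longrightarrow> f \<oplus>\<^bsub>Hom C V Y\<^esub> g \<in> Mor C V Y" by simp

lemma minus_in: "f \<in> Mor C V Y \<Longrightarrow> g \<in> Mor C V Y \<Longrightarrow> f \<ominus>\<^bsub>Hom C V Y\<^esub> g \<in> Mor C V Y" by simp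

lemma smult_in: "f \<in> Mor C V Y \<Longrightarrow> a \<odot>\<^bsub>Hom C V Y\<^esub> f \<in> Mor C V Y" using H.smult_closed[of a f] by simp

lemma smult_zero_scalar: "f \<in> Mor C V Y \<Longrightarrow> 0 \<odot>\<^bsub>Hom C V Y\<^esub> f = Zero C V Y"
  using H.smult_l_null[of f] by simp

lemma smult_Zero: "a \<odot>\<^bsub>Hom C V Y\<^esub> Zero C V Y = Zero C V Y"
  using H.smult_r_null[of a] by simp

lemma smult_one: "f \<in> Mor C V Y \<Longrightarrow> 1 \<odot>\<^bsub>Hom C V Y\<^esub> f = f"
  using H.smult_one[of f] by simp

lemma smult_smult: "f \<in> Mor C V Y \<Longrightarrow> a \<odot>\<^bsub>Hom C V Y\<^esub> (b \<odot>\<^bsub>Hom C V Y\<^esub> f) = (a * b) \<odot>\<^bsub>Hom C V Y\<^esub> f"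
  using H.smult_assoc1[of a b f] by simp

lemma smult_add_scalar:
  "f \<in> Mor C V Y \<Longrightarrow> (a + b) \<odot>\<^bsub>Hom C V Y\<^esub> f = a \<odot>\<^bsub>Hom C V Y\<^esub> f \<oplus>\<^bsub>Hom C V Y\<^esub> b \<odot>\<^bsub>Hom C V Y\<^esub> f"
  using H.smult_l_distr[of a b f] by simp

lemma smult_add:
  "f \<in> Mor C V Y \<Longrightarrow> g \<in> Mor C V Y \<Longrightarrow>
    a \<odot>\<^bsub>Hom C V Y\<^esub> (f \<oplus>\<^bsub>Hom C V Y\<^esub> g) = a \<odot>\<^bsub>Hom C V Y\<^esub> f \<oplus>\<^bsub>Hom C V Y\<^esub> a \<odot>\<^bsub>Hom C V Y\<^esub> g"
  using H.smult_r_distr[of a f g] by simp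

lemma minus_eq_Zero: "f \<in> Mor C V Y \<Longrightarrow> g \<in> Mor C V Y \<Longrightarrow> f \<ominus>\<^bsub>Hom C V Y\<^esub> g = Zero C V Y \<longleftrightarrow> f = g"
  using H.M.minus_eq H.M.r_neg H.M.minus_equality H.M.minus_minus H.M.a_inv_closed H.M.a_comm by (metis)

lemma minus_smult: "f \<in> Mor C V Y \<Longrightarrow> g \<in> Mor C V Y \<Longrightarrow>
    f \<ominus>\<^bsub>Hom C V Y\<^esub> g = f \<oplus>\<^bsub>Hom C V Y\<^esub> (-1) \<odot>\<^bsub>Hom C V Y\<^esub> g"
proof -
  assume f: "f \<in> Mor C V Y" and g: "g \<in> Mor C V Y"
  have "g \<oplus>\<^bsub>Hom C V Y\<^esub> (-1) \<odot>\<^bsub>Hom C V Y\<^esub> g = (1 + (-1)) \<odot>\<^bsub>Hom C V Y\<^esub> g"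
    using g by (simp only: smult_add_scalar smult_one)
  also have "\<dots> = Zero C V Y" using g by (simp add: smult_zero_scalar)
  finally have "\<ominus>\<^bsub>Hom C V Y\<^esub> g = (-1) \<odot>\<^bsub>Hom C V Y\<^esub> g"
    using g smult_in by (metis H.M.minus_equality H.M.a_comm)
  thus ?thesis by (simp add: a_minus_def)
qed

lemma add_Zero: "f \<in> Mor C V Y \<Longrightarrow> f \<oplus>\<^bsub>Hom C V Y\<^esub> Zero C V Y = f"
    "f \<in> Mor C V Y \<Longrightarrow> Zero C V Y \<oplus>\<^bsub>Hom C V Y\<^esub> f = f"
  by simp_all

end

lemma Comp_Zero_left: "\<lbrakk>V \<in> Obj C; Y \<in> Obj C; Z \<in> Obj C; f \<in> Mor C V Y\<rbrakk> \<Longrightarrow> Zero C Y Z \<bullet> f = Zero C V Z"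
  using Comp_smult_left[of V Y Z f "Zero C Y Z" 0] by (simp add: smult_zero_scalar Zero_in Comp_in)

lemma Comp_Zero_right: "\<lbrakk>V \<in> Obj C; Y \<in> Obj C; Z \<in> Obj C; g \<in> Mor C Y Z\<rbrakk> \<Longrightarrow> g \<bullet> Zero C V Y = Zero C V Z"
  using Comp_smult_right[of V Y Z "Zero C V Y" g 0] by (simp add: smult_zero_scalar Zero_in Comp_in)

lemma Comp_minus_right:
  "\<lbrakk>V \<in> Obj C; Y \<in> Obj C; Z \<in> Obj C; f \<in> Mor C V Y; g \<in> Mor C V Y; h \<in> Mor C Y Z\<rbrakk>
    \<Longrightarrow> h \<bullet> (f \<ominus>\<^bsub>Hom C V Y\<^esub> g) = (h \<bullet> f) \<ominus>\<^bsub>Hom C V Z\<^esub> (h \<bullet> g)"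
  by (simp add: minus_smult Comp_add_right smult_in Comp_in Comp_smult_right)

lemma Comp_minus_left:
  "\<lbrakk>V \<in> Obj C; Y \<in> Obj C; Z \<in> Obj C; f \<in> Mor C V Y; g \<in> Mor C Y Z; h \<in> Mor C Y Z\<rbrakk>
    \<Longrightarrow> (g \<ominus>\<^bsub>Hom C Y Z\<^esub> h) \<bullet> f = (g \<bullet> f) \<ominus>\<^bsub>Hom C V Z\<^esub> (h \<bullet> f)"
  by (simp add: minus_smult Comp_add_left smult_in Comp_in Comp_smult_left)

lemma finsum_in:
  "\<lbrakk>V \<in> Obj C; Y \<in> Obj C; \<And>j. j \<in> J \<Longrightarrow> f j \<in> Mor C V Y\<rbrakk> \<Longrightarrow> finsum (Hom C V Y) f J \<in> Mor C V Y"
  using abelian_monoid.finsum_closed[of "Hom C V Y" f J] Hom_abelian_group[of V Y]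
  by (auto simp: abelian_group_def)

text \<open>
  All manipulations of sums of morphisms below are instances of this for composition or tensoring with a
  fixed morphism.
\<close>

lemma linear_finsum:
  assumes obj: "V \<in> Obj C" "Y \<in> Obj C" "V' \<in> Obj C" "Y' \<in> Obj C"
    and L: "linear_on (Hom C V Y) (Hom C V' Y') L"
    and J: "finite J" and f: "\<And>j. j \<in> J \<Longrightarrow> f j \<in> Mor C V Y"
  shows "L (finsum (Hom C V Y) f J) = finsum (Hom C V' Y') (\<lambda>j. L (f j)) J"
  using J f
proof (induction J rule: finite_induct)
  interpret H: abelian_group "Hom C V Y" by (rule Hom_abelian_group[OF obj(1,2)])
  interpret H': abelian_group "Hom C V' Y'" by (rule Hom_abelian_group[OF obj(3,4)])
  {
    case empty
    have "L (Zero C V Y) = Zero C V' Y'"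
    proof -
      have "L (0 \<odot>\<^bsub>Hom C V Y\<^esub> Zero C V Y) = 0 \<odot>\<^bsub>Hom C V' Y'\<^esub> L (Zero C V Y)"
        using L by (simp add: linear_on_def)
      thus ?thesis using L obj by (simp add: smult_Zero smult_zero_scalar linear_on_def image_subset_iff)
    qed
    thus ?case by simp
  next
    case (insert x F)
    have "L (f x) \<in> Mor C V' Y'" "\<And>j. j \<in> F \<Longrightarrow> L (f j) \<in> Mor C V' Y'"
      using L insert.prems by (auto simp: linear_on_def)
    moreover have "L (f x \<oplus>\<^bsub>Hom C V Y\<^esub> finsum (Hom C V Y) f F)
        = L (f x) \<oplus>\<^bsub>Hom C V' Y'\<^esub> L (finsum (Hom C V Y) f F)"
      using L insert.prems by (auto simp: linear_on_def intro!: finsum_in obj)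
    ultimately show ?case using insert
      by (subst H.finsum_insert) (auto simp: H'.finsum_insert Pi_iff)
  }
qed

lemma linear_post: "\<lbrakk>W \<in> Obj C; V \<in> Obj C; Y \<in> Obj C; g \<in> Mor C V Y\<rbrakk>
    \<Longrightarrow> linear_on (Hom C W V) (Hom C W Y) (\<lambda>f. g \<bullet> f)"
  by (auto simp: linear_on_def Comp_in Comp_add_right Comp_smult_right)

lemma linear_pre: "\<lbrakk>W \<in> Obj C; V \<in> Obj C; Y \<in> Obj C; g \<in> Mor C W V\<rbrakk>
    \<Longrightarrow> linear_on (Hom C V Y) (Hom C W Y) (\<lambda>f. f \<bullet> g)"
  by (auto simp: linear_on_def Comp_in Comp_add_left Comp_smult_left)

lemma linear_comp: "linear_on M M' L \<Longrightarrow> linear_on M' M'' L' \<Longrightarrow> linear_on M M'' (\<lambda>x. L' (L x))"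
  by (auto simp: linear_on_def image_subset_iff)

lemma finsum_delta:
  "\<lbrakk>V \<in> Obj C; Y \<in> Obj C; l \<in> J; finite J; \<And>j. j \<in> J \<Longrightarrow> f j \<in> Mor C V Y\<rbrakk>
    \<Longrightarrow> finsum (Hom C V Y) (\<lambda>j. if j = l then f j else Zero C V Y) J = f l"
proof -
  assume a: "V \<in> Obj C" "Y \<in> Obj C" "l \<in> J" "finite J" "\<And>j. j \<in> J \<Longrightarrow> f j \<in> Mor C V Y"
  interpret H: abelian_group "Hom C V Y" by (rule Hom_abelian_group[OF a(1,2)])
  show ?thesis using H.finsum_singleton[OF a(3,4), of f] a(5) by (simp add: eq_commute[of _ l])
qed

lemma finsum_cong_Mor:
  "\<lbrakk>V \<in> Obj C; Y \<in> Obj C; \<And>j. j \<in> J \<Longrightarrow> f j = g j; \<And>j. j \<in> J \<Longrightarrow> g j \<in> Mor C V Y\<rbrakk>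
    \<Longrightarrow> finsum (Hom C V Y) f J = finsum (Hom C V Y) g J"
proof -
  assume a: "V \<in> Obj C" "Y \<in> Obj C" "\<And>j. j \<in> J \<Longrightarrow> f j = g j" "\<And>j. j \<in> J \<Longrightarrow> g j \<in> Mor C V Y"
  interpret H: abelian_group "Hom C V Y" by (rule Hom_abelian_group[OF a(1,2)])
  show ?thesis by (rule H.finsum_cong') (use a in auto)
qed

lemma biproductD:
  assumes "biproduct C V J Y i p"
  shows "V \<in> Obj C" "finite J" "\<And>j. j \<in> J \<Longrightarrow> Y j \<in> Obj C" "\<And>j. j \<in> J \<Longrightarrow> i j \<in> Mor C (Y j) V"
    "\<And>j. j \<in> J \<Longrightarrow> p j \<in> Mor C V (Y j)"
    "\<And>j l. j \<in> J \<Longrightarrow> l \<in> J \<Longrightarrow> p l \<bullet> i j = (if j = l then Id C (Y j) else Zero C (Y j) (Y l))"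
    "finsum (Hom C V V) (\<lambda>j. i j \<bullet> p j) J = Id C V"
  using assms unfolding biproduct_def by blast+

lemma biproduct_factor_source:
  assumes b: "biproduct C V J Y i p" and Z: "Z \<in> Obj C" and f: "f \<in> Mor C V Z"
  shows "f = finsum (Hom C V Z) (\<lambda>j. (f \<bullet> i j) \<bullet> p j) J"
proof -
  note b' = biproductD[OF b]
  have ip: "i j \<bullet> p j \<in> Mor C V V" if "j \<in> J" for j using b' that Comp_in by blast
  have "f = f \<bullet> finsum (Hom C V V) (\<lambda>j. i j \<bullet> p j) J" using b' Z f by (simp add: Comp_Id)
  also have "\<dots> = finsum (Hom C V Z) (\<lambda>j. f \<bullet> (i j \<bullet> p j)) J"
    by (rule linear_finsum[OF _ _ _ _ linear_post]) (use b' Z f ip in auto)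
  also have "\<dots> = finsum (Hom C V Z) (\<lambda>j. (f \<bullet> i j) \<bullet> p j) J"
  proof (rule finsum_cong_Mor)
    fix j assume j: "j \<in> J"
    show "f \<bullet> (i j \<bullet> p j) = (f \<bullet> i j) \<bullet> p j"
      using Comp_assoc[of V "Y j" V Z "p j" "i j" f] b' Z f j by simp
    show "(f \<bullet> i j) \<bullet> p j \<in> Mor C V Z"
      using Comp_in[of V "Y j" Z "p j" "f \<bullet> i j"] Comp_in[of "Y j" V Z "i j" f] b' Z f j by simp
  qed (use b' Z in auto)
  finally show ?thesis .
qed

lemma biproduct_factor_target:
  assumes b: "biproduct C V J Y i p" and Z: "Z \<in> Obj C" and f: "f \<in> Mor C Z V"
  shows "f = finsum (Hom C Z V) (\<lambda>j. i j \<bullet> (p j \<bullet> f)) J"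
proof -
  note b' = biproductD[OF b]
  have ip: "i j \<bullet> p j \<in> Mor C V V" if "j \<in> J" for j using b' that Comp_in by blast
  have "f = finsum (Hom C V V) (\<lambda>j. i j \<bullet> p j) J \<bullet> f" using b' Z f by (simp add: Id_Comp)
  also have "\<dots> = finsum (Hom C Z V) (\<lambda>j. (i j \<bullet> p j) \<bullet> f) J"
    by (rule linear_finsum[OF _ _ _ _ linear_pre]) (use b' Z f ip in auto)
  also have "\<dots> = finsum (Hom C Z V) (\<lambda>j. i j \<bullet> (p j \<bullet> f)) J"
  proof (rule finsum_cong_Mor)
    fix j assume j: "j \<in> J"
    show "(i j \<bullet> p j) \<bullet> f = i j \<bullet> (p j \<bullet> f)"
      using Comp_assoc[of Z V "Y j" V f "p j" "i j"] b' Z f j by simp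
    show "i j \<bullet> (p j \<bullet> f) \<in> Mor C Z V"
      using Comp_in[of Z "Y j" V "p j \<bullet> f" "i j"] Comp_in[of Z V "Y j" f "p j"] b' Z f j by simp
  qed (use b' Z in auto)
  finally show ?thesis .
qed

lemma biproduct_ext_source:
  assumes b: "biproduct C V J Y i p" and Z: "Z \<in> Obj C" and f: "f \<in> Mor C V Z" "g \<in> Mor C V Z"
    and eq: "\<And>j. j \<in> J \<Longrightarrow> f \<bullet> i j = g \<bullet> i j"
  shows "f = g"
proof -
  note b' = biproductD[OF b]
  have "finsum (Hom C V Z) (\<lambda>j. (f \<bullet> i j) \<bullet> p j) J = finsum (Hom C V Z) (\<lambda>j. (g \<bullet> i j) \<bullet> p j) J"
  proof (rule finsum_cong_Mor)
    fix j assume j: "j \<in> J"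
    show "(g \<bullet> i j) \<bullet> p j \<in> Mor C V Z"
      using Comp_in[of V "Y j" Z "p j" "g \<bullet> i j"] Comp_in[of "Y j" V Z "i j" g] b' Z f j by simp
  qed (use b' Z eq in auto)
  thus ?thesis using biproduct_factor_source[OF b Z] f by metis
qed

lemma biproduct_ext_target:
  assumes b: "biproduct C V J Y i p" and Z: "Z \<in> Obj C" and f: "f \<in> Mor C Z V" "g \<in> Mor C Z V"
    and eq: "\<And>j. j \<in> J \<Longrightarrow> p j \<bullet> f = p j \<bullet> g"
  shows "f = g"
proof -
  note b' = biproductD[OF b]
  have "finsum (Hom C Z V) (\<lambda>j. i j \<bullet> (p j \<bullet> f)) J = finsum (Hom C Z V) (\<lambda>j. i j \<bullet> (p j \<bullet> g)) J"
  proof (rule finsum_cong_Mor)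
    fix j assume j: "j \<in> J"
    show "i j \<bullet> (p j \<bullet> g) \<in> Mor C Z V"
      using Comp_in[of Z "Y j" V "p j \<bullet> g" "i j"] Comp_in[of Z V "Y j" g "p j"] b' Z f j by simp
  qed (use b' Z eq in auto)
  thus ?thesis using biproduct_factor_target[OF b Z] f by metis
qed

lemma biproduct_copair:
  assumes b: "biproduct C V J Y i p" and Z: "Z \<in> Obj C" and h: "\<And>j. j \<in> J \<Longrightarrow> h j \<in> Mor C (Y j) Z"
  shows "\<exists>f\<in>Mor C V Z. \<forall>j\<in>J. f \<bullet> i j = h j"
proof
  note b' = biproductD[OF b]
  let ?f = "finsum (Hom C V Z) (\<lambda>j. h j \<bullet> p j) J"
  have hp: "h j \<bullet> p j \<in> Mor C V Z" if "j \<in> J" for j using b' h Z that Comp_in by blast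
  show "?f \<in> Mor C V Z" using b' Z hp by (intro finsum_in) auto
  show "\<forall>l\<in>J. ?f \<bullet> i l = h l"
  proof
    fix l assume l: "l \<in> J"
    have "?f \<bullet> i l = finsum (Hom C (Y l) Z) (\<lambda>j. (h j \<bullet> p j) \<bullet> i l) J"
      by (rule linear_finsum[OF _ _ _ _ linear_pre]) (use b' Z hp l in auto)
    also have "\<dots> = finsum (Hom C (Y l) Z) (\<lambda>j. if j = l then h j else Zero C (Y l) Z) J"
    proof (rule finsum_cong_Mor)
      fix j assume j: "j \<in> J"
      have "(h j \<bullet> p j) \<bullet> i l = h j \<bullet> (p j \<bullet> i l)" using b' h Z j l by (intro Comp_assoc[of "Y l" V "Y j" Z]) auto
      thus "(h j \<bullet> p j) \<bullet> i l = (if j = l then h j else Zero C (Y l) Z)"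
        using b' h Z j l by (auto simp: Comp_Id Comp_Zero_right)
    qed (use b' h Z l in \<open>auto simp: Zero_in\<close>)
    also have "\<dots> = finsum (Hom C (Y l) Z) (\<lambda>j. if j = l then h l else Zero C (Y l) Z) J"
      by (rule finsum_cong_Mor) (use b' h Z l in \<open>auto simp: Zero_in\<close>)
    also have "\<dots> = h l" using finsum_delta[of "Y l" Z l J "\<lambda>_. h l"] b' h Z l by simp
    finally show "?f \<bullet> i l = h l" .
  qed
qed

lemma biproduct_pair:
  assumes b: "biproduct C V J Y i p" and Z: "Z \<in> Obj C" and h: "\<And>j. j \<in> J \<Longrightarrow> h j \<in> Mor C Z (Y j)"
  shows "\<exists>f\<in>Mor C Z V. \<forall>j\<in>J. p j \<bullet> f = h j"
proof
  note b' = biproductD[OF b]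
  let ?f = "finsum (Hom C Z V) (\<lambda>j. i j \<bullet> h j) J"
  have hp: "i j \<bullet> h j \<in> Mor C Z V" if "j \<in> J" for j using b' h Z that Comp_in by blast
  show "?f \<in> Mor C Z V" using b' Z hp by (intro finsum_in) auto
  show "\<forall>l\<in>J. p l \<bullet> ?f = h l"
  proof
    fix l assume l: "l \<in> J"
    have "p l \<bullet> ?f = finsum (Hom C Z (Y l)) (\<lambda>j. p l \<bullet> (i j \<bullet> h j)) J"
      by (rule linear_finsum[OF _ _ _ _ linear_post]) (use b' Z hp l in auto)
    also have "\<dots> = finsum (Hom C Z (Y l)) (\<lambda>j. if j = l then h l else Zero C Z (Y l)) J"
    proof (rule finsum_cong_Mor)
      fix j assume j: "j \<in> J"
      have "p l \<bullet> (i j \<bullet> h j) = (p l \<bullet> i j) \<bullet> h j"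
        using b' h Z j l by (intro Comp_assoc[of Z "Y j" V "Y l", symmetric]) auto
      thus "p l \<bullet> (i j \<bullet> h j) = (if j = l then h l else Zero C Z (Y l))"
        using b' h Z j l by (auto simp: Id_Comp Comp_Zero_left)
    qed (use b' h Z l in \<open>auto simp: Zero_in\<close>)
    also have "\<dots> = h l" using finsum_delta[of Z "Y l" l J "\<lambda>_. h l"] b' h Z l by simp
    finally show "p l \<bullet> ?f = h l" .
  qed
qed

text \<open>
  Morphisms out of (into) a biproduct correspond to families of morphisms out of (into) its summands.
\<close>

lemma biproduct_dim:
  assumes b: "biproduct C V J Y i p" and Z: "Z \<in> Obj C"
  shows "(\<And>j. j \<in> J \<Longrightarrow> has_dim (Hom C (Y j) Z) (n j)) \<Longrightarrow> has_dim (Hom C V Z) (\<Sum>j\<in>J. n j)"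
    and "(\<And>j. j \<in> J \<Longrightarrow> has_dim (Hom C Z (Y j)) (n j)) \<Longrightarrow> has_dim (Hom C Z V) (\<Sum>j\<in>J. n j)"
proof -
  note b' = biproductD[OF b]
  have card: "card (Sigma J (\<lambda>j. {..<n j})) = (\<Sum>j\<in>J. n j)" using b' by simp
  {
    assume "\<And>j. j \<in> J \<Longrightarrow> has_dim (Hom C (Y j) Z) (n j)"
    hence "\<forall>j\<in>J. \<exists>\<phi>. coordinates (Hom C (Y j) Z) {..<n j} \<phi>" by (simp add: has_dim_def)
    then obtain \<phi> where phi: "\<And>j. j \<in> J \<Longrightarrow> coordinates (Hom C (Y j) Z) {..<n j} (\<phi> j)" by metis
    have "coordinates (Hom C V Z) (Sigma J (\<lambda>j. {..<n j}))
        (\<lambda>f (j, b). if j \<in> J then \<phi> j (f \<bullet> i j) b else 0)"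
      by (rule coordinates_sum[OF b'(2) phi])
        (use b' Z biproduct_ext_source[OF b Z] biproduct_copair[OF b Z] in \<open>auto intro!: linear_pre\<close>)
    from coordinates_has_dim[OF this] show "has_dim (Hom C V Z) (\<Sum>j\<in>J. n j)" unfolding card .
  next
    assume "\<And>j. j \<in> J \<Longrightarrow> has_dim (Hom C Z (Y j)) (n j)"
    hence "\<forall>j\<in>J. \<exists>\<phi>. coordinates (Hom C Z (Y j)) {..<n j} \<phi>" by (simp add: has_dim_def)
    then obtain \<phi> where phi: "\<And>j. j \<in> J \<Longrightarrow> coordinates (Hom C Z (Y j)) {..<n j} (\<phi> j)" by metis
    have "coordinates (Hom C Z V) (Sigma J (\<lambda>j. {..<n j}))
        (\<lambda>f (j, b). if j \<in> J then \<phi> j (p j \<bullet> f) b else 0)"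
      by (rule coordinates_sum[OF b'(2) phi])
        (use b' Z biproduct_ext_target[OF b Z] biproduct_pair[OF b Z] in \<open>auto intro!: linear_post\<close>)
    from coordinates_has_dim[OF this] show "has_dim (Hom C Z V) (\<Sum>j\<in>J. n j)" unfolding card .
  }
qed

end


section \<open>Schur's lemma\<close>

context linear_category
begin

text \<open>
  Composition is associative only for composable morphisms. Bundling a morphism with its source and
  target lets the side conditions of long calculations be discharged by resolution.
\<close>

definition arr :: "'m \<Rightarrow> 'o \<Rightarrow> 'o \<Rightarrow> bool" where
  "arr f V Y \<longleftrightarrow> V \<in> Obj C \<and> Y \<in> Obj C \<and> f \<in> Mor C V Y"

lemma arrD: "arr f V Y \<Longrightarrow> V \<in> Obj C \<and> Y \<in> Obj C \<and> f \<in> Mor C V Y"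
  by (simp add: arr_def)

lemma arr_Id: "V \<in> Obj C \<Longrightarrow> arr (Id C V) V V"
  by (simp add: arr_def Id_in)

lemma arr_Comp: "arr f V Y \<Longrightarrow> arr g Y Z \<Longrightarrow> arr (g \<bullet> f) V Z"
  by (auto simp: arr_def Comp_in)

lemma arr_assoc: "arr f W V \<Longrightarrow> arr g V Y \<Longrightarrow> arr h Y Z \<Longrightarrow> (h \<bullet> g) \<bullet> f = h \<bullet> (g \<bullet> f)"
  by (auto simp: arr_def intro: Comp_assoc)

lemma arr_Id_left: "arr f V Y \<Longrightarrow> Id C Y \<bullet> f = f"
  and arr_Id_right: "arr f V Y \<Longrightarrow> f \<bullet> Id C V = f"
  by (auto simp: arr_def Id_Comp Comp_Id)

definition inverses :: "'o \<Rightarrow> 'o \<Rightarrow> 'm \<Rightarrow> 'm \<Rightarrow> bool" where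
  "inverses V Y f g \<longleftrightarrow> arr f V Y \<and> arr g Y V \<and> g \<bullet> f = Id C V \<and> f \<bullet> g = Id C Y"

lemma is_iso_inverses: "V \<in> Obj C \<Longrightarrow> Y \<in> Obj C \<Longrightarrow> is_iso C V Y f \<longleftrightarrow> (\<exists>g. inverses V Y f g)"
  by (auto simp: is_iso_def is_inverse_def inverses_def arr_def)

lemma inverses_sym: "inverses V Y f g \<Longrightarrow> inverses Y V g f"
  by (simp add: inverses_def)

lemma inverses_comp:
  assumes "inverses V Y f g" "inverses Y Z f' g'"
  shows "inverses V Z (f' \<bullet> f) (g \<bullet> g')"
proof -
  have a: "arr f V Y" "arr g Y V" "arr f' Y Z" "arr g' Z Y" using assms by (auto simp: inverses_def)
  have "(g \<bullet> g') \<bullet> (f' \<bullet> f) = g \<bullet> ((g' \<bullet> f') \<bullet> f)"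
    using arr_assoc[OF arr_Comp[OF a(1,3)] a(4,2)] arr_assoc[OF a(1,3,4)] by simp
  moreover have "(f' \<bullet> f) \<bullet> (g \<bullet> g') = f' \<bullet> ((f \<bullet> g) \<bullet> g')"
    using arr_assoc[OF arr_Comp[OF a(4,2)] a(1,3)] arr_assoc[OF a(4,2,1)] by simp
  ultimately show ?thesis using assms a
    by (auto simp: inverses_def arr_Id_left intro: arr_Comp)
qed

lemma isomorphic_iff: "isomorphic C V Y \<longleftrightarrow> (\<exists>f g. inverses V Y f g)"
proof -
  have "isomorphic C V Y \<longleftrightarrow> V \<in> Obj C \<and> Y \<in> Obj C \<and> (\<exists>f g. inverses V Y f g)"
    unfolding isomorphic_def by (metis is_iso_inverses)
  thus ?thesis by (auto simp: inverses_def arr_def)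
qed

lemma isomorphic_refl: "V \<in> Obj C \<Longrightarrow> isomorphic C V V"
  unfolding isomorphic_iff inverses_def using arr_Id arr_Id_left by blast

lemma isomorphic_sym: "isomorphic C V Y \<Longrightarrow> isomorphic C Y V"
  unfolding isomorphic_iff using inverses_sym by blast

lemma isomorphic_trans: "isomorphic C V Y \<Longrightarrow> isomorphic C Y Z \<Longrightarrow> isomorphic C V Z"
  unfolding isomorphic_iff using inverses_comp by blast

lemma isomorphic_in: "isomorphic C V Y \<Longrightarrow> V \<in> Obj C \<and> Y \<in> Obj C"
  by (simp add: isomorphic_def)

lemma iso_class_eq_iff: "V \<in> Obj C \<Longrightarrow> iso_class C V = iso_class C Y \<longleftrightarrow> isomorphic C V Y"
proof
  assume V: "V \<in> Obj C" and "iso_class C V = iso_class C Y"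
  hence "V \<in> iso_class C Y" using isomorphic_refl[OF V] by (auto simp: iso_class_def)
  thus "isomorphic C V Y" using isomorphic_sym by (simp add: iso_class_def)
next
  assume VY: "isomorphic C V Y"
  have "isomorphic C V Z \<longleftrightarrow> isomorphic C Y Z" for Z
    using isomorphic_trans[OF VY, of Z] isomorphic_trans[OF isomorphic_sym[OF VY], of Z] by blast
  thus "iso_class C V = iso_class C Y" by (simp add: iso_class_def)
qed

lemma isomorphic_direct_sum: "isomorphic C V Y \<Longrightarrow> direct_sum C V [Y]"
proof -
  assume "isomorphic C V Y"
  then obtain f g where fg: "inverses V Y f g" by (auto simp: isomorphic_iff)
  hence a: "arr f V Y" "arr g Y V" "g \<bullet> f = Id C V" "f \<bullet> g = Id C Y" by (auto simp: inverses_def)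
  interpret H: abelian_group "Hom C V V" using Hom_abelian_group arrD[OF a(1)] by blast
  have "finsum (Hom C V V) (\<lambda>j. g \<bullet> f) {..<Suc 0} = g \<bullet> f"
    using arrD[OF arr_Comp[OF a(1,2)]] by (simp add: lessThan_Suc)
  thus ?thesis unfolding direct_sum_biproduct biproduct_def
    using a arrD[OF a(1)] arrD[OF a(2)]
    by (intro exI[of _ "\<lambda>_. g"] exI[of _ "\<lambda>_. f"]) auto
qed

lemma linear_inj_precompose:
  assumes fg: "inverses V Y f g" and Z: "Z \<in> Obj C"
  shows "linear_on (Hom C Y Z) (Hom C V Z) (\<lambda>h. h \<bullet> f)" "inj_on (\<lambda>h. h \<bullet> f) (Mor C Y Z)"
proof -
  have a: "arr f V Y" "arr g Y V" "f \<bullet> g = Id C Y" using fg by (auto simp: inverses_def)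
  show "linear_on (Hom C Y Z) (Hom C V Z) (\<lambda>h. h \<bullet> f)" using linear_pre a Z by (auto simp: arr_def)
  have "(h \<bullet> f) \<bullet> g = h" if "h \<in> Mor C Y Z" for h
    using that a Z Comp_assoc[of Y V Y Z g f h] by (auto simp: arr_def Comp_Id)
  thus "inj_on (\<lambda>h. h \<bullet> f) (Mor C Y Z)" by (rule inj_on_inverseI[where g = "\<lambda>k. k \<bullet> g"])
qed

lemma has_dim_isomorphic:
  assumes "isomorphic C V Y" and Z: "Z \<in> Obj C"
    and dim: "has_dim (Hom C V Z) n" "has_dim (Hom C Y Z) m"
  shows "n = m"
proof -
  obtain f g where fg: "inverses V Y f g" using assms by (auto simp: isomorphic_iff)
  have VY: "V \<in> Obj C" "Y \<in> Obj C" using isomorphic_in assms by auto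
  have "m \<le> n"
    by (rule has_dim_le[OF Hom_vector_space[OF VY(2) Z] dim(2,1)]) (rule linear_inj_precompose[OF fg Z])+
  moreover have "n \<le> m"
    by (rule has_dim_le[OF Hom_vector_space[OF VY(1) Z] dim]) (rule linear_inj_precompose[OF inverses_sym[OF fg] Z])+
  ultimately show ?thesis by simp
qed

lemma zero_objectI:
  assumes V: "V \<in> Obj C" and Id: "Id C V = Zero C V V"
  shows "zero_object C V"
proof -
  have "f = Zero C V Y" if "Y \<in> Obj C" "f \<in> Mor C V Y" for f Y
    using Comp_Id[OF V that] Comp_Zero_right[OF V V that] Id by simp
  moreover have "f = Zero C Y V" if "Y \<in> Obj C" "f \<in> Mor C Y V" for f Y
    using Id_Comp[OF that(1) V that(2)] Comp_Zero_left[OF that(1) V V that(2)] Id by simp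
  ultimately show ?thesis unfolding zero_object_def using V Zero_in by blast
qed

lemma simple_object_in: "simple_object C V \<Longrightarrow> V \<in> Obj C"
  by (simp add: simple_object_def)

lemma simple_Id_nonzero: "simple_object C V \<Longrightarrow> Id C V \<noteq> Zero C V V"
  using zero_objectI[of V] unfolding simple_object_def by auto

lemma split_mono_monic:
  assumes i: "arr i Y V" and p: "arr p V Y" and pi: "p \<bullet> i = Id C Y"
  shows "monic C Y V i"
  unfolding monic_def
proof (intro conjI ballI impI)
  show "i \<in> Mor C Y V" using i by (simp add: arr_def)
  fix W g h assume W: "W \<in> Obj C" "g \<in> Mor C W Y" "h \<in> Mor C W Y" "i \<bullet> g = i \<bullet> h"
  hence gh: "arr g W Y" "arr h W Y" using i by (auto simp: arr_def)
  have "p \<bullet> (i \<bullet> g) = p \<bullet> (i \<bullet> h)" using W by simp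
  thus "g = h" using arr_assoc[OF gh(1) i p] arr_assoc[OF gh(2) i p] pi arr_Id_left gh by metis
qed

text \<open>
  The value \<open>p(f)\<close> of a polynomial at an endomorphism, by Horner's scheme.
\<close>

definition polynomial_at :: "'o \<Rightarrow> 'm \<Rightarrow> 'k poly \<Rightarrow> 'm" where
  "polynomial_at V f p = fold_coeffs (\<lambda>a x. a \<odot>\<^bsub>Hom C V V\<^esub> Id C V \<oplus>\<^bsub>Hom C V V\<^esub> f \<bullet> x) p (Zero C V V)"

context
  fixes V f
  assumes V: "V \<in> Obj C" and f: "f \<in> Mor C V V"
begin

lemma polynomial_at_0: "polynomial_at V f 0 = Zero C V V"
  by (simp add: polynomial_at_def)

lemma polynomial_at_pCons:
  "polynomial_at V f (pCons a p) = a \<odot>\<^bsub>Hom C V V\<^esub> Id C V \<oplus>\<^bsub>Hom C V V\<^esub> f \<bullet> polynomial_at V f p"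
proof (cases "p = 0 \<and> a = 0")
  case True
  thus ?thesis using V f
    by (simp add: polynomial_at_0 smult_zero_scalar Id_in Comp_Zero_right add_Zero Zero_in)
qed (auto simp: polynomial_at_def)

lemma polynomial_at_in: "polynomial_at V f p \<in> Mor C V V"
  by (induction p) (use V f in \<open>auto simp: polynomial_at_0 polynomial_at_pCons Zero_in intro!: add_in smult_in Id_in Comp_in[of V V V]\<close>)

lemma polynomial_at_add:
  "polynomial_at V f (p + q) = polynomial_at V f p \<oplus>\<^bsub>Hom C V V\<^esub> polynomial_at V f q"
proof (induction p q rule: poly_induct2)
  case 0
  thus ?case using V by (simp add: polynomial_at_0 add_Zero Zero_in)
next
  case (pCons a p b q)
  interpret H: abelian_group "Hom C V V" by (rule Hom_abelian_group[OF V V])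
  have c: "f \<bullet> polynomial_at V f r \<in> Mor C V V" "c \<odot>\<^bsub>Hom C V V\<^esub> Id C V \<in> Mor C V V" for r c
    using V f polynomial_at_in by (auto intro!: Comp_in[of V V V] smult_in Id_in)
  show ?case using pCons.IH V f
    by (simp add: polynomial_at_pCons Comp_add_right polynomial_at_in smult_add_scalar Id_in c H.a_ac)
qed

lemma polynomial_at_smult:
  "polynomial_at V f (smult c p) = c \<odot>\<^bsub>Hom C V V\<^esub> polynomial_at V f p"
proof (induction p)
  case 0
  thus ?case using V by (simp add: polynomial_at_0 smult_Zero)
next
  case (pCons a p)
  have c: "f \<bullet> polynomial_at V f r \<in> Mor C V V" "c \<odot>\<^bsub>Hom C V V\<^esub> Id C V \<in> Mor C V V" for r c
    using V f polynomial_at_in by (auto intro!: Comp_in[of V V V] smult_in Id_in)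
  show ?case using pCons.IH V f
    by (simp add: polynomial_at_pCons smult_add c smult_smult Id_in Comp_smult_right polynomial_at_in)
qed

lemma polynomial_at_linear_factor:
  "polynomial_at V f ([:- a, 1:] * q)
    = (f \<ominus>\<^bsub>Hom C V V\<^esub> a \<odot>\<^bsub>Hom C V V\<^esub> Id C V) \<bullet> polynomial_at V f q"
proof -
  interpret H: abelian_group "Hom C V V" by (rule Hom_abelian_group[OF V V])
  let ?q = "polynomial_at V f q"
  have c: "f \<bullet> ?q \<in> Mor C V V" "a \<odot>\<^bsub>Hom C V V\<^esub> Id C V \<in> Mor C V V" for a
    using V f polynomial_at_in by (auto intro!: Comp_in[of V V V] smult_in Id_in)
  have "polynomial_at V f ([:- a, 1:] * q) = polynomial_at V f (smult (- a) q + pCons 0 q)"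
    by simp
  also have "\<dots> = (- a) \<odot>\<^bsub>Hom C V V\<^esub> ?q \<oplus>\<^bsub>Hom C V V\<^esub> f \<bullet> ?q"
    using V c by (simp only: polynomial_at_add polynomial_at_smult polynomial_at_pCons)
      (simp add: smult_zero_scalar Id_in add_Zero)
  also have "\<dots> = f \<bullet> ?q \<oplus>\<^bsub>Hom C V V\<^esub> (-1) \<odot>\<^bsub>Hom C V V\<^esub> (a \<odot>\<^bsub>Hom C V V\<^esub> ?q)"
    using V c polynomial_at_in by (simp add: smult_smult H.a_comm smult_in)
  also have "\<dots> = f \<bullet> ?q \<ominus>\<^bsub>Hom C V V\<^esub> (a \<odot>\<^bsub>Hom C V V\<^esub> Id C V) \<bullet> ?q"
    using V c polynomial_at_in
    by (simp add: minus_smult smult_in Comp_smult_left Id_in Id_Comp)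
  also have "\<dots> = (f \<ominus>\<^bsub>Hom C V V\<^esub> a \<odot>\<^bsub>Hom C V V\<^esub> Id C V) \<bullet> ?q"
    using V f c polynomial_at_in by (simp add: Comp_minus_left)
  finally show ?thesis .
qed

text \<open>
  If \<open>n\<close> morphisms span the endomorphisms, then the powers of \<open>f\<close> with exponents \<open>0, \<dots>, n\<close> are linearly
  dependent.
\<close>

lemma ex_annihilating_polynomial:
  assumes B: "finite B" "B \<subseteq> Mor C V V"
    and span: "\<And>g. g \<in> Mor C V V \<Longrightarrow> \<exists>c. g = finsum (Hom C V V) (\<lambda>b. c b \<odot>\<^bsub>Hom C V V\<^esub> b) B"
  shows "\<exists>p. p \<noteq> 0 \<and> polynomial_at V f p = Zero C V V"
proof -
  interpret H: abelian_group "Hom C V V" by (rule Hom_abelian_group[OF V V])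
  define S where "S c = finsum (Hom C V V) (\<lambda>b. c b \<odot>\<^bsub>Hom C V V\<^esub> b) B" for c
  have sm: "c \<odot>\<^bsub>Hom C V V\<^esub> b \<in> Mor C V V" if "b \<in> B" for b c
    using that B V by (auto intro: smult_in)
  have S_add: "S (\<lambda>b. c b + c' b) = S c \<oplus>\<^bsub>Hom C V V\<^esub> S c'" for c c'
  proof -
    have "S (\<lambda>b. c b + c' b)
        = finsum (Hom C V V) (\<lambda>b. c b \<odot>\<^bsub>Hom C V V\<^esub> b \<oplus>\<^bsub>Hom C V V\<^esub> c' b \<odot>\<^bsub>Hom C V V\<^esub> b) B"
      unfolding S_def by (rule finsum_cong_Mor) (use V B sm in \<open>auto simp: smult_add_scalar subset_iff\<close>)
    thus ?thesis unfolding S_def using sm by (simp add: H.finsum_addf Pi_iff)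
  qed
  have S_smult: "S (\<lambda>b. a * c b) = a \<odot>\<^bsub>Hom C V V\<^esub> S c" for a c
  proof -
    have "linear_on (Hom C V V) (Hom C V V) (\<lambda>g. a \<odot>\<^bsub>Hom C V V\<^esub> g)"
      using V by (auto simp: linear_on_def smult_in smult_add smult_smult mult.commute)
    hence "a \<odot>\<^bsub>Hom C V V\<^esub> S c
        = finsum (Hom C V V) (\<lambda>b. a \<odot>\<^bsub>Hom C V V\<^esub> (c b \<odot>\<^bsub>Hom C V V\<^esub> b)) B"
      unfolding S_def using V B sm by (intro linear_finsum) auto
    also have "\<dots> = S (\<lambda>b. a * c b)"
      unfolding S_def by (rule finsum_cong_Mor) (use V B sm in \<open>auto simp: smult_smult subset_iff\<close>)
    finally show ?thesis by simp
  qed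
  have S_zero: "S (\<lambda>b. 0) = Zero C V V"
    using S_smult[of 0 "\<lambda>b. 0"] V sm by (simp add: smult_zero_scalar S_def finsum_in)
  have "\<exists>c. polynomial_at V f (monom 1 n) = S c" for n
    unfolding S_def by (rule span[OF polynomial_at_in])
  then obtain M where M: "\<And>n. polynomial_at V f (monom 1 n) = S (M n)" by metis
  have "card B < card {..card B}" by simp
  from homogeneous_system_solution[OF B(1) _ this, of "\<lambda>b n. M n b"]
  obtain c where c: "\<exists>n\<le>card B. c n \<noteq> 0" "\<And>b. b \<in> B \<Longrightarrow> (\<Sum>n\<le>card B. M n b * c n) = 0"
    by auto
  have sum: "polynomial_at V f (\<Sum>n\<in>U. monom (c n) n) = S (\<lambda>b. \<Sum>n\<in>U. M n b * c n)" if "finite U" for U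
    using that
  proof (induction U rule: finite_induct)
    case empty
    thus ?case using S_zero by (simp add: polynomial_at_0)
  next
    case (insert x U)
    have "polynomial_at V f (monom (c x) x) = S (\<lambda>b. M x b * c x)"
      using polynomial_at_smult[of "c x" "monom 1 x"] M[of x] S_smult[of "c x" "M x"]
      by (simp add: smult_monom mult.commute)
    thus ?case using insert by (simp add: polynomial_at_add S_add)
  qed
  let ?p = "\<Sum>n\<le>card B. monom (c n) n"
  have "polynomial_at V f ?p = S (\<lambda>b. \<Sum>n\<le>card B. M n b * c n)" by (rule sum) simp
  also have "\<dots> = S (\<lambda>b. 0)"
    unfolding S_def by (rule finsum_cong_Mor) (use V sm c in auto)
  finally have "polynomial_at V f ?p = Zero C V V" using S_zero by simp
  moreover have "?p \<noteq> 0"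
  proof -
    obtain n where n: "n \<le> card B" "c n \<noteq> 0" using c(1) by blast
    have "coeff ?p n = c n" using n by (simp add: coeff_sum if_distrib cong: if_cong)
    thus ?thesis using n by auto
  qed
  ultimately show ?thesis by blast
qed

end

end

context abelian_category
begin

text \<open>
  The kernel of \<open>f\<close> is a subobject of the simple object \<open>V\<close>. If it is all of \<open>V\<close>, then \<open>f\<close> vanishes; if
  it is zero, then \<open>f\<close> is monic, hence an isomorphism because \<open>Y\<close> is simple.
\<close>

lemma Schur:
  assumes V: "simple_object C V" and Y: "simple_object C Y" and f: "f \<in> Mor C V Y"
  shows "f = Zero C V Y \<or> is_iso C V Y f"
proof -
  have obj: "V \<in> Obj C" "Y \<in> Obj C" using V Y simple_object_in by auto
  obtain K k where "is_kernel C K k V Y f" using ex_kernel[OF obj f] by blast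
  hence K: "K \<in> Obj C" "k \<in> Mor C K V" "f \<bullet> k = Zero C K Y"
    and univ: "\<And>W h. W \<in> Obj C \<Longrightarrow> h \<in> Mor C W V \<Longrightarrow> f \<bullet> h = Zero C W Y \<Longrightarrow> \<exists>!u. u \<in> Mor C W K \<and> k \<bullet> u = h"
    unfolding is_kernel_def by blast+
  have "monic C K V k"
    unfolding monic_def
  proof (intro conjI ballI impI K(2))
    fix W g h assume W: "W \<in> Obj C" "g \<in> Mor C W K" "h \<in> Mor C W K" "k \<bullet> g = k \<bullet> h"
    have "f \<bullet> (k \<bullet> g) = Zero C W Y"
      using Comp_assoc[of W K V Y g k f] W K obj f by (simp add: Comp_Zero_left)
    hence "\<exists>!u. u \<in> Mor C W K \<and> k \<bullet> u = k \<bullet> g" using univ W K obj Comp_in by blast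
    thus "g = h" using W by metis
  qed
  hence "zero_object C K \<or> is_iso C K V k" using V K unfolding simple_object_def by blast
  thus ?thesis
  proof
    assume "is_iso C K V k"
    then obtain k' where k': "inverses K V k k'" using is_iso_inverses K obj by blast
    hence "k' \<in> Mor C V K" "k \<bullet> k' = Id C V" by (auto simp: inverses_def arr_def)
    hence "f = (f \<bullet> k) \<bullet> k'"
      using Comp_assoc[of V K V Y k' k f] K obj f by (simp add: Comp_Id)
    also have "\<dots> = Zero C V Y" using K obj f \<open>k' \<in> Mor C V K\<close> by (simp add: Comp_Zero_left)
    finally show ?thesis by simp
  next
    assume zero: "zero_object C K"
    have "monic C V Y f"
      unfolding monic_def
    proof (intro conjI ballI impI f)
      fix W g h assume W: "W \<in> Obj C" "g \<in> Mor C W V" "h \<in> Mor C W V" "f \<bullet> g = f \<bullet> h"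
      have "f \<bullet> (g \<ominus>\<^bsub>Hom C W V\<^esub> h) = Zero C W Y"
        using W obj f Comp_in[of W V Y _ f] by (simp add: Comp_minus_right minus_eq_Zero)
      then obtain u where u: "u \<in> Mor C W K" "k \<bullet> u = g \<ominus>\<^bsub>Hom C W V\<^esub> h"
        using univ[of W "g \<ominus>\<^bsub>Hom C W V\<^esub> h"] W obj minus_in by blast
      have "u = Zero C W K" using u zero W unfolding zero_object_def by blast
      hence "g \<ominus>\<^bsub>Hom C W V\<^esub> h = Zero C W V" using u K W obj Comp_Zero_right by metis
      thus "g = h" using minus_eq_Zero W obj by blast
    qed
    thus ?thesis using Y V obj unfolding simple_object_def by blast
  qed
qed

end

context fusion_category
begin

text \<open>
  A nonzero polynomial annihilates \<open>f\<close>, and over an algebraically closed field it has a linear factor.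
  By Schur's lemma \<open>f - a\<close> is zero or invertible, and in the second case the factor can be cancelled, which
  lowers the degree; a constant cannot remain because the identity of a simple object is not zero.
\<close>

lemma simple_endomorphism:
  assumes V: "simple_object C V" and f: "f \<in> Mor C V V"
  shows "\<exists>a. f = a \<odot>\<^bsub>Hom C V V\<^esub> Id C V"
proof -
  have obj: "V \<in> Obj C" using V simple_object_in by auto
  obtain B where B: "finite B" "B \<subseteq> Mor C V V"
    "\<And>g. g \<in> Mor C V V \<Longrightarrow> \<exists>c. g = finsum (Hom C V V) (\<lambda>b. c b \<odot>\<^bsub>Hom C V V\<^esub> b) B"
    using finite_dim[OF obj obj] by blast
  obtain p where p: "p \<noteq> 0" "polynomial_at V f p = Zero C V V"
    using ex_annihilating_polynomial[OF obj f B] by blast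
  from p show ?thesis
  proof (induction "degree p" arbitrary: p)
    case 0
    then obtain c where c: "p = [:c:]" by (metis degree_eq_zeroE)
    hence "c \<noteq> 0" using 0 by auto
    have "c \<odot>\<^bsub>Hom C V V\<^esub> Id C V = Zero C V V"
      using 0 c obj f by (simp add: polynomial_at_pCons polynomial_at_0 Comp_Zero_right add_Zero smult_in Id_in)
    hence "inverse c \<odot>\<^bsub>Hom C V V\<^esub> (c \<odot>\<^bsub>Hom C V V\<^esub> Id C V) = Zero C V V"
      using obj by (simp add: smult_Zero)
    hence "Id C V = Zero C V V" using obj \<open>c \<noteq> 0\<close> by (simp add: smult_smult Id_in smult_one)
    thus ?case using simple_Id_nonzero[OF V] by simp
  next
    case (Suc n)
    then obtain a where "poly p a = 0" using alg_closed_imp_poly_has_root[of p] by auto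
    then obtain q where q: "p = [:- a, 1:] * q" by (metis poly_eq_0_iff_dvd dvdE)
    hence q0: "q \<noteq> 0" using Suc.prems by auto
    have deg: "n = degree q" using Suc.hyps q0 q by (simp add: degree_mult_eq del: mult_pCons_left)
    let ?g = "f \<ominus>\<^bsub>Hom C V V\<^esub> a \<odot>\<^bsub>Hom C V V\<^esub> Id C V" and ?q = "polynomial_at V f q"
    have g: "?g \<in> Mor C V V" and qin: "?q \<in> Mor C V V"
      using obj f by (auto intro!: minus_in smult_in Id_in polynomial_at_in)
    have gq: "?g \<bullet> ?q = Zero C V V"
      using Suc.prems(2) polynomial_at_linear_factor[OF obj f, of a q] by (simp only: q)
    show ?case
    proof (cases "?g = Zero C V V")
      case True
      hence "f = a \<odot>\<^bsub>Hom C V V\<^esub> Id C V" using minus_eq_Zero obj f smult_in Id_in by metis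
      thus ?thesis by blast
    next
      case False
      then obtain g' where g': "inverses V V ?g g'"
        using Schur[OF V V g] is_iso_inverses[OF obj obj] by blast
      hence "g' \<in> Mor C V V" "g' \<bullet> ?g = Id C V" by (auto simp: inverses_def arr_def)
      hence "?q = g' \<bullet> (?g \<bullet> ?q)"
        using Comp_assoc[of V V V V ?q ?g g'] obj g qin by (simp add: Id_Comp)
      also have "\<dots> = Zero C V V" using gq obj \<open>g' \<in> Mor C V V\<close> by (simp add: Comp_Zero_right)
      finally show ?thesis using Suc.hyps(1)[OF deg q0] by blast
    qed
  qed
qed

text \<open>
  Composing with the inverse of one isomorphism identifies morphisms between isomorphic simple objects
  with endomorphisms, which are scalars.
\<close>

lemma simple_Hom_dim:
  assumes V: "simple_object C V" and Y: "simple_object C Y"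
  shows "has_dim (Hom C V Y) (if isomorphic C V Y then 1 else 0)"
proof -
  have obj: "V \<in> Obj C" "Y \<in> Obj C" using V Y simple_object_in by auto
  show ?thesis
  proof (cases "isomorphic C V Y")
    case False
    hence zero: "f = Zero C V Y" if "f \<in> Mor C V Y" for f
      using Schur[OF V Y that] obj by (auto simp: isomorphic_def)
    have "bij_betw (\<lambda>f (b :: nat). 0 :: 'k) (Mor C V Y) {c. \<forall>b. b \<notin> {} \<longrightarrow> c b = 0}"
    proof -
      have "Mor C V Y = {Zero C V Y}" using zero Zero_in[OF obj] by blast
      thus ?thesis by (auto simp: bij_betw_def fun_eq_iff)
    qed
    hence "coordinates (Hom C V Y) {} (\<lambda>f (b :: nat). 0)" by (simp add: coordinates_def)
    from coordinates_has_dim[OF this] False show ?thesis by simp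
  next
    case True
    then obtain u w where uw: "inverses V Y u w" by (auto simp: isomorphic_iff)
    hence u: "u \<in> Mor C V Y" and w: "w \<in> Mor C Y V" and wu: "w \<bullet> u = Id C V" and uw': "u \<bullet> w = Id C Y"
      by (auto simp: inverses_def arr_def)
    have span: "\<exists>a. f = a \<odot>\<^bsub>Hom C V Y\<^esub> u" if f: "f \<in> Mor C V Y" for f
    proof -
      obtain a where a: "w \<bullet> f = a \<odot>\<^bsub>Hom C V V\<^esub> Id C V"
        using simple_endomorphism[OF V Comp_in[OF obj(1,2,1) f w]] by blast
      have "f = u \<bullet> (w \<bullet> f)"
        using Comp_assoc[of V Y V Y f w u] obj f w u uw' by (simp add: Id_Comp)
      also have "\<dots> = a \<odot>\<^bsub>Hom C V Y\<^esub> u" unfolding a using obj u by (simp add: Comp_smult_right Id_in Comp_Id)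
      finally show ?thesis by blast
    qed
    have unique: "a = b" if ab: "a \<odot>\<^bsub>Hom C V Y\<^esub> u = b \<odot>\<^bsub>Hom C V Y\<^esub> u" for a b
    proof (rule ccontr)
      assume "a \<noteq> b"
      have "w \<bullet> (c \<odot>\<^bsub>Hom C V Y\<^esub> u) = c \<odot>\<^bsub>Hom C V V\<^esub> Id C V" for c
        using obj u w by (simp add: Comp_smult_right wu)
      hence "a \<odot>\<^bsub>Hom C V V\<^esub> Id C V = b \<odot>\<^bsub>Hom C V V\<^esub> Id C V" using ab by metis
      moreover have "(a - b) \<odot>\<^bsub>Hom C V V\<^esub> Id C V
          = a \<odot>\<^bsub>Hom C V V\<^esub> Id C V \<ominus>\<^bsub>Hom C V V\<^esub> b \<odot>\<^bsub>Hom C V V\<^esub> Id C V"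
        using obj smult_add_scalar[OF obj(1,1) Id_in[OF obj(1)], of a "- b"]
        by (simp add: minus_smult smult_in Id_in smult_smult)
      ultimately have "(a - b) \<odot>\<^bsub>Hom C V V\<^esub> Id C V = Zero C V V"
        using obj by (simp add: minus_eq_Zero smult_in Id_in)
      hence "inverse (a - b) \<odot>\<^bsub>Hom C V V\<^esub> ((a - b) \<odot>\<^bsub>Hom C V V\<^esub> Id C V) = Zero C V V"
        using obj by (simp add: smult_Zero)
      hence "Id C V = Zero C V V" using obj \<open>a \<noteq> b\<close> by (simp add: smult_smult Id_in smult_one)
      thus False using simple_Id_nonzero[OF V] by simp
    qed
    define \<alpha> where "\<alpha> f = (THE a. f = a \<odot>\<^bsub>Hom C V Y\<^esub> u)" for f
    have alpha: "\<alpha> (a \<odot>\<^bsub>Hom C V Y\<^esub> u) = a" for a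
      unfolding \<alpha>_def by (rule the_equality) (auto dest: unique)
    have alpha': "f = \<alpha> f \<odot>\<^bsub>Hom C V Y\<^esub> u" if "f \<in> Mor C V Y" for f
      using span[OF that] alpha by auto
    have "coordinates (Hom C V Y) {0::nat} (\<lambda>f b. if b = 0 then \<alpha> f else 0)"
      unfolding coordinates_def
    proof (intro conjI ballI allI)
      show "bij_betw (\<lambda>f b. if b = 0 then \<alpha> f else 0) (Mor C V Y) {c. \<forall>b. b \<notin> {0::nat} \<longrightarrow> c b = 0}"
      proof (rule bij_betwI[where g = "\<lambda>c. c 0 \<odot>\<^bsub>Hom C V Y\<^esub> u"])
        show "(\<lambda>c. c 0 \<odot>\<^bsub>Hom C V Y\<^esub> u) \<in> {c. \<forall>b. b \<notin> {0::nat} \<longrightarrow> c b = 0} \<rightarrow> Mor C V Y"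
          using smult_in obj u by blast
        show "(\<lambda>b. if b = 0 then \<alpha> (c 0 \<odot>\<^bsub>Hom C V Y\<^esub> u) else 0) = c"
          if "c \<in> {c. \<forall>b. b \<notin> {0::nat} \<longrightarrow> c b = 0}" for c
          using that alpha by (auto simp: fun_eq_iff)
      qed (use alpha' in auto)
      fix f g assume fg: "f \<in> Mor C V Y" "g \<in> Mor C V Y"
      have "f \<oplus>\<^bsub>Hom C V Y\<^esub> g = (\<alpha> f + \<alpha> g) \<odot>\<^bsub>Hom C V Y\<^esub> u"
        using alpha'[OF fg(1)] alpha'[OF fg(2)] smult_add_scalar[OF obj u] by metis
      thus "(\<lambda>b. if b = 0 then \<alpha> (f \<oplus>\<^bsub>Hom C V Y\<^esub> g) else 0)
          = (\<lambda>b. (if b = (0::nat) then \<alpha> f else 0) + (if b = 0 then \<alpha> g else 0))"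
        using alpha by auto
    next
      fix a f assume f: "f \<in> Mor C V Y"
      have "a \<odot>\<^bsub>Hom C V Y\<^esub> f = (a * \<alpha> f) \<odot>\<^bsub>Hom C V Y\<^esub> u"
        using alpha'[OF f] smult_smult[OF obj u] by metis
      thus "(\<lambda>b. if b = 0 then \<alpha> (a \<odot>\<^bsub>Hom C V Y\<^esub> f) else 0)
          = (\<lambda>b. a * (if b = (0::nat) then \<alpha> f else 0))"
        using alpha by auto
    qed simp
    from coordinates_has_dim[OF this] True show ?thesis by simp
  qed
qed

end


section \<open>Multiplicities and tensor products\<close>

context linear_category
begin

lemma monic_isomorphism:
  assumes h: "monic C W Y h" and fg: "inverses Y V f g" and W: "W \<in> Obj C"
  shows "monic C W V (f \<bullet> h)"
proof -
  have a: "arr f Y V" "arr g V Y" "g \<bullet> f = Id C Y" using fg by (auto simp: inverses_def)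
  have hW: "arr h W Y" using h W a by (auto simp: monic_def arr_def)
  show ?thesis
    unfolding monic_def
  proof (intro conjI ballI impI)
    show "f \<bullet> h \<in> Mor C W V" using arr_Comp[OF hW a(1)] by (simp add: arr_def)
    fix U u v assume U: "U \<in> Obj C" "u \<in> Mor C U W" "v \<in> Mor C U W" "(f \<bullet> h) \<bullet> u = (f \<bullet> h) \<bullet> v"
    have uv: "arr u U W" "arr v U W" using U W by (auto simp: arr_def)
    have *: "g \<bullet> ((f \<bullet> h) \<bullet> w) = h \<bullet> w" if "arr w U W" for w
      using arr_assoc[OF that hW a(1)] arr_assoc[OF arr_Comp[OF that hW] a(1,2)] a(3)
        arr_Id_left[OF arr_Comp[OF that hW]] by simp
    have "h \<bullet> u = h \<bullet> v" using *[OF uv(1)] *[OF uv(2)] U(4) by simp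
    thus "u = v" using h U unfolding monic_def by blast
  qed
qed

lemma zero_object_isomorphic:
  assumes Y: "zero_object C Y" and iso: "isomorphic C V Y"
  shows "zero_object C V"
proof -
  obtain f g where "inverses V Y f g" using iso by (auto simp: isomorphic_iff)
  hence a: "arr f V Y" "arr g Y V" "g \<bullet> f = Id C V" by (auto simp: inverses_def)
  have V: "V \<in> Obj C" "Y \<in> Obj C" using isomorphic_in[OF iso] by auto
  have "f = Zero C V Y" using Y a(1) by (auto simp: zero_object_def arr_def)
  hence "Id C V = Zero C V V" using a V Comp_Zero_right[of V Y V g] by (auto simp: arr_def)
  thus ?thesis by (rule zero_objectI[OF V(1)])
qed

text \<open>
  Needed because a class of simple objects is represented by an arbitrary member.
\<close>

lemma simple_object_isomorphic:
  assumes V: "simple_object C V" and iso: "isomorphic C V Y"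
  shows "simple_object C Y"
proof -
  obtain f g where fg: "inverses V Y f g" using iso by (auto simp: isomorphic_iff)
  have obj: "V \<in> Obj C" "Y \<in> Obj C" using isomorphic_in[OF iso] by auto
  have "\<not> zero_object C Y" using zero_object_isomorphic[OF _ iso] V by (auto simp: simple_object_def)
  moreover have "zero_object C W \<or> is_iso C W Y h" if W: "W \<in> Obj C" and h: "monic C W Y h" for W h
  proof -
    have "monic C W V (g \<bullet> h)" by (rule monic_isomorphism[OF h inverses_sym[OF fg] W])
    hence "zero_object C W \<or> is_iso C W V (g \<bullet> h)" using V W unfolding simple_object_def by blast
    moreover have "is_iso C W Y h" if iso: "is_iso C W V (g \<bullet> h)"
    proof -
      obtain k where k: "inverses W V (g \<bullet> h) k" using iso is_iso_inverses[OF W obj(1)] by blast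
      have hW: "arr h W Y" using h W obj by (auto simp: monic_def arr_def)
      have "f \<bullet> (g \<bullet> h) = h"
        using arr_assoc[OF hW, of g V f Y] arr_Id_left[OF hW] fg by (auto simp: inverses_def)
      thus ?thesis using inverses_comp[OF k fg] is_iso_inverses[OF W obj(2)] by auto
    qed
    ultimately show ?thesis by blast
  qed
  ultimately show ?thesis using obj unfolding simple_object_def by blast
qed

lemma Irr_representative:
  assumes "c \<in> Irr C"
  shows "simple_object C (representative c)" "iso_class C (representative c) = c" "representative c \<in> c"
proof -
  obtain V where V: "simple_object C V" "c = iso_class C V" using assms by (auto simp: Irr_def)
  have "V \<in> c" using V isomorphic_refl simple_object_in by (auto simp: iso_class_def)
  thus r: "representative c \<in> c" unfolding representative_def by (rule someI)
  hence iso: "isomorphic C V (representative c)" using V by (simp add: iso_class_def)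
  show "simple_object C (representative c)" by (rule simple_object_isomorphic[OF V(1) iso])
  show "iso_class C (representative c) = c"
    using iso_class_eq_iff[OF simple_object_in[OF V(1)], of "representative c"] iso V(2) by simp
qed

lemma iso_class_Irr: "simple_object C V \<Longrightarrow> iso_class C V \<in> Irr C"
  by (auto simp: Irr_def)

lemma isomorphic_representative:
  "simple_object C V \<Longrightarrow> isomorphic C V (representative (iso_class C V))"
  using Irr_representative(3)[OF iso_class_Irr] by (simp add: iso_class_def)

end

context fusion_category
begin

abbreviation mult :: "'o \<Rightarrow> 'o \<Rightarrow> nat" where
  "mult V Z \<equiv> multiplicity_in C V (iso_class C Z)"

lemma simple_decomposition_dim:
  assumes dec: "simple_decomposition C V Ys" and Z: "simple_object C Z"
  shows "has_dim (Hom C V Z) (card {j. j < length Ys \<and> Ys ! j \<in> iso_class C Z})"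
    and "has_dim (Hom C Z V) (card {j. j < length Ys \<and> Ys ! j \<in> iso_class C Z})"
proof -
  obtain i p where b: "biproduct C V {..<length Ys} ((!) Ys) i p"
    and Ys: "\<And>j. j < length Ys \<Longrightarrow> simple_object C (Ys ! j)"
    using dec by (auto simp: simple_decomposition_def direct_sum_biproduct)
  have ZO: "Z \<in> Obj C" using Z simple_object_in by auto
  have card: "(\<Sum>j<length Ys. if isomorphic C Z (Ys ! j) then 1 else 0)
      = card {j. j < length Ys \<and> Ys ! j \<in> iso_class C Z}"
    by (simp add: sum.If_cases iso_class_def) (rule arg_cong[where f = card], auto)
  have iso: "isomorphic C (Ys ! j) Z \<longleftrightarrow> isomorphic C Z (Ys ! j)" for j
    using isomorphic_sym by auto
  show "has_dim (Hom C V Z) (card {j. j < length Ys \<and> Ys ! j \<in> iso_class C Z})"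
    unfolding card[symmetric]
    by (rule biproduct_dim(1)[OF b ZO]) (use simple_Hom_dim[OF Ys Z] iso in simp)
  show "has_dim (Hom C Z V) (card {j. j < length Ys \<and> Ys ! j \<in> iso_class C Z})"
    unfolding card[symmetric]
    by (rule biproduct_dim(2)[OF b ZO]) (use simple_Hom_dim[OF Z Ys] in simp)
qed

text \<open>
  The multiplicity is defined by means of some chosen decomposition; as a dimension it does not depend on
  the choice, and it can be read off on either side.
\<close>

lemma Hom_dim:
  assumes V: "V \<in> Obj C" and Z: "simple_object C Z"
  shows "has_dim (Hom C V Z) (mult V Z)" "has_dim (Hom C Z V) (mult V Z)"
proof -
  define Ys where "Ys = (SOME Ys. simple_decomposition C V Ys)"
  have "simple_decomposition C V Ys" unfolding Ys_def using semisimple[OF V] by (rule someI_ex)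
  moreover have "mult V Z = card {j. j < length Ys \<and> Ys ! j \<in> iso_class C Z}"
    unfolding multiplicity_in_def Ys_def by (simp add: length_filter_conv_card)
  ultimately show "has_dim (Hom C V Z) (mult V Z)" "has_dim (Hom C Z V) (mult V Z)"
    using simple_decomposition_dim[OF _ Z] by simp_all
qed

lemma mult_eqI:
  assumes V: "V \<in> Obj C" and Z: "simple_object C Z"
  shows "has_dim (Hom C V Z) n \<Longrightarrow> mult V Z = n"
  using has_dim_unique[OF Hom_vector_space Hom_dim(1)] V Z simple_object_in by blast

lemma mult_decomposition:
  assumes "simple_decomposition C V Ys" and "simple_object C Z"
  shows "mult V Z = card {j. j < length Ys \<and> Ys ! j \<in> iso_class C Z}"
  by (rule mult_eqI[OF _ assms(2) simple_decomposition_dim(1)[OF assms]])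
    (use assms in \<open>auto simp: simple_decomposition_def direct_sum_def\<close>)

lemma mult_isomorphic: "isomorphic C V Y \<Longrightarrow> simple_object C Z \<Longrightarrow> mult V Z = mult Y Z"
  using has_dim_isomorphic Hom_dim(1) isomorphic_in simple_object_in by blast

lemma mult_biproduct:
  assumes b: "biproduct C V J Y i p" and Z: "simple_object C Z"
  shows "mult V Z = (\<Sum>j\<in>J. mult (Y j) Z)"
  by (rule mult_eqI[OF biproductD(1)[OF b] Z biproduct_dim(1)[OF b simple_object_in[OF Z]]])
    (rule Hom_dim[OF biproductD(3)[OF b] Z])

lemma mult_simple:
  "simple_object C V \<Longrightarrow> simple_object C Z \<Longrightarrow> mult V Z = (if isomorphic C V Z then 1 else 0)"
  by (rule mult_eqI[OF _ _ simple_Hom_dim]) (auto simp: simple_object_in)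

lemma multiplicity_in_Irr:
  "c \<in> Irr C \<Longrightarrow> multiplicity_in C V c = mult V (representative c)"
  by (simp add: Irr_representative)

text \<open>
  Regrouping the summands of a decomposition by isomorphism class.
\<close>

lemma sum_decomposition:
  fixes F :: "'o \<Rightarrow> nat"
  assumes dec: "simple_decomposition C V Ys"
    and F: "\<And>Y. simple_object C Y \<Longrightarrow> F Y = F (representative (iso_class C Y))"
  shows "(\<Sum>j<length Ys. F (Ys ! j)) = (\<Sum>c\<in>Irr C. multiplicity_in C V c * F (representative c))"
proof -
  let ?g = "\<lambda>j. iso_class C (Ys ! j)"
  have Ys: "simple_object C (Ys ! j)" if "j < length Ys" for j
    using dec that by (simp add: simple_decomposition_def)
  have "(\<Sum>j<length Ys. F (Ys ! j)) = (\<Sum>c\<in>Irr C. \<Sum>j | j \<in> {..<length Ys} \<and> ?g j = c. F (Ys ! j))"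
    by (rule sum.group[symmetric]) (use Ys finite_Irr iso_class_Irr in auto)
  also have "\<dots> = (\<Sum>c\<in>Irr C. multiplicity_in C V c * F (representative c))"
  proof (rule sum.cong[OF refl])
    fix c assume c: "c \<in> Irr C"
    note rep = Irr_representative[OF c]
    have set: "{j. j \<in> {..<length Ys} \<and> ?g j = c} = {j. j < length Ys \<and> Ys ! j \<in> iso_class C (representative c)}"
    proof -
      have "?g j = c \<longleftrightarrow> Ys ! j \<in> iso_class C (representative c)" if "j < length Ys" for j
        using iso_class_eq_iff[OF simple_object_in[OF Ys[OF that]], of "representative c"] rep isomorphic_sym
        by (auto simp: iso_class_def)
      thus ?thesis by auto
    qed
    have "(\<Sum>j | j \<in> {..<length Ys} \<and> ?g j = c. F (Ys ! j))
        = (\<Sum>j | j \<in> {..<length Ys} \<and> ?g j = c. F (representative c))"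
      using F Ys by (intro sum.cong) auto
    also have "\<dots> = multiplicity_in C V c * F (representative c)"
      unfolding set by (simp add: mult_decomposition[OF dec rep(1)] multiplicity_in_Irr[OF c])
    finally show "(\<Sum>j | j \<in> {..<length Ys} \<and> ?g j = c. F (Ys ! j))
        = multiplicity_in C V c * F (representative c)" .
  qed
  finally show ?thesis .
qed

lemma arr_tensor: "arr f V Y \<Longrightarrow> arr f' V' Y' \<Longrightarrow> arr (f \<otimes>\<^sub>m f') (V \<otimes>\<^sub>o V') (Y \<otimes>\<^sub>o Y')"
  by (auto simp: arr_def intro: TensMor_in Tens_in)

lemma arr_interchange:
  "\<lbrakk>arr f V Y; arr g Y Z; arr f' V' Y'; arr g' Y' Z'\<rbrakk>
    \<Longrightarrow> (g \<bullet> f) \<otimes>\<^sub>m (g' \<bullet> f') = (g \<otimes>\<^sub>m g') \<bullet> (f \<otimes>\<^sub>m f')"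
  using TensMor_Comp[of V Y Z V' Y' Z' f g f' g'] by (simp add: arr_def)

lemma whisker_right: "\<lbrakk>arr f V Y; arr g Y Z; A \<in> Obj C\<rbrakk>
    \<Longrightarrow> (g \<bullet> f) \<otimes>\<^sub>m Id C A = (g \<otimes>\<^sub>m Id C A) \<bullet> (f \<otimes>\<^sub>m Id C A)"
  using arr_interchange[OF _ _ arr_Id arr_Id, of f V Y g Z A] arr_Id_left[OF arr_Id, of A] by simp

lemma whisker_left: "\<lbrakk>arr f V Y; arr g Y Z; A \<in> Obj C\<rbrakk>
    \<Longrightarrow> Id C A \<otimes>\<^sub>m (g \<bullet> f) = (Id C A \<otimes>\<^sub>m g) \<bullet> (Id C A \<otimes>\<^sub>m f)"
  using arr_interchange[OF arr_Id arr_Id, of A f V Y g Z] arr_Id_left[OF arr_Id, of A] by simp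

lemma inverses_tensor:
  assumes "inverses V Y f g" "inverses V' Y' f' g'"
  shows "inverses (V \<otimes>\<^sub>o V') (Y \<otimes>\<^sub>o Y') (f \<otimes>\<^sub>m f') (g \<otimes>\<^sub>m g')"
proof -
  have a: "arr f V Y" "arr g Y V" "arr f' V' Y'" "arr g' Y' V'" using assms by (auto simp: inverses_def)
  have obj: "V \<in> Obj C" "Y \<in> Obj C" "V' \<in> Obj C" "Y' \<in> Obj C"
    using arrD[OF a(1)] arrD[OF a(3)] by auto
  show ?thesis
    using assms arr_interchange[OF a] arr_interchange[OF a(2,1,4,3)] arr_tensor[OF a(1,3)] arr_tensor[OF a(2,4)] obj
    by (simp add: inverses_def TensMor_Id)
qed

lemma isomorphic_tensor: "isomorphic C V Y \<Longrightarrow> isomorphic C V' Y' \<Longrightarrow> isomorphic C (V \<otimes>\<^sub>o V') (Y \<otimes>\<^sub>o Y')"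
  unfolding isomorphic_iff using inverses_tensor by blast

lemma linear_tensor_right:
  "\<lbrakk>V \<in> Obj C; Y \<in> Obj C; A \<in> Obj C\<rbrakk>
    \<Longrightarrow> linear_on (Hom C V Y) (Hom C (V \<otimes>\<^sub>o A) (Y \<otimes>\<^sub>o A)) (\<lambda>f. f \<otimes>\<^sub>m Id C A)"
  by (auto simp: linear_on_def TensMor_in Id_in TensMor_add_left TensMor_smult_left)

lemma linear_tensor_left:
  "\<lbrakk>V \<in> Obj C; Y \<in> Obj C; A \<in> Obj C\<rbrakk>
    \<Longrightarrow> linear_on (Hom C V Y) (Hom C (A \<otimes>\<^sub>o V) (A \<otimes>\<^sub>o Y)) (\<lambda>f. Id C A \<otimes>\<^sub>m f)"
  by (auto simp: linear_on_def TensMor_in Id_in TensMor_add_right TensMor_smult_right)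

lemma linear_Zero:
  assumes obj: "V \<in> Obj C" "Y \<in> Obj C" "V' \<in> Obj C" "Y' \<in> Obj C"
    and L: "linear_on (Hom C V Y) (Hom C V' Y') L"
  shows "L (Zero C V Y) = Zero C V' Y'"
proof -
  have "L (Zero C V Y) \<in> Mor C V' Y'" using L Zero_in[OF obj(1,2)] by (auto simp: linear_on_def)
  moreover have "L (0 \<odot>\<^bsub>Hom C V Y\<^esub> Zero C V Y) = 0 \<odot>\<^bsub>Hom C V' Y'\<^esub> L (Zero C V Y)"
    using L Zero_in[OF obj(1,2)] by (simp add: linear_on_def)
  ultimately show ?thesis using obj by (simp add: smult_Zero smult_zero_scalar)
qed

text \<open>
  A linear functor, with action \<open>T\<close> on objects and \<open>L\<close> on morphisms, preserves biproducts.
\<close>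

lemma biproduct_functor:
  assumes b: "biproduct C V J Y i p"
    and T: "\<And>W. W \<in> Obj C \<Longrightarrow> T W \<in> Obj C"
    and L: "\<And>W W'. W \<in> Obj C \<Longrightarrow> W' \<in> Obj C \<Longrightarrow> linear_on (Hom C W W') (Hom C (T W) (T W')) L"
    and L_Id: "\<And>W. W \<in> Obj C \<Longrightarrow> L (Id C W) = Id C (T W)"
    and L_Comp: "\<And>W W' W'' f g. arr f W W' \<Longrightarrow> arr g W' W'' \<Longrightarrow> L (g \<bullet> f) = L g \<bullet> L f"
  shows "biproduct C (T V) J (\<lambda>j. T (Y j)) (\<lambda>j. L (i j)) (\<lambda>j. L (p j))"
proof -
  note b' = biproductD[OF b]
  have i: "arr (i j) (Y j) V" and p: "arr (p j) V (Y j)" if "j \<in> J" for j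
    using b' that by (auto simp: arr_def)
  have "L f \<in> Mor C (T W) (T W')" if "arr f W W'" for f W W'
    using L[of W W'] that by (auto simp: linear_on_def arr_def)
  moreover have "L (p l) \<bullet> L (i j) = (if j = l then Id C (T (Y j)) else Zero C (T (Y j)) (T (Y l)))"
    if jl: "j \<in> J" "l \<in> J" for j l
    using L_Comp[OF i[OF jl(1)] p[OF jl(2)]] b'(6)[OF jl] b'(3)[OF jl(1)] b'(3)[OF jl(2)] L_Id T
      linear_Zero[OF _ _ _ _ L, of "Y j" "Y l"] by auto
  moreover have "finsum (Hom C (T V) (T V)) (\<lambda>j. L (i j) \<bullet> L (p j)) J = Id C (T V)"
  proof -
    have "finsum (Hom C (T V) (T V)) (\<lambda>j. L (i j) \<bullet> L (p j)) J
        = finsum (Hom C (T V) (T V)) (\<lambda>j. L (i j \<bullet> p j)) J"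
    proof (rule finsum_cong_Mor)
      fix j assume j: "j \<in> J"
      show "L (i j) \<bullet> L (p j) = L (i j \<bullet> p j)" using L_Comp[OF p[OF j] i[OF j]] by simp
      show "L (i j \<bullet> p j) \<in> Mor C (T V) (T V)"
        using L[OF b'(1) b'(1)] arrD[OF arr_Comp[OF p[OF j] i[OF j]]] by (auto simp: linear_on_def)
    qed (use T b' in auto)
    also have "\<dots> = L (finsum (Hom C V V) (\<lambda>j. i j \<bullet> p j) J)"
    proof (rule linear_finsum[OF _ _ _ _ L, symmetric])
      show "i j \<bullet> p j \<in> Mor C V V" if "j \<in> J" for j
        using arrD[OF arr_Comp[OF p[OF that] i[OF that]]] by simp
    qed (use T b' in auto)
    also have "\<dots> = Id C (T V)" using b' L_Id by simp
    finally show ?thesis .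
  qed
  ultimately show ?thesis
    unfolding biproduct_def using b' T i p by simp
qed

lemma biproduct_tensor_right:
  assumes "biproduct C V J Y i p" and A: "A \<in> Obj C"
  shows "biproduct C (V \<otimes>\<^sub>o A) J (\<lambda>j. Y j \<otimes>\<^sub>o A) (\<lambda>j. i j \<otimes>\<^sub>m Id C A) (\<lambda>j. p j \<otimes>\<^sub>m Id C A)"
  by (rule biproduct_functor[OF assms(1), where T = "\<lambda>W. W \<otimes>\<^sub>o A" and L = "\<lambda>f. f \<otimes>\<^sub>m Id C A"])
    (use A in \<open>auto simp: TensMor_Id Tens_in linear_tensor_right whisker_right\<close>)

lemma biproduct_tensor_left:
  assumes "biproduct C V J Y i p" and A: "A \<in> Obj C"
  shows "biproduct C (A \<otimes>\<^sub>o V) J (\<lambda>j. A \<otimes>\<^sub>o Y j) (\<lambda>j. Id C A \<otimes>\<^sub>m i j) (\<lambda>j. Id C A \<otimes>\<^sub>m p j)"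
  by (rule biproduct_functor[OF assms(1), where T = "\<lambda>W. A \<otimes>\<^sub>o W" and L = "\<lambda>f. Id C A \<otimes>\<^sub>m f"])
    (use A in \<open>auto simp: TensMor_Id Tens_in linear_tensor_left whisker_left\<close>)

lemma mult_tensor_right:
  assumes V: "V \<in> Obj C" and A: "A \<in> Obj C" and Z: "simple_object C Z"
  shows "mult (V \<otimes>\<^sub>o A) Z = (\<Sum>c\<in>Irr C. multiplicity_in C V c * mult (representative c \<otimes>\<^sub>o A) Z)"
proof -
  obtain Ys where dec: "simple_decomposition C V Ys" using semisimple[OF V] by blast
  then obtain i p where b: "biproduct C V {..<length Ys} ((!) Ys) i p"
    by (auto simp: simple_decomposition_def direct_sum_biproduct)
  have "mult (V \<otimes>\<^sub>o A) Z = (\<Sum>j<length Ys. mult (Ys ! j \<otimes>\<^sub>o A) Z)"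
    by (rule mult_biproduct[OF biproduct_tensor_right[OF b A] Z])
  also have "\<dots> = (\<Sum>c\<in>Irr C. multiplicity_in C V c * mult (representative c \<otimes>\<^sub>o A) Z)"
  proof (rule sum_decomposition[OF dec])
    fix Y assume "simple_object C Y"
    from isomorphic_tensor[OF isomorphic_representative[OF this] isomorphic_refl[OF A]]
    show "mult (Y \<otimes>\<^sub>o A) Z = mult (representative (iso_class C Y) \<otimes>\<^sub>o A) Z" by (rule mult_isomorphic[OF _ Z])
  qed
  finally show ?thesis .
qed

lemma mult_tensor_left:
  assumes V: "V \<in> Obj C" and A: "A \<in> Obj C" and Z: "simple_object C Z"
  shows "mult (A \<otimes>\<^sub>o V) Z = (\<Sum>c\<in>Irr C. multiplicity_in C V c * mult (A \<otimes>\<^sub>o representative c) Z)"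
proof -
  obtain Ys where dec: "simple_decomposition C V Ys" using semisimple[OF V] by blast
  then obtain i p where b: "biproduct C V {..<length Ys} ((!) Ys) i p"
    by (auto simp: simple_decomposition_def direct_sum_biproduct)
  have "mult (A \<otimes>\<^sub>o V) Z = (\<Sum>j<length Ys. mult (A \<otimes>\<^sub>o Ys ! j) Z)"
    by (rule mult_biproduct[OF biproduct_tensor_left[OF b A] Z])
  also have "\<dots> = (\<Sum>c\<in>Irr C. multiplicity_in C V c * mult (A \<otimes>\<^sub>o representative c) Z)"
  proof (rule sum_decomposition[OF dec])
    fix Y assume "simple_object C Y"
    from isomorphic_tensor[OF isomorphic_refl[OF A] isomorphic_representative[OF this]]
    show "mult (A \<otimes>\<^sub>o Y) Z = mult (A \<otimes>\<^sub>o representative (iso_class C Y)) Z" by (rule mult_isomorphic[OF _ Z])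
  qed
  finally show ?thesis .
qed

end


section \<open>Frobenius reciprocity\<close>

context fusion_category
begin

text \<open>
  Rewrites the two outer factors of a right-nested composite.
\<close>

lemma arr_replace:
  assumes "g \<bullet> f = g' \<bullet> f'" "arr e W V" "arr f V Y" "arr g Y Z" "arr f' V Y'" "arr g' Y' Z"
  shows "g \<bullet> (f \<bullet> e) = g' \<bullet> (f' \<bullet> e)"
  using assms arr_assoc[OF assms(2,3,4)] arr_assoc[OF assms(2,5,6)] by simp

lemma arr_cancel:
  assumes "g \<bullet> f = Id C V" "arr e W V" "arr f V Y" "arr g Y V"
  shows "g \<bullet> (f \<bullet> e) = e"
  using assms arr_assoc[OF assms(2,3,4)] arr_Id_left[OF assms(2)] by simp

lemma Assoc_inverses:
  assumes "V \<in> Obj C" "Y \<in> Obj C" "Z \<in> Obj C"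
  obtains a where "inverses ((V \<otimes>\<^sub>o Y) \<otimes>\<^sub>o Z) (V \<otimes>\<^sub>o (Y \<otimes>\<^sub>o Z)) (Assoc C V Y Z) a"
  using Assoc_iso[OF assms] is_iso_inverses[of "(V \<otimes>\<^sub>o Y) \<otimes>\<^sub>o Z" "V \<otimes>\<^sub>o (Y \<otimes>\<^sub>o Z)"] Tens_in assms by blast

lemma arr_Assoc: "V \<in> Obj C \<Longrightarrow> Y \<in> Obj C \<Longrightarrow> Z \<in> Obj C \<Longrightarrow>
    arr (Assoc C V Y Z) ((V \<otimes>\<^sub>o Y) \<otimes>\<^sub>o Z) (V \<otimes>\<^sub>o (Y \<otimes>\<^sub>o Z))"
  using Assoc_inverses[of V Y Z] by (auto simp: inverses_def)

lemma LUnit_inverses: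
  assumes "V \<in> Obj C"
  obtains l where "inverses (\<one>\<^sub>o \<otimes>\<^sub>o V) V (LUnit C V) l"
  using LUnit_iso[OF assms] is_iso_inverses[of "\<one>\<^sub>o \<otimes>\<^sub>o V" V] Tens_in[OF Unit_in assms] assms by blast

lemma RUnit_inverses:
  assumes "V \<in> Obj C"
  obtains r where "inverses (V \<otimes>\<^sub>o \<one>\<^sub>o) V (RUnit C V) r"
  using RUnit_iso[OF assms] is_iso_inverses[of "V \<otimes>\<^sub>o \<one>\<^sub>o" V] Tens_in[OF assms Unit_in] assms by blast

lemma arr_LUnit: "V \<in> Obj C \<Longrightarrow> arr (LUnit C V) (\<one>\<^sub>o \<otimes>\<^sub>o V) V"
  using LUnit_inverses[of V] by (auto simp: inverses_def)

lemma arr_RUnit: "V \<in> Obj C \<Longrightarrow> arr (RUnit C V) (V \<otimes>\<^sub>o \<one>\<^sub>o) V"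
  using RUnit_inverses[of V] by (auto simp: inverses_def)

lemma Assoc_nat:
  "\<lbrakk>arr f V V'; arr g Y Y'; arr h Z Z'\<rbrakk>
    \<Longrightarrow> Assoc C V' Y' Z' \<bullet> ((f \<otimes>\<^sub>m g) \<otimes>\<^sub>m h) = (f \<otimes>\<^sub>m (g \<otimes>\<^sub>m h)) \<bullet> Assoc C V Y Z"
  using Assoc_natural[of V Y Z V' Y' Z' f g h] by (simp add: arr_def)

text \<open>
  Both sides are the tensor product \<open>f \<otimes> g\<close>.
\<close>

lemma exchange:
  assumes "arr f V V'" "arr g Y Y'"
  shows "(f \<otimes>\<^sub>m Id C Y') \<bullet> (Id C V \<otimes>\<^sub>m g) = (Id C V' \<otimes>\<^sub>m g) \<bullet> (f \<otimes>\<^sub>m Id C Y)"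
proof -
  have obj: "V \<in> Obj C" "V' \<in> Obj C" "Y \<in> Obj C" "Y' \<in> Obj C" using assms by (auto simp: arr_def)
  show ?thesis
    using arr_interchange[OF arr_Id[OF obj(1)] assms(1) assms(2) arr_Id[OF obj(4)]]
      arr_interchange[OF assms(1) arr_Id[OF obj(2)] arr_Id[OF obj(3)] assms(2)]
      arr_Id_left[OF assms(1)] arr_Id_right[OF assms(1)] arr_Id_left[OF assms(2)] arr_Id_right[OF assms(2)]
    by simp
qed

context
  fixes A D ev coev a
  assumes A: "A \<in> Obj C" and D: "D \<in> Obj C"
    and ev: "arr ev (D \<otimes>\<^sub>o A) \<one>\<^sub>o" and coev: "arr coev \<one>\<^sub>o (A \<otimes>\<^sub>o D)"
    and a: "inverses ((D \<otimes>\<^sub>o A) \<otimes>\<^sub>o D) (D \<otimes>\<^sub>o (A \<otimes>\<^sub>o D)) (Assoc C D A D) a"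
    and zigzag1: "RUnit C A \<bullet> ((Id C A \<otimes>\<^sub>m ev) \<bullet> (Assoc C A D A \<bullet> (coev \<otimes>\<^sub>m Id C A))) = LUnit C A"
    and zigzag2: "LUnit C D \<bullet> ((ev \<otimes>\<^sub>m Id C D) \<bullet> (a \<bullet> (Id C D \<otimes>\<^sub>m coev))) = RUnit C D"
begin

lemmas arr_rules = arr_Comp arr_tensor arr_Id arr_Assoc arr_LUnit arr_RUnit ev coev A D Tens_in Unit_in

text \<open>
  Let \<open>D\<close> be dual to \<open>A\<close>. Transposing a morphism \<open>h\<close> from \<open>Z\<close> to \<open>A \<otimes> Y\<close> by means of the evaluation and then
  transposing back by means of the coevaluation multiplies \<open>1 \<otimes> h\<close> by a morphism \<open>K\<close> that does not depend on
  \<open>h\<close>. By the pentagon, naturality, the triangle and the first zig-zag identity, \<open>K\<close> composed with an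
  associativity isomorphism is the unit isomorphism of \<open>A\<close> tensored with \<open>Y\<close>. So \<open>K\<close> is invertible, and
  \<open>h\<close> can be recovered.
\<close>

lemma transpose_injective:
  assumes Y: "Y \<in> Obj C" and Z: "Z \<in> Obj C"
    and b: "inverses ((D \<otimes>\<^sub>o A) \<otimes>\<^sub>o Y) (D \<otimes>\<^sub>o (A \<otimes>\<^sub>o Y)) (Assoc C D A Y) b"
    and f: "arr f Z (A \<otimes>\<^sub>o Y)" and g: "arr g Z (A \<otimes>\<^sub>o Y)"
    and eq: "LUnit C Y \<bullet> ((ev \<otimes>\<^sub>m Id C Y) \<bullet> (b \<bullet> (Id C D \<otimes>\<^sub>m f)))
      = LUnit C Y \<bullet> ((ev \<otimes>\<^sub>m Id C Y) \<bullet> (b \<bullet> (Id C D \<otimes>\<^sub>m g)))"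
  shows "f = g"
proof -
  note [intro] = arr_rules Y Z
  let ?u1 = "Id C A \<otimes>\<^sub>m LUnit C Y" and ?u2 = "Id C A \<otimes>\<^sub>m (ev \<otimes>\<^sub>m Id C Y)" and ?u3 = "Id C A \<otimes>\<^sub>m b"
  let ?AY = "A \<otimes>\<^sub>o Y"
  let ?a4 = "Assoc C A D ?AY" and ?c = "coev \<otimes>\<^sub>m Id C ?AY"
  have arr_b: "arr b (D \<otimes>\<^sub>o ?AY) ((D \<otimes>\<^sub>o A) \<otimes>\<^sub>o Y)" using b by (simp add: inverses_def)
  have arr_evY: "arr (ev \<otimes>\<^sub>m Id C Y) ((D \<otimes>\<^sub>o A) \<otimes>\<^sub>o Y) (\<one>\<^sub>o \<otimes>\<^sub>o Y)" by blast
  have u1: "arr ?u1 (A \<otimes>\<^sub>o (\<one>\<^sub>o \<otimes>\<^sub>o Y)) ?AY" by blast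
  have u2: "arr ?u2 (A \<otimes>\<^sub>o ((D \<otimes>\<^sub>o A) \<otimes>\<^sub>o Y)) (A \<otimes>\<^sub>o (\<one>\<^sub>o \<otimes>\<^sub>o Y))" by blast
  have u3: "arr ?u3 (A \<otimes>\<^sub>o (D \<otimes>\<^sub>o ?AY)) (A \<otimes>\<^sub>o ((D \<otimes>\<^sub>o A) \<otimes>\<^sub>o Y))" using arr_b by blast
  have a4: "arr ?a4 ((A \<otimes>\<^sub>o D) \<otimes>\<^sub>o ?AY) (A \<otimes>\<^sub>o (D \<otimes>\<^sub>o ?AY))" by blast
  have c: "arr ?c (\<one>\<^sub>o \<otimes>\<^sub>o ?AY) ((A \<otimes>\<^sub>o D) \<otimes>\<^sub>o ?AY)" by blast
  let ?K = "?u1 \<bullet> (?u2 \<bullet> (?u3 \<bullet> (?a4 \<bullet> ?c)))"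
  have K: "arr ?K (\<one>\<^sub>o \<otimes>\<^sub>o ?AY) ?AY"
    using arr_Comp[OF arr_Comp[OF arr_Comp[OF arr_Comp[OF c a4] u3] u2] u1] .
  have recover: "(Id C A \<otimes>\<^sub>m (LUnit C Y \<bullet> ((ev \<otimes>\<^sub>m Id C Y) \<bullet> (b \<bullet> (Id C D \<otimes>\<^sub>m h)))))
      \<bullet> (Assoc C A D Z \<bullet> (coev \<otimes>\<^sub>m Id C Z)) = ?K \<bullet> (Id C \<one>\<^sub>o \<otimes>\<^sub>m h)"
    if h: "arr h Z ?AY" for h
  proof -
    let ?Dh = "Id C D \<otimes>\<^sub>m h"
    let ?z = "Assoc C A D Z \<bullet> (coev \<otimes>\<^sub>m Id C Z)"
    have Dh: "arr ?Dh (D \<otimes>\<^sub>o Z) (D \<otimes>\<^sub>o ?AY)" using h by blast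
    have u4: "arr (Id C A \<otimes>\<^sub>m ?Dh) (A \<otimes>\<^sub>o (D \<otimes>\<^sub>o Z)) (A \<otimes>\<^sub>o (D \<otimes>\<^sub>o ?AY))" using Dh by blast
    have aZ: "arr (Assoc C A D Z) ((A \<otimes>\<^sub>o D) \<otimes>\<^sub>o Z) (A \<otimes>\<^sub>o (D \<otimes>\<^sub>o Z))" by blast
    have cZ: "arr (coev \<otimes>\<^sub>m Id C Z) (\<one>\<^sub>o \<otimes>\<^sub>o Z) ((A \<otimes>\<^sub>o D) \<otimes>\<^sub>o Z)" by blast
    have z: "arr ?z (\<one>\<^sub>o \<otimes>\<^sub>o Z) (A \<otimes>\<^sub>o (D \<otimes>\<^sub>o Z))" by (rule arr_Comp[OF cZ aZ])
    have w: "arr (Id C (A \<otimes>\<^sub>o D) \<otimes>\<^sub>m h) ((A \<otimes>\<^sub>o D) \<otimes>\<^sub>o Z) ((A \<otimes>\<^sub>o D) \<otimes>\<^sub>o ?AY)" using h by blast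
    have h1: "arr (Id C \<one>\<^sub>o \<otimes>\<^sub>m h) (\<one>\<^sub>o \<otimes>\<^sub>o Z) (\<one>\<^sub>o \<otimes>\<^sub>o ?AY)" using h by blast
    have "Id C A \<otimes>\<^sub>m (LUnit C Y \<bullet> ((ev \<otimes>\<^sub>m Id C Y) \<bullet> (b \<bullet> ?Dh)))
        = ?u1 \<bullet> (?u2 \<bullet> (?u3 \<bullet> (Id C A \<otimes>\<^sub>m ?Dh)))"
      using whisker_left[OF Dh arr_b A] whisker_left[OF arr_Comp[OF Dh arr_b] arr_evY A]
        whisker_left[OF arr_Comp[OF arr_Comp[OF Dh arr_b] arr_evY] arr_LUnit[OF Y] A] by simp
    hence "(Id C A \<otimes>\<^sub>m (LUnit C Y \<bullet> ((ev \<otimes>\<^sub>m Id C Y) \<bullet> (b \<bullet> ?Dh)))) \<bullet> ?z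
        = ?u1 \<bullet> (?u2 \<bullet> (?u3 \<bullet> ((Id C A \<otimes>\<^sub>m ?Dh) \<bullet> ?z)))"
      using arr_assoc[OF z arr_Comp[OF arr_Comp[OF u4 u3] u2] u1]
        arr_assoc[OF z arr_Comp[OF u4 u3] u2] arr_assoc[OF z u4 u3] by simp
    also have "(Id C A \<otimes>\<^sub>m ?Dh) \<bullet> ?z = ?a4 \<bullet> ((Id C (A \<otimes>\<^sub>o D) \<otimes>\<^sub>m h) \<bullet> (coev \<otimes>\<^sub>m Id C Z))"
      by (rule arr_replace[OF _ cZ aZ u4 w a4])
        (use Assoc_nat[OF arr_Id[OF A] arr_Id[OF D] h] A D in \<open>simp add: TensMor_Id\<close>)
    also have "(Id C (A \<otimes>\<^sub>o D) \<otimes>\<^sub>m h) \<bullet> (coev \<otimes>\<^sub>m Id C Z) = ?c \<bullet> (Id C \<one>\<^sub>o \<otimes>\<^sub>m h)"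
      using exchange[OF coev h] by simp
    finally show ?thesis
      using arr_assoc[OF h1 arr_Comp[OF arr_Comp[OF arr_Comp[OF c a4] u3] u2] u1]
        arr_assoc[OF h1 arr_Comp[OF arr_Comp[OF c a4] u3] u2]
        arr_assoc[OF h1 arr_Comp[OF c a4] u3] arr_assoc[OF h1 c a4] by simp
  qed
  obtain k where k: "inverses ((\<one>\<^sub>o \<otimes>\<^sub>o A) \<otimes>\<^sub>o Y) (\<one>\<^sub>o \<otimes>\<^sub>o ?AY) (Assoc C \<one>\<^sub>o A Y) k"
    using Assoc_inverses[OF Unit_in A Y] .
  have arr_k: "arr k (\<one>\<^sub>o \<otimes>\<^sub>o ?AY) ((\<one>\<^sub>o \<otimes>\<^sub>o A) \<otimes>\<^sub>o Y)" using k by (simp add: inverses_def)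
  have K_Assoc: "?K \<bullet> Assoc C \<one>\<^sub>o A Y = LUnit C A \<otimes>\<^sub>m Id C Y"
  proof -
    let ?m = "Assoc C \<one>\<^sub>o A Y"
    let ?p = "(coev \<otimes>\<^sub>m Id C A) \<otimes>\<^sub>m Id C Y"
    let ?q = "Assoc C A D A \<otimes>\<^sub>m Id C Y"
    have m: "arr ?m ((\<one>\<^sub>o \<otimes>\<^sub>o A) \<otimes>\<^sub>o Y) (\<one>\<^sub>o \<otimes>\<^sub>o ?AY)" by blast
    have cA: "arr (coev \<otimes>\<^sub>m Id C A) (\<one>\<^sub>o \<otimes>\<^sub>o A) ((A \<otimes>\<^sub>o D) \<otimes>\<^sub>o A)" by blast
    have p: "arr ?p ((\<one>\<^sub>o \<otimes>\<^sub>o A) \<otimes>\<^sub>o Y) (((A \<otimes>\<^sub>o D) \<otimes>\<^sub>o A) \<otimes>\<^sub>o Y)" by blast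
    have q: "arr ?q (((A \<otimes>\<^sub>o D) \<otimes>\<^sub>o A) \<otimes>\<^sub>o Y) ((A \<otimes>\<^sub>o (D \<otimes>\<^sub>o A)) \<otimes>\<^sub>o Y)" by blast
    have n: "arr (Assoc C (A \<otimes>\<^sub>o D) A Y) (((A \<otimes>\<^sub>o D) \<otimes>\<^sub>o A) \<otimes>\<^sub>o Y) ((A \<otimes>\<^sub>o D) \<otimes>\<^sub>o ?AY)" by blast
    have s: "arr (Assoc C A (D \<otimes>\<^sub>o A) Y) ((A \<otimes>\<^sub>o (D \<otimes>\<^sub>o A)) \<otimes>\<^sub>o Y) (A \<otimes>\<^sub>o ((D \<otimes>\<^sub>o A) \<otimes>\<^sub>o Y))" by blast
    have t: "arr (Id C A \<otimes>\<^sub>m Assoc C D A Y) (A \<otimes>\<^sub>o ((D \<otimes>\<^sub>o A) \<otimes>\<^sub>o Y)) (A \<otimes>\<^sub>o (D \<otimes>\<^sub>o ?AY))" by blast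
    have v: "arr ((Id C A \<otimes>\<^sub>m ev) \<otimes>\<^sub>m Id C Y) ((A \<otimes>\<^sub>o (D \<otimes>\<^sub>o A)) \<otimes>\<^sub>o Y) ((A \<otimes>\<^sub>o \<one>\<^sub>o) \<otimes>\<^sub>o Y)" by blast
    have r: "arr (Assoc C A \<one>\<^sub>o Y) ((A \<otimes>\<^sub>o \<one>\<^sub>o) \<otimes>\<^sub>o Y) (A \<otimes>\<^sub>o (\<one>\<^sub>o \<otimes>\<^sub>o Y))" by blast
    have Aev: "arr (Id C A \<otimes>\<^sub>m ev) (A \<otimes>\<^sub>o (D \<otimes>\<^sub>o A)) (A \<otimes>\<^sub>o \<one>\<^sub>o)" by blast
    have qp: "arr (?q \<bullet> ?p) ((\<one>\<^sub>o \<otimes>\<^sub>o A) \<otimes>\<^sub>o Y) ((A \<otimes>\<^sub>o (D \<otimes>\<^sub>o A)) \<otimes>\<^sub>o Y)" by (rule arr_Comp[OF p q])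
    have sqp: "arr (Assoc C A (D \<otimes>\<^sub>o A) Y \<bullet> (?q \<bullet> ?p)) ((\<one>\<^sub>o \<otimes>\<^sub>o A) \<otimes>\<^sub>o Y) (A \<otimes>\<^sub>o ((D \<otimes>\<^sub>o A) \<otimes>\<^sub>o Y))"
      by (rule arr_Comp[OF qp s])
    have vqp: "arr (((Id C A \<otimes>\<^sub>m ev) \<otimes>\<^sub>m Id C Y) \<bullet> (?q \<bullet> ?p)) ((\<one>\<^sub>o \<otimes>\<^sub>o A) \<otimes>\<^sub>o Y) ((A \<otimes>\<^sub>o \<one>\<^sub>o) \<otimes>\<^sub>o Y)"
      by (rule arr_Comp[OF qp v])
    have "?K \<bullet> ?m = ?u1 \<bullet> (?u2 \<bullet> (?u3 \<bullet> (?a4 \<bullet> (?c \<bullet> ?m))))"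
      using arr_assoc[OF m arr_Comp[OF arr_Comp[OF arr_Comp[OF c a4] u3] u2] u1]
        arr_assoc[OF m arr_Comp[OF arr_Comp[OF c a4] u3] u2]
        arr_assoc[OF m arr_Comp[OF c a4] u3] arr_assoc[OF m c a4] by simp
    also have "?c \<bullet> ?m = Assoc C (A \<otimes>\<^sub>o D) A Y \<bullet> ?p"
      using Assoc_nat[OF coev arr_Id[OF A] arr_Id[OF Y]] A Y by (simp add: TensMor_Id)
    also have "?a4 \<bullet> (Assoc C (A \<otimes>\<^sub>o D) A Y \<bullet> ?p) = (?a4 \<bullet> Assoc C (A \<otimes>\<^sub>o D) A Y) \<bullet> ?p"
      using arr_assoc[OF p n a4] by simp
    also have "?a4 \<bullet> Assoc C (A \<otimes>\<^sub>o D) A Y = (Id C A \<otimes>\<^sub>m Assoc C D A Y) \<bullet> Assoc C A (D \<otimes>\<^sub>o A) Y \<bullet> ?q"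
      by (rule pentagon[OF A D A Y])
    also have "\<dots> \<bullet> ?p = (Id C A \<otimes>\<^sub>m Assoc C D A Y) \<bullet> (Assoc C A (D \<otimes>\<^sub>o A) Y \<bullet> (?q \<bullet> ?p))"
      using arr_assoc[OF p arr_Comp[OF q s] t] arr_assoc[OF p q s] by simp
    also have "?u3 \<bullet> \<dots> = Assoc C A (D \<otimes>\<^sub>o A) Y \<bullet> (?q \<bullet> ?p)"
    proof (rule arr_cancel[OF _ sqp t u3])
      have "arr (Assoc C D A Y) ((D \<otimes>\<^sub>o A) \<otimes>\<^sub>o Y) (D \<otimes>\<^sub>o (A \<otimes>\<^sub>o Y))" by blast
      from whisker_left[OF this arr_b A]
      show "?u3 \<bullet> (Id C A \<otimes>\<^sub>m Assoc C D A Y) = Id C (A \<otimes>\<^sub>o ((D \<otimes>\<^sub>o A) \<otimes>\<^sub>o Y))"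
        using b A D Y by (simp add: inverses_def TensMor_Id Tens_in)
    qed
    also have "?u2 \<bullet> (Assoc C A (D \<otimes>\<^sub>o A) Y \<bullet> (?q \<bullet> ?p))
        = Assoc C A \<one>\<^sub>o Y \<bullet> (((Id C A \<otimes>\<^sub>m ev) \<otimes>\<^sub>m Id C Y) \<bullet> (?q \<bullet> ?p))"
      by (rule arr_replace[OF _ qp s u2 v r]) (use Assoc_nat[OF arr_Id[OF A] ev arr_Id[OF Y]] in simp)
    also have "?u1 \<bullet> \<dots> = (RUnit C A \<otimes>\<^sub>m Id C Y) \<bullet> (((Id C A \<otimes>\<^sub>m ev) \<otimes>\<^sub>m Id C Y) \<bullet> (?q \<bullet> ?p))"
      using arr_assoc[OF vqp r u1] triangle[OF A Y] by simp
    also have "\<dots> = (RUnit C A \<bullet> ((Id C A \<otimes>\<^sub>m ev) \<bullet> (Assoc C A D A \<bullet> (coev \<otimes>\<^sub>m Id C A)))) \<otimes>\<^sub>m Id C Y"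
    proof -
      have aA: "arr (Assoc C A D A) ((A \<otimes>\<^sub>o D) \<otimes>\<^sub>o A) (A \<otimes>\<^sub>o (D \<otimes>\<^sub>o A))" by blast
      show ?thesis
        using whisker_right[OF cA aA Y] whisker_right[OF arr_Comp[OF cA aA] Aev Y]
          whisker_right[OF arr_Comp[OF arr_Comp[OF cA aA] Aev] arr_RUnit[OF A] Y] by simp
    qed
    also have "\<dots> = LUnit C A \<otimes>\<^sub>m Id C Y" unfolding zigzag1 ..
    finally show ?thesis .
  qed
  obtain l where l: "inverses (\<one>\<^sub>o \<otimes>\<^sub>o A) A (LUnit C A) l" using LUnit_inverses[OF A] .
  define K' where "K' = Assoc C \<one>\<^sub>o A Y \<bullet> (l \<otimes>\<^sub>m Id C Y)"
  have lY: "arr (l \<otimes>\<^sub>m Id C Y) ?AY ((\<one>\<^sub>o \<otimes>\<^sub>o A) \<otimes>\<^sub>o Y)" using l by (auto simp: inverses_def)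
  have m: "arr (Assoc C \<one>\<^sub>o A Y) ((\<one>\<^sub>o \<otimes>\<^sub>o A) \<otimes>\<^sub>o Y) (\<one>\<^sub>o \<otimes>\<^sub>o ?AY)" by blast
  have K': "arr K' ?AY (\<one>\<^sub>o \<otimes>\<^sub>o ?AY)" unfolding K'_def by (rule arr_Comp[OF lY m])
  have K_eq: "?K = (LUnit C A \<otimes>\<^sub>m Id C Y) \<bullet> k"
  proof -
    have "Assoc C \<one>\<^sub>o A Y \<bullet> k = Id C (\<one>\<^sub>o \<otimes>\<^sub>o ?AY)" using k by (simp add: inverses_def)
    thus ?thesis using arr_assoc[OF arr_k m K] arr_Id_right[OF K] K_Assoc by simp
  qed
  have left_inverse: "K' \<bullet> ?K = Id C (\<one>\<^sub>o \<otimes>\<^sub>o ?AY)"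
  proof -
    have lu: "inverses ((\<one>\<^sub>o \<otimes>\<^sub>o A) \<otimes>\<^sub>o Y) ?AY (LUnit C A \<otimes>\<^sub>m Id C Y) (l \<otimes>\<^sub>m Id C Y)"
      by (rule inverses_tensor[OF l]) (use Y arr_Id arr_Id_left in \<open>auto simp: inverses_def\<close>)
    from inverses_comp[OF inverses_sym[OF k] this] show ?thesis
      unfolding K_eq K'_def by (simp add: inverses_def)
  qed
  have unit: "Id C \<one>\<^sub>o \<otimes>\<^sub>m f = Id C \<one>\<^sub>o \<otimes>\<^sub>m g"
  proof -
    have f1: "arr (Id C \<one>\<^sub>o \<otimes>\<^sub>m f) (\<one>\<^sub>o \<otimes>\<^sub>o Z) (\<one>\<^sub>o \<otimes>\<^sub>o ?AY)"
      and g1: "arr (Id C \<one>\<^sub>o \<otimes>\<^sub>m g) (\<one>\<^sub>o \<otimes>\<^sub>o Z) (\<one>\<^sub>o \<otimes>\<^sub>o ?AY)" using f g by blast+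
    have "?K \<bullet> (Id C \<one>\<^sub>o \<otimes>\<^sub>m f) = ?K \<bullet> (Id C \<one>\<^sub>o \<otimes>\<^sub>m g)"
      unfolding recover[OF f, symmetric] recover[OF g, symmetric] eq ..
    hence "K' \<bullet> (?K \<bullet> (Id C \<one>\<^sub>o \<otimes>\<^sub>m f)) = K' \<bullet> (?K \<bullet> (Id C \<one>\<^sub>o \<otimes>\<^sub>m g))" by (rule arg_cong)
    thus ?thesis
      unfolding arr_cancel[OF left_inverse f1 K K'] arr_cancel[OF left_inverse g1 K K'] .
  qed
  obtain j where j: "inverses (\<one>\<^sub>o \<otimes>\<^sub>o Z) Z (LUnit C Z) j" using LUnit_inverses[OF Z] .
  have "h = (LUnit C ?AY \<bullet> (Id C \<one>\<^sub>o \<otimes>\<^sub>m h)) \<bullet> j" if h: "arr h Z ?AY" for h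
  proof -
    have arr_j: "arr j Z (\<one>\<^sub>o \<otimes>\<^sub>o Z)" and lj: "LUnit C Z \<bullet> j = Id C Z" using j by (auto simp: inverses_def)
    have "(LUnit C ?AY \<bullet> (Id C \<one>\<^sub>o \<otimes>\<^sub>m h)) \<bullet> j = (h \<bullet> LUnit C Z) \<bullet> j"
      using LUnit_natural[of Z ?AY h] h by (simp add: arr_def)
    also have "\<dots> = h" using arr_assoc[OF arr_j arr_LUnit[OF Z] h] lj arr_Id_right[OF h] by simp
    finally show ?thesis ..
  qed
  from this[OF f] this[OF g] unit show "f = g" by metis
qed

text \<open>
  The same idea in the other direction: the two transpositions in the opposite order multiply a morphism
  on the right by a fixed \<open>K\<close>, which the pentagon and the second zig-zag identity reduce to a composite of
  isomorphisms.
\<close>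

lemma detranspose_injective:
  assumes Y: "Y \<in> Obj C" and Z: "Z \<in> Obj C"
    and f: "arr f (D \<otimes>\<^sub>o Z) Y" and g: "arr g (D \<otimes>\<^sub>o Z) Y"
    and eq: "(Id C A \<otimes>\<^sub>m f) \<bullet> (Assoc C A D Z \<bullet> (coev \<otimes>\<^sub>m Id C Z))
      = (Id C A \<otimes>\<^sub>m g) \<bullet> (Assoc C A D Z \<bullet> (coev \<otimes>\<^sub>m Id C Z))"
  shows "f = g"
proof -
  note [intro] = arr_rules Y Z
  let ?DZ = "D \<otimes>\<^sub>o Z"
  have DZ: "?DZ \<in> Obj C" by blast
  let ?m = "Assoc C A D Z" and ?c = "coev \<otimes>\<^sub>m Id C Z"
  have m: "arr ?m ((A \<otimes>\<^sub>o D) \<otimes>\<^sub>o Z) (A \<otimes>\<^sub>o ?DZ)" by blast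
  have c: "arr ?c (\<one>\<^sub>o \<otimes>\<^sub>o Z) ((A \<otimes>\<^sub>o D) \<otimes>\<^sub>o Z)" by blast
  obtain b where b: "inverses ((D \<otimes>\<^sub>o A) \<otimes>\<^sub>o ?DZ) (D \<otimes>\<^sub>o (A \<otimes>\<^sub>o ?DZ)) (Assoc C D A ?DZ) b"
    using Assoc_inverses[OF D A DZ] .
  have arr_b: "arr b (D \<otimes>\<^sub>o (A \<otimes>\<^sub>o ?DZ)) ((D \<otimes>\<^sub>o A) \<otimes>\<^sub>o ?DZ)" using b by (simp add: inverses_def)
  obtain b' where b': "inverses ((D \<otimes>\<^sub>o A) \<otimes>\<^sub>o Y) (D \<otimes>\<^sub>o (A \<otimes>\<^sub>o Y)) (Assoc C D A Y) b'"
    using Assoc_inverses[OF D A Y] .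
  have arr_b': "arr b' (D \<otimes>\<^sub>o (A \<otimes>\<^sub>o Y)) ((D \<otimes>\<^sub>o A) \<otimes>\<^sub>o Y)" using b' by (simp add: inverses_def)
  let ?l = "LUnit C ?DZ" and ?e = "ev \<otimes>\<^sub>m Id C ?DZ"
  let ?t1 = "Id C D \<otimes>\<^sub>m ?m" and ?t2 = "Id C D \<otimes>\<^sub>m ?c"
  have l: "arr ?l (\<one>\<^sub>o \<otimes>\<^sub>o ?DZ) ?DZ" by blast
  have e: "arr ?e ((D \<otimes>\<^sub>o A) \<otimes>\<^sub>o ?DZ) (\<one>\<^sub>o \<otimes>\<^sub>o ?DZ)" by blast
  have t1: "arr ?t1 (D \<otimes>\<^sub>o ((A \<otimes>\<^sub>o D) \<otimes>\<^sub>o Z)) (D \<otimes>\<^sub>o (A \<otimes>\<^sub>o ?DZ))" by blast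
  have t2: "arr ?t2 (D \<otimes>\<^sub>o (\<one>\<^sub>o \<otimes>\<^sub>o Z)) (D \<otimes>\<^sub>o ((A \<otimes>\<^sub>o D) \<otimes>\<^sub>o Z))" by blast
  have t12: "arr (?t1 \<bullet> ?t2) (D \<otimes>\<^sub>o (\<one>\<^sub>o \<otimes>\<^sub>o Z)) (D \<otimes>\<^sub>o (A \<otimes>\<^sub>o ?DZ))" by (rule arr_Comp[OF t2 t1])
  have bt: "arr (b \<bullet> (?t1 \<bullet> ?t2)) (D \<otimes>\<^sub>o (\<one>\<^sub>o \<otimes>\<^sub>o Z)) ((D \<otimes>\<^sub>o A) \<otimes>\<^sub>o ?DZ)" by (rule arr_Comp[OF t12 arr_b])
  have ebt: "arr (?e \<bullet> (b \<bullet> (?t1 \<bullet> ?t2))) (D \<otimes>\<^sub>o (\<one>\<^sub>o \<otimes>\<^sub>o Z)) (\<one>\<^sub>o \<otimes>\<^sub>o ?DZ)" by (rule arr_Comp[OF bt e])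
  let ?K = "?l \<bullet> (?e \<bullet> (b \<bullet> (?t1 \<bullet> ?t2)))"
  have K: "arr ?K (D \<otimes>\<^sub>o (\<one>\<^sub>o \<otimes>\<^sub>o Z)) ?DZ" by (rule arr_Comp[OF ebt l])
  have recover: "LUnit C Y \<bullet> ((ev \<otimes>\<^sub>m Id C Y) \<bullet> (b' \<bullet> (Id C D \<otimes>\<^sub>m ((Id C A \<otimes>\<^sub>m h) \<bullet> (?m \<bullet> ?c))))) = h \<bullet> ?K"
    if h: "arr h ?DZ Y" for h
  proof -
    let ?Ah = "Id C A \<otimes>\<^sub>m h"
    have Ah: "arr ?Ah (A \<otimes>\<^sub>o ?DZ) (A \<otimes>\<^sub>o Y)" using h by blast
    have DAh: "arr (Id C D \<otimes>\<^sub>m ?Ah) (D \<otimes>\<^sub>o (A \<otimes>\<^sub>o ?DZ)) (D \<otimes>\<^sub>o (A \<otimes>\<^sub>o Y))" using Ah by blast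
    have w: "arr (Id C (D \<otimes>\<^sub>o A) \<otimes>\<^sub>m h) ((D \<otimes>\<^sub>o A) \<otimes>\<^sub>o ?DZ) ((D \<otimes>\<^sub>o A) \<otimes>\<^sub>o Y)" using h by blast
    have h1: "arr (Id C \<one>\<^sub>o \<otimes>\<^sub>m h) (\<one>\<^sub>o \<otimes>\<^sub>o ?DZ) (\<one>\<^sub>o \<otimes>\<^sub>o Y)" using h by blast
    have eY: "arr (ev \<otimes>\<^sub>m Id C Y) ((D \<otimes>\<^sub>o A) \<otimes>\<^sub>o Y) (\<one>\<^sub>o \<otimes>\<^sub>o Y)" by blast
    have aY: "arr (Assoc C D A Y) ((D \<otimes>\<^sub>o A) \<otimes>\<^sub>o Y) (D \<otimes>\<^sub>o (A \<otimes>\<^sub>o Y))" by blast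
    have aDZ: "arr (Assoc C D A ?DZ) ((D \<otimes>\<^sub>o A) \<otimes>\<^sub>o ?DZ) (D \<otimes>\<^sub>o (A \<otimes>\<^sub>o ?DZ))" by blast
    have "Id C D \<otimes>\<^sub>m (?Ah \<bullet> (?m \<bullet> ?c)) = (Id C D \<otimes>\<^sub>m ?Ah) \<bullet> (?t1 \<bullet> ?t2)"
      using whisker_left[OF arr_Comp[OF c m] Ah D] whisker_left[OF c m D] by simp
    moreover have "b' \<bullet> ((Id C D \<otimes>\<^sub>m ?Ah) \<bullet> (?t1 \<bullet> ?t2)) = (Id C (D \<otimes>\<^sub>o A) \<otimes>\<^sub>m h) \<bullet> (b \<bullet> (?t1 \<bullet> ?t2))"
    proof (rule arr_replace[OF _ t12 DAh arr_b' arr_b w])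
      have nat: "Assoc C D A Y \<bullet> (Id C (D \<otimes>\<^sub>o A) \<otimes>\<^sub>m h) = (Id C D \<otimes>\<^sub>m ?Ah) \<bullet> Assoc C D A ?DZ"
        using Assoc_nat[OF arr_Id[OF D] arr_Id[OF A] h] A D by (simp add: TensMor_Id)
      have "b' \<bullet> (Id C D \<otimes>\<^sub>m ?Ah) = b' \<bullet> ((Id C D \<otimes>\<^sub>m ?Ah) \<bullet> (Assoc C D A ?DZ \<bullet> b))"
        using b arr_Id_right[OF DAh] by (simp add: inverses_def)
      also have "\<dots> = b' \<bullet> (((Id C D \<otimes>\<^sub>m ?Ah) \<bullet> Assoc C D A ?DZ) \<bullet> b)"
        using arr_assoc[OF arr_b aDZ DAh] by simp
      also have "\<dots> = b' \<bullet> (Assoc C D A Y \<bullet> ((Id C (D \<otimes>\<^sub>o A) \<otimes>\<^sub>m h) \<bullet> b))"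
        unfolding nat[symmetric] using arr_assoc[OF arr_b w aY] by simp
      also have "\<dots> = (Id C (D \<otimes>\<^sub>o A) \<otimes>\<^sub>m h) \<bullet> b"
        by (rule arr_cancel[OF _ arr_Comp[OF arr_b w] aY arr_b']) (use b' in \<open>simp add: inverses_def\<close>)
      finally show "b' \<bullet> (Id C D \<otimes>\<^sub>m ?Ah) = (Id C (D \<otimes>\<^sub>o A) \<otimes>\<^sub>m h) \<bullet> b" .
    qed
    moreover have "(ev \<otimes>\<^sub>m Id C Y) \<bullet> ((Id C (D \<otimes>\<^sub>o A) \<otimes>\<^sub>m h) \<bullet> (b \<bullet> (?t1 \<bullet> ?t2)))
        = (Id C \<one>\<^sub>o \<otimes>\<^sub>m h) \<bullet> (?e \<bullet> (b \<bullet> (?t1 \<bullet> ?t2)))"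
      by (rule arr_replace[OF exchange[OF ev h] bt w eY e h1])
    moreover have "LUnit C Y \<bullet> ((Id C \<one>\<^sub>o \<otimes>\<^sub>m h) \<bullet> (?e \<bullet> (b \<bullet> (?t1 \<bullet> ?t2)))) = h \<bullet> ?K"
      by (rule arr_replace[OF _ ebt h1 arr_LUnit[OF Y] l h])
        (use LUnit_natural[of ?DZ Y h] h in \<open>simp add: arr_def\<close>)
    ultimately show ?thesis by simp
  qed
  let ?n = "Assoc C D \<one>\<^sub>o Z"
  have n: "arr ?n ((D \<otimes>\<^sub>o \<one>\<^sub>o) \<otimes>\<^sub>o Z) (D \<otimes>\<^sub>o (\<one>\<^sub>o \<otimes>\<^sub>o Z))" by blast
  have arr_a: "arr a (D \<otimes>\<^sub>o (A \<otimes>\<^sub>o D)) ((D \<otimes>\<^sub>o A) \<otimes>\<^sub>o D)" using a by (simp add: inverses_def)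
  let ?d = "Id C D \<otimes>\<^sub>m coev" and ?eD = "ev \<otimes>\<^sub>m Id C D"
  have d: "arr ?d (D \<otimes>\<^sub>o \<one>\<^sub>o) (D \<otimes>\<^sub>o (A \<otimes>\<^sub>o D))" by blast
  have eD: "arr ?eD ((D \<otimes>\<^sub>o A) \<otimes>\<^sub>o D) (\<one>\<^sub>o \<otimes>\<^sub>o D)" by blast
  define q where "q = ?eD \<bullet> (a \<bullet> ?d)"
  have ad: "arr (a \<bullet> ?d) (D \<otimes>\<^sub>o \<one>\<^sub>o) ((D \<otimes>\<^sub>o A) \<otimes>\<^sub>o D)" by (rule arr_Comp[OF d arr_a])
  have q: "arr q (D \<otimes>\<^sub>o \<one>\<^sub>o) (\<one>\<^sub>o \<otimes>\<^sub>o D)" unfolding q_def by (rule arr_Comp[OF ad eD])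
  have K_Assoc: "?K \<bullet> ?n = ?l \<bullet> (Assoc C \<one>\<^sub>o D Z \<bullet> (q \<otimes>\<^sub>m Id C Z))"
  proof -
    let ?s = "Assoc C D (A \<otimes>\<^sub>o D) Z" and ?dZ = "?d \<otimes>\<^sub>m Id C Z" and ?aZ = "a \<otimes>\<^sub>m Id C Z"
    let ?r = "Assoc C (D \<otimes>\<^sub>o A) D Z" and ?b = "Assoc C D A ?DZ" and ?aa = "Assoc C D A D \<otimes>\<^sub>m Id C Z"
    have s: "arr ?s ((D \<otimes>\<^sub>o (A \<otimes>\<^sub>o D)) \<otimes>\<^sub>o Z) (D \<otimes>\<^sub>o ((A \<otimes>\<^sub>o D) \<otimes>\<^sub>o Z))" by blast
    have dZ: "arr ?dZ ((D \<otimes>\<^sub>o \<one>\<^sub>o) \<otimes>\<^sub>o Z) ((D \<otimes>\<^sub>o (A \<otimes>\<^sub>o D)) \<otimes>\<^sub>o Z)" by blast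
    have aZ: "arr ?aZ ((D \<otimes>\<^sub>o (A \<otimes>\<^sub>o D)) \<otimes>\<^sub>o Z) (((D \<otimes>\<^sub>o A) \<otimes>\<^sub>o D) \<otimes>\<^sub>o Z)" using arr_a by blast
    have aa: "arr ?aa (((D \<otimes>\<^sub>o A) \<otimes>\<^sub>o D) \<otimes>\<^sub>o Z) ((D \<otimes>\<^sub>o (A \<otimes>\<^sub>o D)) \<otimes>\<^sub>o Z)" by blast
    have r: "arr ?r (((D \<otimes>\<^sub>o A) \<otimes>\<^sub>o D) \<otimes>\<^sub>o Z) ((D \<otimes>\<^sub>o A) \<otimes>\<^sub>o ?DZ)" by blast
    have bb: "arr ?b ((D \<otimes>\<^sub>o A) \<otimes>\<^sub>o ?DZ) (D \<otimes>\<^sub>o (A \<otimes>\<^sub>o ?DZ))" by blast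
    have eDZ: "arr (?eD \<otimes>\<^sub>m Id C Z) (((D \<otimes>\<^sub>o A) \<otimes>\<^sub>o D) \<otimes>\<^sub>o Z) ((\<one>\<^sub>o \<otimes>\<^sub>o D) \<otimes>\<^sub>o Z)" by blast
    have u: "arr (Assoc C \<one>\<^sub>o D Z) ((\<one>\<^sub>o \<otimes>\<^sub>o D) \<otimes>\<^sub>o Z) (\<one>\<^sub>o \<otimes>\<^sub>o ?DZ)" by blast
    have adZ: "arr (?aZ \<bullet> ?dZ) ((D \<otimes>\<^sub>o \<one>\<^sub>o) \<otimes>\<^sub>o Z) (((D \<otimes>\<^sub>o A) \<otimes>\<^sub>o D) \<otimes>\<^sub>o Z)" by (rule arr_Comp[OF dZ aZ])
    have "?K \<bullet> ?n = ?l \<bullet> (?e \<bullet> (b \<bullet> (?t1 \<bullet> (?t2 \<bullet> ?n))))"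
      using arr_assoc[OF n ebt l] arr_assoc[OF n bt e] arr_assoc[OF n t12 arr_b] arr_assoc[OF n t2 t1] by simp
    also have "?t2 \<bullet> ?n = ?s \<bullet> ?dZ"
      using Assoc_nat[OF arr_Id[OF D] coev arr_Id[OF Z]] by simp
    also have "?t1 \<bullet> (?s \<bullet> ?dZ) = ?b \<bullet> (?r \<bullet> (?aZ \<bullet> ?dZ))"
    proof -
      have inv: "?aa \<bullet> (?aZ \<bullet> ?dZ) = ?dZ"
      proof (rule arr_cancel[OF _ dZ aZ aa])
        have "arr (Assoc C D A D) ((D \<otimes>\<^sub>o A) \<otimes>\<^sub>o D) (D \<otimes>\<^sub>o (A \<otimes>\<^sub>o D))" by blast
        from whisker_right[OF arr_a this Z]
        show "?aa \<bullet> ?aZ = Id C ((D \<otimes>\<^sub>o (A \<otimes>\<^sub>o D)) \<otimes>\<^sub>o Z)"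
          using a A D Z by (simp add: inverses_def TensMor_Id Tens_in)
      qed
      have "?b \<bullet> (?r \<bullet> (?aZ \<bullet> ?dZ)) = (?b \<bullet> ?r) \<bullet> (?aZ \<bullet> ?dZ)"
        using arr_assoc[OF adZ r bb] by simp
      also have "?b \<bullet> ?r = ?t1 \<bullet> (?s \<bullet> ?aa)" by (rule pentagon[OF D A D Z])
      also have "\<dots> \<bullet> (?aZ \<bullet> ?dZ) = ?t1 \<bullet> (?s \<bullet> (?aa \<bullet> (?aZ \<bullet> ?dZ)))"
        using arr_assoc[OF adZ arr_Comp[OF aa s] t1] arr_assoc[OF adZ aa s] by simp
      finally show ?thesis using inv by simp
    qed
    also have "b \<bullet> (?b \<bullet> (?r \<bullet> (?aZ \<bullet> ?dZ))) = ?r \<bullet> (?aZ \<bullet> ?dZ)"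
      by (rule arr_cancel[OF _ arr_Comp[OF adZ r] bb arr_b]) (use b in \<open>simp add: inverses_def\<close>)
    also have "?e \<bullet> (?r \<bullet> (?aZ \<bullet> ?dZ)) = Assoc C \<one>\<^sub>o D Z \<bullet> ((?eD \<otimes>\<^sub>m Id C Z) \<bullet> (?aZ \<bullet> ?dZ))"
      by (rule arr_replace[OF _ adZ r e eDZ u])
        (use Assoc_nat[OF ev arr_Id[OF D] arr_Id[OF Z]] D Z in \<open>simp add: TensMor_Id\<close>)
    also have "(?eD \<otimes>\<^sub>m Id C Z) \<bullet> (?aZ \<bullet> ?dZ) = q \<otimes>\<^sub>m Id C Z"
      using whisker_right[OF d arr_a Z] whisker_right[OF ad eD Z] by (simp add: q_def)
    finally show ?thesis .
  qed
  \<comment> \<open>the second zig-zag identity exhibits \<open>q\<close> as the composite of two unit isomorphisms\<close>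
  have q_iso: "\<exists>q'. inverses (D \<otimes>\<^sub>o \<one>\<^sub>o) (\<one>\<^sub>o \<otimes>\<^sub>o D) q q'"
  proof -
    obtain l' where l': "inverses (\<one>\<^sub>o \<otimes>\<^sub>o D) D (LUnit C D) l'" using LUnit_inverses[OF D] .
    obtain r' where r': "inverses (D \<otimes>\<^sub>o \<one>\<^sub>o) D (RUnit C D) r'" using RUnit_inverses[OF D] .
    have arr_l': "arr l' D (\<one>\<^sub>o \<otimes>\<^sub>o D)" using l' by (simp add: inverses_def)
    have "l' \<bullet> (LUnit C D \<bullet> q) = q"
      by (rule arr_cancel[OF _ q arr_LUnit[OF D] arr_l']) (use l' in \<open>simp add: inverses_def\<close>)
    hence "q = l' \<bullet> RUnit C D" using zigzag2 by (simp add: q_def)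
    thus ?thesis using inverses_comp[OF r' inverses_sym[OF l']] by blast
  qed
  then obtain q' where q': "inverses (D \<otimes>\<^sub>o \<one>\<^sub>o) (\<one>\<^sub>o \<otimes>\<^sub>o D) q q'" by blast
  have "inverses Z Z (Id C Z) (Id C Z)" using Z arr_Id arr_Id_left by (auto simp: inverses_def)
  from inverses_tensor[OF q' this]
  have qZ: "inverses ((D \<otimes>\<^sub>o \<one>\<^sub>o) \<otimes>\<^sub>o Z) ((\<one>\<^sub>o \<otimes>\<^sub>o D) \<otimes>\<^sub>o Z) (q \<otimes>\<^sub>m Id C Z) (q' \<otimes>\<^sub>m Id C Z)" .
  obtain u' where u': "inverses ((\<one>\<^sub>o \<otimes>\<^sub>o D) \<otimes>\<^sub>o Z) (\<one>\<^sub>o \<otimes>\<^sub>o ?DZ) (Assoc C \<one>\<^sub>o D Z) u'"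
    using Assoc_inverses[OF Unit_in D Z] .
  obtain v' where v': "inverses (\<one>\<^sub>o \<otimes>\<^sub>o ?DZ) ?DZ ?l v'" using LUnit_inverses[OF DZ] .
  obtain w where w: "inverses ((D \<otimes>\<^sub>o \<one>\<^sub>o) \<otimes>\<^sub>o Z) ?DZ (?K \<bullet> ?n) w"
    unfolding K_Assoc using inverses_comp[OF inverses_comp[OF qZ u'] v'] by blast
  have arr_w: "arr w ?DZ ((D \<otimes>\<^sub>o \<one>\<^sub>o) \<otimes>\<^sub>o Z)" and Kw: "(?K \<bullet> ?n) \<bullet> w = Id C ?DZ"
    using w by (auto simp: inverses_def)
  have right_inverse: "?K \<bullet> (?n \<bullet> w) = Id C ?DZ" using arr_assoc[OF arr_w n K] Kw by simp
  have "h = (h \<bullet> ?K) \<bullet> (?n \<bullet> w)" if h: "arr h ?DZ Y" for h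
    using arr_assoc[OF arr_Comp[OF arr_w n] K h] right_inverse arr_Id_right[OF h] by simp
  moreover have "f \<bullet> ?K = g \<bullet> ?K"
    unfolding recover[OF f, symmetric] recover[OF g, symmetric] eq ..
  ultimately show "f = g" using f g by metis
qed

end

text \<open>
  Each of the two transpositions is linear and injective, so the dimensions of \<open>Hom(Z, A \<otimes> Y)\<close> and
  \<open>Hom(D \<otimes> Z, Y)\<close> are bounded by each other.
\<close>

lemma mult_adjunction:
  assumes dual: "left_dual C A D" and Y: "simple_object C Y" and Z: "simple_object C Z"
  shows "mult (A \<otimes>\<^sub>o Y) Z = mult (D \<otimes>\<^sub>o Z) Y"
proof -
  obtain ev coev a where A: "A \<in> Obj C" and D: "D \<in> Obj C"
    and ev': "ev \<in> Mor C (D \<otimes>\<^sub>o A) \<one>\<^sub>o" and coev': "coev \<in> Mor C \<one>\<^sub>o (A \<otimes>\<^sub>o D)"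
    and a': "is_inverse C ((D \<otimes>\<^sub>o A) \<otimes>\<^sub>o D) (D \<otimes>\<^sub>o (A \<otimes>\<^sub>o D)) (Assoc C D A D) a"
    and zigzag: "RUnit C A \<bullet> ((Id C A \<otimes>\<^sub>m ev) \<bullet> (Assoc C A D A \<bullet> (coev \<otimes>\<^sub>m Id C A))) = LUnit C A"
      "LUnit C D \<bullet> ((ev \<otimes>\<^sub>m Id C D) \<bullet> (a \<bullet> (Id C D \<otimes>\<^sub>m coev))) = RUnit C D"
    using dual unfolding left_dual_def by blast
  have YZ: "Y \<in> Obj C" "Z \<in> Obj C" using Y Z simple_object_in by auto
  have obj: "A \<otimes>\<^sub>o Y \<in> Obj C" "D \<otimes>\<^sub>o Z \<in> Obj C" "D \<otimes>\<^sub>o (A \<otimes>\<^sub>o Y) \<in> Obj C" "(D \<otimes>\<^sub>o A) \<otimes>\<^sub>o Y \<in> Obj C"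
    "\<one>\<^sub>o \<otimes>\<^sub>o Y \<in> Obj C" "\<one>\<^sub>o \<otimes>\<^sub>o Z \<in> Obj C" "A \<otimes>\<^sub>o (D \<otimes>\<^sub>o Z) \<in> Obj C"
    using A D YZ Tens_in Unit_in by auto
  have ev: "arr ev (D \<otimes>\<^sub>o A) \<one>\<^sub>o" and coev: "arr coev \<one>\<^sub>o (A \<otimes>\<^sub>o D)"
    using ev' coev' A D Tens_in Unit_in by (auto simp: arr_def)
  have a: "inverses ((D \<otimes>\<^sub>o A) \<otimes>\<^sub>o D) (D \<otimes>\<^sub>o (A \<otimes>\<^sub>o D)) (Assoc C D A D) a"
    using a' A D Tens_in by (auto simp: is_inverse_def inverses_def arr_def)
  obtain b where b: "inverses ((D \<otimes>\<^sub>o A) \<otimes>\<^sub>o Y) (D \<otimes>\<^sub>o (A \<otimes>\<^sub>o Y)) (Assoc C D A Y) b"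
    using Assoc_inverses[OF D A YZ(1)] .
  have b_in: "b \<in> Mor C (D \<otimes>\<^sub>o (A \<otimes>\<^sub>o Y)) ((D \<otimes>\<^sub>o A) \<otimes>\<^sub>o Y)" using b by (auto simp: inverses_def arr_def)
  have evY: "ev \<otimes>\<^sub>m Id C Y \<in> Mor C ((D \<otimes>\<^sub>o A) \<otimes>\<^sub>o Y) (\<one>\<^sub>o \<otimes>\<^sub>o Y)"
    using arrD[OF arr_tensor[OF ev arr_Id[OF YZ(1)]]] by simp
  have lY: "LUnit C Y \<in> Mor C (\<one>\<^sub>o \<otimes>\<^sub>o Y) Y" using arrD[OF arr_LUnit[OF YZ(1)]] by simp
  let ?\<Phi> = "\<lambda>f. LUnit C Y \<bullet> ((ev \<otimes>\<^sub>m Id C Y) \<bullet> (b \<bullet> (Id C D \<otimes>\<^sub>m f)))"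
  have "linear_on (Hom C Z (A \<otimes>\<^sub>o Y)) (Hom C (D \<otimes>\<^sub>o Z) Y) ?\<Phi>"
    by (rule linear_comp[OF linear_comp[OF linear_comp[OF
        linear_tensor_left[OF YZ(2) obj(1) D] linear_post[OF obj(2,3,4) b_in]]
        linear_post[OF obj(2,4,5) evY]] linear_post[OF obj(2,5) YZ(1) lY]])
  moreover have "inj_on ?\<Phi> (Mor C Z (A \<otimes>\<^sub>o Y))"
  proof (rule inj_onI)
    fix f g assume fg: "f \<in> Mor C Z (A \<otimes>\<^sub>o Y)" "g \<in> Mor C Z (A \<otimes>\<^sub>o Y)" "?\<Phi> f = ?\<Phi> g"
    have "arr f Z (A \<otimes>\<^sub>o Y)" "arr g Z (A \<otimes>\<^sub>o Y)" using fg YZ obj by (auto simp: arr_def)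
    from transpose_injective[OF A D ev coev a zigzag YZ b this fg(3)] show "f = g" .
  qed
  ultimately have le: "mult (A \<otimes>\<^sub>o Y) Z \<le> mult (D \<otimes>\<^sub>o Z) Y"
    by (rule has_dim_le[OF Hom_vector_space[OF YZ(2) obj(1)] Hom_dim(2)[OF obj(1) Z] Hom_dim(1)[OF obj(2) Y]])
  obtain l where l: "inverses (\<one>\<^sub>o \<otimes>\<^sub>o Z) Z (LUnit C Z) l" using LUnit_inverses[OF YZ(2)] .
  let ?z = "Assoc C A D Z \<bullet> (coev \<otimes>\<^sub>m Id C Z)"
  have z: "arr ?z (\<one>\<^sub>o \<otimes>\<^sub>o Z) (A \<otimes>\<^sub>o (D \<otimes>\<^sub>o Z))"
    by (rule arr_Comp[OF arr_tensor[OF coev arr_Id[OF YZ(2)]] arr_Assoc[OF A D YZ(2)]])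
  let ?\<Psi> = "\<lambda>g. ((Id C A \<otimes>\<^sub>m g) \<bullet> ?z) \<bullet> l"
  note pre_l = linear_inj_precompose[OF inverses_sym[OF l] obj(1)]
  have lin: "linear_on (Hom C (D \<otimes>\<^sub>o Z) Y) (Hom C (\<one>\<^sub>o \<otimes>\<^sub>o Z) (A \<otimes>\<^sub>o Y)) (\<lambda>g. (Id C A \<otimes>\<^sub>m g) \<bullet> ?z)"
    by (rule linear_comp[OF linear_tensor_left[OF obj(2) YZ(1) A] linear_pre[OF obj(6,7,1)]])
      (use z in \<open>simp add: arr_def\<close>)
  have "linear_on (Hom C (D \<otimes>\<^sub>o Z) Y) (Hom C Z (A \<otimes>\<^sub>o Y)) ?\<Psi>" by (rule linear_comp[OF lin pre_l(1)])
  moreover have "inj_on ?\<Psi> (Mor C (D \<otimes>\<^sub>o Z) Y)"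
  proof (rule inj_onI)
    fix f g assume fg: "f \<in> Mor C (D \<otimes>\<^sub>o Z) Y" "g \<in> Mor C (D \<otimes>\<^sub>o Z) Y" "?\<Psi> f = ?\<Psi> g"
    have "(Id C A \<otimes>\<^sub>m f) \<bullet> ?z = (Id C A \<otimes>\<^sub>m g) \<bullet> ?z"
      by (rule inj_onD[OF pre_l(2) fg(3)]) (use lin fg in \<open>auto simp: linear_on_def\<close>)
    moreover have "arr f (D \<otimes>\<^sub>o Z) Y" "arr g (D \<otimes>\<^sub>o Z) Y" using fg YZ obj by (auto simp: arr_def)
    ultimately show "f = g" using detranspose_injective[OF A D ev coev a zigzag YZ, of f g] by blast
  qed
  ultimately have "mult (D \<otimes>\<^sub>o Z) Y \<le> mult (A \<otimes>\<^sub>o Y) Z"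
    by (rule has_dim_le[OF Hom_vector_space[OF obj(2) YZ(1)] Hom_dim(1)[OF obj(2) Y] Hom_dim(2)[OF obj(1) Z]])
  thus ?thesis using le by simp
qed

end


section \<open>Subcategories and closed sets of classes\<close>

context fusion_category
begin

definition fusion_coefficient :: "'o set \<Rightarrow> 'o set \<Rightarrow> 'o set \<Rightarrow> nat" where
  "fusion_coefficient x y z = multiplicity_in C (representative x \<otimes>\<^sub>o representative y) z"

lemma representative_in: "c \<in> Irr C \<Longrightarrow> representative c \<in> Obj C"
  using Irr_representative(1) simple_object_in by blast

lemma Unit_Irr: "iso_class C \<one>\<^sub>o \<in> Irr C"
  by (rule iso_class_Irr[OF simple_Unit])

lemma mult_representative:
  "x \<in> Irr C \<Longrightarrow> c \<in> Irr C \<Longrightarrow> multiplicity_in C (representative x) c = (if x = c then 1 else 0)"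
  using mult_simple[of "representative x" "representative c"] Irr_representative[of x] Irr_representative[of c]
    iso_class_eq_iff[OF representative_in, of x "representative c"] by simp

lemma isomorphic_Assoc:
  "A \<in> Obj C \<Longrightarrow> V \<in> Obj C \<Longrightarrow> Y \<in> Obj C \<Longrightarrow> isomorphic C ((A \<otimes>\<^sub>o V) \<otimes>\<^sub>o Y) (A \<otimes>\<^sub>o (V \<otimes>\<^sub>o Y))"
  using Assoc_inverses[of A V Y] unfolding isomorphic_iff by blast

lemma isomorphic_LUnit: "V \<in> Obj C \<Longrightarrow> isomorphic C (\<one>\<^sub>o \<otimes>\<^sub>o V) V"
  using LUnit_inverses[of V] unfolding isomorphic_iff by blast

lemma isomorphic_RUnit: "V \<in> Obj C \<Longrightarrow> isomorphic C (V \<otimes>\<^sub>o \<one>\<^sub>o) V"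
  using RUnit_inverses[of V] unfolding isomorphic_iff by blast

text \<open>
  Reciprocity with \<open>Z\<close> the unit object expresses the constituents of a dual through fusion coefficients.
\<close>

lemma multiplicity_dual:
  assumes dual: "left_dual C V D" and c: "c \<in> Irr C"
  shows "multiplicity_in C D c = (\<Sum>v\<in>Irr C. multiplicity_in C V v * fusion_coefficient v c (iso_class C \<one>\<^sub>o))"
proof -
  have obj: "V \<in> Obj C" "D \<in> Obj C" using dual by (auto simp: left_dual_def)
  note rep = Irr_representative(1)[OF c]
  have "multiplicity_in C D c = mult D (representative c)" using multiplicity_in_Irr[OF c] .
  also have "\<dots> = mult (D \<otimes>\<^sub>o \<one>\<^sub>o) (representative c)"
    by (rule mult_isomorphic[OF isomorphic_sym[OF isomorphic_RUnit[OF obj(2)]] rep])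
  also have "\<dots> = mult (V \<otimes>\<^sub>o representative c) \<one>\<^sub>o"
    by (rule mult_adjunction[OF dual rep simple_Unit, symmetric])
  also have "\<dots> = (\<Sum>v\<in>Irr C. multiplicity_in C V v * fusion_coefficient v c (iso_class C \<one>\<^sub>o))"
    unfolding fusion_coefficient_def by (rule mult_tensor_right[OF obj(1) representative_in[OF c] simple_Unit])
  finally show ?thesis .
qed

lemma fusion_rule: "fusion_rule (Irr C) fusion_coefficient (iso_class C \<one>\<^sub>o)"
proof
  show "finite (Irr C)" by (rule finite_Irr)
  show "iso_class C \<one>\<^sub>o \<in> Irr C" by (rule Unit_Irr)
  fix x y z t
  assume y: "y \<in> Irr C" and z: "z \<in> Irr C"
  note ry = representative_in[OF y] and rz = representative_in[OF z]
  have unit: "isomorphic C (representative (iso_class C \<one>\<^sub>o)) \<one>\<^sub>o"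
    by (rule isomorphic_sym[OF isomorphic_representative[OF simple_Unit]])
  have "isomorphic C (representative (iso_class C \<one>\<^sub>o) \<otimes>\<^sub>o representative y) (representative y)"
    by (rule isomorphic_trans[OF isomorphic_tensor[OF unit isomorphic_refl[OF ry]] isomorphic_LUnit[OF ry]])
  from mult_isomorphic[OF this Irr_representative(1)[OF z]]
  show "fusion_coefficient (iso_class C \<one>\<^sub>o) y z = (if y = z then 1 else 0)"
    using mult_representative[OF y z] by (simp add: fusion_coefficient_def Irr_representative(2)[OF z])
  have "isomorphic C (representative y \<otimes>\<^sub>o representative (iso_class C \<one>\<^sub>o)) (representative y)"
    by (rule isomorphic_trans[OF isomorphic_tensor[OF isomorphic_refl[OF ry] unit] isomorphic_RUnit[OF ry]])
  from mult_isomorphic[OF this Irr_representative(1)[OF z]]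
  show "fusion_coefficient y (iso_class C \<one>\<^sub>o) z = (if y = z then 1 else 0)"
    using mult_representative[OF y z] by (simp add: fusion_coefficient_def Irr_representative(2)[OF z])
  assume x: "x \<in> Irr C"
  note rx = representative_in[OF x]
  obtain D where D: "left_dual C (representative x) D" using ex_left_dual[OF rx] by blast
  hence DO: "D \<in> Obj C" by (simp add: left_dual_def)
  \<comment> \<open>the constituents of the chosen dual object do not depend on the choice\<close>
  have dual: "multiplicity_in C D d = fusion_coefficient x d (iso_class C \<one>\<^sub>o)" if "d \<in> Irr C" for d
    using multiplicity_dual[OF D that] mult_representative[OF x] x finite_Irr
    by (simp add: if_distrib[of "\<lambda>t. t * _"] cong: if_cong)
  have "fusion_coefficient x y z = mult (representative x \<otimes>\<^sub>o representative y) (representative z)"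
    unfolding fusion_coefficient_def by (rule multiplicity_in_Irr[OF z])
  also have "\<dots> = mult (D \<otimes>\<^sub>o representative z) (representative y)"
    by (rule mult_adjunction[OF D Irr_representative(1)[OF y] Irr_representative(1)[OF z]])
  also have "\<dots> = (\<Sum>d\<in>Irr C. multiplicity_in C D d * fusion_coefficient d z y)"
    unfolding mult_tensor_right[OF DO rz Irr_representative(1)[OF y]]
    by (simp add: fusion_coefficient_def Irr_representative(2)[OF y])
  also have "\<dots> = (\<Sum>d\<in>Irr C. fusion_coefficient x d (iso_class C \<one>\<^sub>o) * fusion_coefficient d z y)"
    using dual by simp
  finally show "fusion_coefficient x y z
      = (\<Sum>d\<in>Irr C. fusion_coefficient x d (iso_class C \<one>\<^sub>o) * fusion_coefficient d z y)" .
  assume t: "t \<in> Irr C"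
  note rt = Irr_representative(1,2)[OF t]
  have "(\<Sum>w\<in>Irr C. fusion_coefficient x y w * fusion_coefficient w z t)
      = mult ((representative x \<otimes>\<^sub>o representative y) \<otimes>\<^sub>o representative z) (representative t)"
    unfolding mult_tensor_right[OF Tens_in[OF rx ry] rz rt(1)] by (simp add: fusion_coefficient_def rt)
  also have "\<dots> = mult (representative x \<otimes>\<^sub>o (representative y \<otimes>\<^sub>o representative z)) (representative t)"
    by (rule mult_isomorphic[OF isomorphic_Assoc[OF rx ry rz] rt(1)])
  also have "\<dots> = (\<Sum>w\<in>Irr C. fusion_coefficient y z w * fusion_coefficient x w t)"
    unfolding mult_tensor_left[OF Tens_in[OF ry rz] rx rt(1)] by (simp add: fusion_coefficient_def rt)
  finally show "(\<Sum>w\<in>Irr C. fusion_coefficient x y w * fusion_coefficient w z t)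
      = (\<Sum>w\<in>Irr C. fusion_coefficient y z w * fusion_coefficient x w t)" .
qed

end

sublocale fusion_category \<subseteq> rule: fusion_rule "Irr C" fusion_coefficient "iso_class C \<one>\<^sub>o"
  by (rule fusion_rule)

context fusion_category
begin

text \<open>
  So a dual object has the dual constituents. Together with additivity on direct sums and tensor products
  this makes the closure properties of tensor subcategories combinatorial.
\<close>

lemma multiplicity_left_dual:
  assumes "left_dual C V D" and "c \<in> Irr C"
  shows "multiplicity_in C D c = multiplicity_in C V (rule.dual c)"
proof -
  have "multiplicity_in C D c = (\<Sum>v\<in>Irr C. if v = rule.dual c then multiplicity_in C V v else 0)"
    unfolding multiplicity_dual[OF assms]
    by (rule sum.cong[OF refl]) (use assms rule.dual_dual in \<open>auto simp: rule.N_dual\<close>)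
  thus ?thesis using assms finite_Irr by simp
qed

lemma multiplicity_tensor:
  assumes V: "V \<in> Obj C" "Y \<in> Obj C" and c: "c \<in> Irr C"
  shows "multiplicity_in C (V \<otimes>\<^sub>o Y) c
    = (\<Sum>x\<in>Irr C. \<Sum>y\<in>Irr C. multiplicity_in C V x * multiplicity_in C Y y * fusion_coefficient x y c)"
proof -
  note rc = Irr_representative(1,2)[OF c]
  have "multiplicity_in C (V \<otimes>\<^sub>o Y) c = (\<Sum>x\<in>Irr C. multiplicity_in C V x * mult (representative x \<otimes>\<^sub>o Y) (representative c))"
    using mult_tensor_right[OF V rc(1)] by (simp add: rc)
  also have "\<dots> = (\<Sum>x\<in>Irr C. multiplicity_in C V x * (\<Sum>y\<in>Irr C. multiplicity_in C Y y * fusion_coefficient x y c))"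
    using mult_tensor_left[OF V(2) representative_in rc(1)] by (simp add: rc fusion_coefficient_def)
  finally show ?thesis by (simp add: sum_distrib_left mult.assoc)
qed

lemma multiplicity_pos_iff:
  assumes dec: "simple_decomposition C V Ys" and c: "c \<in> Irr C"
  shows "0 < multiplicity_in C V c \<longleftrightarrow> (\<exists>Y\<in>set Ys. iso_class C Y = c)"
proof -
  note rc = Irr_representative(1,2)[OF c]
  have Ys: "simple_object C Y" if "Y \<in> set Ys" for Y using dec that by (auto simp: simple_decomposition_def)
  have "multiplicity_in C V c = card {j. j < length Ys \<and> Ys ! j \<in> c}"
    using mult_decomposition[OF dec rc(1)] by (simp add: rc)
  hence "0 < multiplicity_in C V c \<longleftrightarrow> (\<exists>j. j < length Ys \<and> Ys ! j \<in> c)"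
    by (simp add: card_gt_0_iff)
  also have "\<dots> \<longleftrightarrow> (\<exists>Y\<in>set Ys. Y \<in> c)" by (metis in_set_conv_nth)
  also have "\<dots> \<longleftrightarrow> (\<exists>Y\<in>set Ys. iso_class C Y = c)"
  proof (intro bex_cong refl)
    fix Y assume "Y \<in> set Ys"
    hence Y: "simple_object C Y" by (rule Ys)
    have "Y \<in> c \<longleftrightarrow> isomorphic C (representative c) Y" using rc(2) by (auto simp: iso_class_def)
    also have "\<dots> \<longleftrightarrow> isomorphic C Y (representative c)" using isomorphic_sym by blast
    also have "\<dots> \<longleftrightarrow> iso_class C Y = c"
      using iso_class_eq_iff[OF simple_object_in[OF Y], of "representative c"] rc(2) by simp
    finally show "Y \<in> c \<longleftrightarrow> iso_class C Y = c" .
  qed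
  finally show ?thesis .
qed

lemma multiplicity_direct_sum_pos_iff:
  assumes sum: "direct_sum C V Ys" and c: "c \<in> Irr C"
  shows "0 < multiplicity_in C V c \<longleftrightarrow> (\<exists>Y\<in>set Ys. 0 < multiplicity_in C Y c)"
proof -
  note rc = Irr_representative(1,2)[OF c]
  obtain i p where b: "biproduct C V {..<length Ys} ((!) Ys) i p" using sum by (auto simp: direct_sum_biproduct)
  have "multiplicity_in C V c = (\<Sum>j<length Ys. multiplicity_in C (Ys ! j) c)"
    using mult_biproduct[OF b rc(1)] by (simp add: rc)
  hence "0 < multiplicity_in C V c \<longleftrightarrow> (\<exists>j<length Ys. 0 < multiplicity_in C (Ys ! j) c)"
    by (auto simp: neq0_conv[symmetric] simp del: neq0_conv)
  also have "\<dots> \<longleftrightarrow> (\<exists>Y\<in>set Ys. 0 < multiplicity_in C Y c)" by (auto simp: in_set_conv_nth Bex_def)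
  finally show ?thesis .
qed

text \<open>
  This and the next definition translate between full tensor subcategories and closed sets of classes.
\<close>

definition classes_of :: "'o set \<Rightarrow> 'o set set" where
  "classes_of S = {c \<in> Irr C. representative c \<in> S}"

definition objects_of :: "'o set set \<Rightarrow> 'o set" where
  "objects_of T = {V \<in> Obj C. \<forall>c\<in>Irr C. 0 < multiplicity_in C V c \<longrightarrow> c \<in> T}"

lemma classes_of_objects_of: "T \<subseteq> Irr C \<Longrightarrow> classes_of (objects_of T) = T"
  unfolding classes_of_def objects_of_def
  by (auto simp: mult_representative representative_in subset_iff split: if_splits)

text \<open>
  This is the direction that exploits minimality: a subcategory generated by given objects lies inside
  every one that is obtained from a closed set of classes.
\<close>

lemma tensor_subcategory_objects_of:
  assumes T: "rule.subrule T"
  shows "tensor_subcategory C (objects_of T)"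
  unfolding tensor_subcategory_def
proof (intro conjI ballI allI impI)
  note T' = rule.subruleD[OF T]
  show "objects_of T \<subseteq> Obj C" by (auto simp: objects_of_def)
  have "multiplicity_in C \<one>\<^sub>o c = (if iso_class C \<one>\<^sub>o = c then 1 else 0)" if c: "c \<in> Irr C" for c
    using mult_simple[OF simple_Unit Irr_representative(1)[OF c]] Irr_representative(2)[OF c]
      iso_class_eq_iff[OF Unit_in, of "representative c"] by simp
  thus "\<one>\<^sub>o \<in> objects_of T" using Unit_in T'(2) by (auto simp: objects_of_def)
next
  fix V Y assume V: "V \<in> objects_of T" "Y \<in> objects_of T"
  hence obj: "V \<in> Obj C" "Y \<in> Obj C" by (auto simp: objects_of_def)
  have "c \<in> T" if c: "c \<in> Irr C" and pos: "0 < multiplicity_in C (V \<otimes>\<^sub>o Y) c" for c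
  proof -
    obtain x where x: "x \<in> Irr C" "(\<Sum>y\<in>Irr C. multiplicity_in C V x * multiplicity_in C Y y * fusion_coefficient x y c) \<noteq> 0"
      using pos unfolding multiplicity_tensor[OF obj c] by (metis (no_types, lifting) less_numeral_extra(3) sum.neutral)
    then obtain y where y: "y \<in> Irr C" "multiplicity_in C V x * multiplicity_in C Y y * fusion_coefficient x y c \<noteq> 0"
      by (meson sum.neutral)
    hence "x \<in> T" "y \<in> T" "rule.in_product x y c"
      using V x(1) c by (auto simp: objects_of_def rule.in_product_def)
    thus ?thesis by (rule rule.subruleD(3)[OF T])
  qed
  thus "V \<otimes>\<^sub>o Y \<in> objects_of T" using obj Tens_in by (auto simp: objects_of_def)
next
  fix V Ys assume "direct_sum C V Ys \<and> set Ys \<subseteq> objects_of T"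
  thus "V \<in> objects_of T"
    using multiplicity_direct_sum_pos_iff[of V Ys] unfolding objects_of_def direct_sum_def by blast
next
  fix V Ys assume "direct_sum C V Ys \<and> V \<in> objects_of T"
  thus "set Ys \<subseteq> objects_of T"
    using multiplicity_direct_sum_pos_iff[of V Ys] unfolding objects_of_def direct_sum_def by blast
next
  fix V D assume dual: "left_dual C V D"
  note T' = rule.subruleD[OF T]
  have obj: "V \<in> Obj C" "D \<in> Obj C" using dual by (auto simp: left_dual_def)
  have closed: "rule.dual c \<in> T \<longleftrightarrow> c \<in> T" if "c \<in> Irr C" for c
    using T'(4)[of c] T'(4)[of "rule.dual c"] rule.dual_dual[OF that] by auto
  show "V \<in> objects_of T \<longleftrightarrow> D \<in> objects_of T"
  proof
    assume V: "V \<in> objects_of T"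
    have "c \<in> T" if "c \<in> Irr C" "0 < multiplicity_in C D c" for c
      using V that closed[OF that(1)] rule.dual_in[OF that(1)]
      by (auto simp: objects_of_def multiplicity_left_dual[OF dual])
    thus "D \<in> objects_of T" using obj by (simp add: objects_of_def)
  next
    assume D: "D \<in> objects_of T"
    have "c \<in> T" if "c \<in> Irr C" "0 < multiplicity_in C V c" for c
    proof -
      have "multiplicity_in C D (rule.dual c) = multiplicity_in C V c"
        using multiplicity_left_dual[OF dual rule.dual_in[OF that(1)]] that(1) by simp
      hence "rule.dual c \<in> T" using D that rule.dual_in[OF that(1)] by (simp add: objects_of_def)
      thus ?thesis using closed[OF that(1)] by simp
    qed
    thus "V \<in> objects_of T" using obj by (simp add: objects_of_def)
  qed
qed

context
  fixes S
  assumes S: "tensor_subcategory C S"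
begin

lemma subcategory_closed:
  shows "S \<subseteq> Obj C" "\<one>\<^sub>o \<in> S" "\<And>V Y. V \<in> S \<Longrightarrow> Y \<in> S \<Longrightarrow> V \<otimes>\<^sub>o Y \<in> S"
    "\<And>V Ys. direct_sum C V Ys \<Longrightarrow> set Ys \<subseteq> S \<Longrightarrow> V \<in> S"
    "\<And>V Ys. direct_sum C V Ys \<Longrightarrow> V \<in> S \<Longrightarrow> set Ys \<subseteq> S"
    "\<And>V D. left_dual C V D \<Longrightarrow> V \<in> S \<longleftrightarrow> D \<in> S"
  using S unfolding tensor_subcategory_def by blast+

lemma subcategory_isomorphic: "isomorphic C V Y \<Longrightarrow> V \<in> S \<longleftrightarrow> Y \<in> S"
  using isomorphic_direct_sum[of V Y] subcategory_closed(4,5)[of V "[Y]"] by auto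

lemma iso_class_in_classes_of: "simple_object C V \<Longrightarrow> iso_class C V \<in> classes_of S \<longleftrightarrow> V \<in> S"
  using isomorphic_representative[of V] subcategory_isomorphic iso_class_Irr[of V]
  unfolding classes_of_def by blast

text \<open>
  A tensor subcategory is closed under sums and summands, so it is determined by its simple objects.
\<close>

lemma subcategory_objects_of: "S = objects_of (classes_of S)"
proof (intro equalityI subsetI)
  fix V assume V: "V \<in> S"
  hence obj: "V \<in> Obj C" using subcategory_closed(1) by blast
  obtain Ys where dec: "simple_decomposition C V Ys" using semisimple[OF obj] by blast
  have "set Ys \<subseteq> S" using dec subcategory_closed(5) V unfolding simple_decomposition_def by blast
  moreover have "\<And>Y. Y \<in> set Ys \<Longrightarrow> simple_object C Y" using dec by (simp add: simple_decomposition_def)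
  ultimately have "iso_class C Y \<in> classes_of S" if "Y \<in> set Ys" for Y
    using that iso_class_in_classes_of by blast
  thus "V \<in> objects_of (classes_of S)"
    using obj multiplicity_pos_iff[OF dec] by (auto simp: objects_of_def)
next
  fix V assume V: "V \<in> objects_of (classes_of S)"
  hence obj: "V \<in> Obj C" by (simp add: objects_of_def)
  obtain Ys where dec: "simple_decomposition C V Ys" using semisimple[OF obj] by blast
  have "Y \<in> S" if Y: "Y \<in> set Ys" for Y
  proof -
    have simple: "simple_object C Y" using dec Y by (simp add: simple_decomposition_def)
    have "0 < multiplicity_in C V (iso_class C Y)"
      using multiplicity_pos_iff[OF dec iso_class_Irr[OF simple]] Y by blast
    hence "iso_class C Y \<in> classes_of S" using V iso_class_Irr[OF simple] by (simp add: objects_of_def)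
    thus ?thesis using iso_class_in_classes_of[OF simple] by simp
  qed
  thus "V \<in> S" using subcategory_closed(4)[of V Ys] dec by (auto simp: simple_decomposition_def)
qed

lemma subcategory_multiplicity:
  "V \<in> S \<Longrightarrow> c \<in> Irr C \<Longrightarrow> 0 < multiplicity_in C V c \<Longrightarrow> c \<in> classes_of S"
  using subcategory_objects_of unfolding objects_of_def by blast

lemma subrule_classes_of: "rule.subrule (classes_of S)"
  unfolding rule.subrule_def
proof (intro conjI ballI allI impI)
  show "classes_of S \<subseteq> Irr C" by (auto simp: classes_of_def)
  show "iso_class C \<one>\<^sub>o \<in> classes_of S"
    using iso_class_in_classes_of[OF simple_Unit] subcategory_closed(2) by simp
next
  fix x y z assume x: "x \<in> classes_of S" and y: "y \<in> classes_of S" and z: "rule.in_product x y z"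
  have "representative x \<otimes>\<^sub>o representative y \<in> S"
    using x y subcategory_closed(3) by (simp add: classes_of_def)
  thus "z \<in> classes_of S"
    by (rule subcategory_multiplicity) (use z in \<open>auto simp: rule.in_product_def fusion_coefficient_def\<close>)
next
  fix x assume x: "x \<in> classes_of S"
  hence xI: "x \<in> Irr C" "representative x \<in> S" by (auto simp: classes_of_def)
  obtain D where D: "left_dual C (representative x) D" using ex_left_dual[OF representative_in[OF xI(1)]] by blast
  have DS: "D \<in> S" using subcategory_closed(6)[OF D] xI(2) by simp
  have "multiplicity_in C D (rule.dual x) = 1"
    using multiplicity_left_dual[OF D rule.dual_in[OF xI(1)]] xI(1) mult_representative[OF xI(1) xI(1)] by simp
  thus "rule.dual x \<in> classes_of S"
    by (intro subcategory_multiplicity[OF DS]) (use xI(1) in auto)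
qed

end

end


section \<open>Full subcategories and the adjoint series\<close>

lemma full_subcategory_sel [simp]:
  "Obj (full_subcategory C S) = S" "Hom (full_subcategory C S) = Hom C" "Id (full_subcategory C S) = Id C"
  "Comp (full_subcategory C S) = Comp C" "Unit (full_subcategory C S) = Unit C"
  "Tens (full_subcategory C S) = Tens C" "TensMor (full_subcategory C S) = TensMor C"
  "Assoc (full_subcategory C S) = Assoc C" "LUnit (full_subcategory C S) = LUnit C"
  "RUnit (full_subcategory C S) = RUnit C"
  by (simp_all add: full_subcategory_def)

lemma full_subcategory_full [simp]: "full_subcategory (full_subcategory C S) T = full_subcategory C T"
  by (simp add: full_subcategory_def)

lemma full_subcategory_Obj [simp]: "full_subcategory C (Obj C) = C"
  by (simp add: full_subcategory_def)

lemma is_iso_full_subcategory [simp]: "is_iso (full_subcategory C S) V Y f = is_iso C V Y f"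
  by (simp add: is_iso_def is_inverse_def)

lemma isomorphic_full_subcategory:
  "S \<subseteq> Obj C \<Longrightarrow> isomorphic (full_subcategory C S) V Y \<longleftrightarrow> V \<in> S \<and> Y \<in> S \<and> isomorphic C V Y"
  by (auto simp: isomorphic_def)

lemma direct_sum_full_subcategory:
  "S \<subseteq> Obj C \<Longrightarrow> direct_sum (full_subcategory C S) V Ys \<longleftrightarrow> V \<in> S \<and> set Ys \<subseteq> S \<and> direct_sum C V Ys"
  by (auto simp: direct_sum_def)

lemma left_dual_full_subcategory:
  "S \<subseteq> Obj C \<Longrightarrow> left_dual (full_subcategory C S) V D \<longleftrightarrow> V \<in> S \<and> D \<in> S \<and> left_dual C V D"
  by (auto simp: left_dual_def is_inverse_def)

text \<open>
  A subcategory of a subcategory is a subcategory: sums, summands and duals of objects of \<open>T\<close> taken in \<open>C\<close>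
  already belong to \<open>S\<close>. This turns the iterated adjoint construction into a descending chain of
  subcategories of \<open>C\<close>.
\<close>

lemma tensor_subcategory_full_subcategory:
  assumes S: "tensor_subcategory C S"
  shows "tensor_subcategory (full_subcategory C S) T \<longleftrightarrow> T \<subseteq> S \<and> tensor_subcategory C T"
proof -
  have SO: "S \<subseteq> Obj C" using S by (simp add: tensor_subcategory_def)
  have sum: "V \<in> S" if "direct_sum C V Ys" "set Ys \<subseteq> S" for V Ys
    using S that unfolding tensor_subcategory_def by blast
  have sum': "set Ys \<subseteq> S" if "direct_sum C V Ys" "V \<in> S" for V Ys
    using S that unfolding tensor_subcategory_def by blast
  have dual: "V \<in> S \<longleftrightarrow> D \<in> S" if "left_dual C V D" for V D
    using S that unfolding tensor_subcategory_def by blast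
  show ?thesis
  proof (cases "T \<subseteq> S")
    case True
    have e1: "(\<forall>V Ys. direct_sum (full_subcategory C S) V Ys \<and> set Ys \<subseteq> T \<longrightarrow> V \<in> T)
        \<longleftrightarrow> (\<forall>V Ys. direct_sum C V Ys \<and> set Ys \<subseteq> T \<longrightarrow> V \<in> T)"
      unfolding direct_sum_full_subcategory[OF SO] using sum True by blast
    have e2: "(\<forall>V Ys. direct_sum (full_subcategory C S) V Ys \<and> V \<in> T \<longrightarrow> set Ys \<subseteq> T)
        \<longleftrightarrow> (\<forall>V Ys. direct_sum C V Ys \<and> V \<in> T \<longrightarrow> set Ys \<subseteq> T)"
      unfolding direct_sum_full_subcategory[OF SO] using sum' True by blast
    have e3: "(\<forall>V D. left_dual (full_subcategory C S) V D \<longrightarrow> (V \<in> T \<longleftrightarrow> D \<in> T))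
        \<longleftrightarrow> (\<forall>V D. left_dual C V D \<longrightarrow> (V \<in> T \<longleftrightarrow> D \<in> T))"
      unfolding left_dual_full_subcategory[OF SO] using dual True by blast
    show ?thesis
      by (simp only: tensor_subcategory_def full_subcategory_sel e1 e2 e3 True subset_trans[OF True SO] simp_thms)
  next
    case False
    thus ?thesis by (simp only: tensor_subcategory_def full_subcategory_sel simp_thms)
  qed
qed

lemma tensor_subcategory_Obj:
  assumes "fusion_category C"
  shows "tensor_subcategory C (Obj C)"
proof -
  interpret fusion_category C by fact
  show ?thesis unfolding tensor_subcategory_def using Unit_in Tens_in
    by (auto simp: direct_sum_def left_dual_def)
qed

lemma tensor_subcategory_Inter:
  assumes ne: "F \<noteq> {}" and F: "\<And>S. S \<in> F \<Longrightarrow> tensor_subcategory C S"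
  shows "tensor_subcategory C (\<Inter>F)"
proof -
  have closed: "S \<subseteq> Obj C" "Unit C \<in> S" "\<And>V Y. V \<in> S \<Longrightarrow> Y \<in> S \<Longrightarrow> Tens C V Y \<in> S"
    "\<And>V Ys. direct_sum C V Ys \<Longrightarrow> set Ys \<subseteq> S \<Longrightarrow> V \<in> S"
    "\<And>V Ys. direct_sum C V Ys \<Longrightarrow> V \<in> S \<Longrightarrow> set Ys \<subseteq> S"
    "\<And>V D. left_dual C V D \<Longrightarrow> V \<in> S \<longleftrightarrow> D \<in> S" if "S \<in> F" for S
    using F[OF that] unfolding tensor_subcategory_def by blast+
  show ?thesis
    unfolding tensor_subcategory_def
  proof (intro conjI ballI allI impI)
    show "\<Inter>F \<subseteq> Obj C" using ne closed(1) by blast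
    show "Unit C \<in> \<Inter>F" using closed(2) by simp
    show "Tens C V Y \<in> \<Inter>F" if "V \<in> \<Inter>F" "Y \<in> \<Inter>F" for V Y
      using closed(3) that by simp
    show "V \<in> \<Inter>F" if "direct_sum C V Ys \<and> set Ys \<subseteq> \<Inter>F" for V Ys
    proof
      fix S assume "S \<in> F"
      thus "V \<in> S" using closed(4)[of S V Ys] that by blast
    qed
    show "set Ys \<subseteq> \<Inter>F" if "direct_sum C V Ys \<and> V \<in> \<Inter>F" for V Ys
    proof (rule Inter_greatest)
      fix S assume "S \<in> F"
      thus "set Ys \<subseteq> S" using closed(5)[of S V Ys] that by blast
    qed
    show "V \<in> \<Inter>F \<longleftrightarrow> D \<in> \<Inter>F" if "left_dual C V D" for V D
      using closed(6)[OF _ that] by simp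
  qed
qed

context fusion_category
begin

context
  fixes S
  assumes S: "tensor_subcategory C S"
begin

lemma zero_object_subcategory:
  assumes V: "V \<in> S"
  shows "zero_object (full_subcategory C S) V \<longleftrightarrow> zero_object C V"
proof
  have VO: "V \<in> Obj C" using V subcategory_closed(1)[OF S] by blast
  assume "zero_object (full_subcategory C S) V"
  hence "Mor C V V = {Zero C V V}" using V by (auto simp: zero_object_def)
  thus "zero_object C V" using Id_in[OF VO] by (intro zero_objectI[OF VO]) blast
next
  assume "zero_object C V"
  thus "zero_object (full_subcategory C S) V"
    using V subcategory_closed(1)[OF S] by (auto simp: zero_object_def)
qed

text \<open>
  Monomorphisms of a subcategory are tested against fewer objects. Nothing is lost, because a simple summand of
  a test object that does not belong to \<open>S\<close> has only zero morphisms to \<open>Y\<close>.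
\<close>

lemma monic_subcategory:
  assumes Y: "Y \<in> S" and V: "V \<in> S"
  shows "monic (full_subcategory C S) Y V f \<longleftrightarrow> monic C Y V f"
proof
  have obj: "Y \<in> Obj C" "V \<in> Obj C" using Y V subcategory_closed(1)[OF S] by blast+
  assume m: "monic (full_subcategory C S) Y V f"
  hence f: "f \<in> Mor C Y V" by (simp add: monic_def)
  have cancel: "g = h" if "W \<in> S" "g \<in> Mor C W Y" "h \<in> Mor C W Y" "f \<bullet> g = f \<bullet> h" for W g h
    using m that unfolding monic_def by simp
  show "monic C Y V f"
    unfolding monic_def
  proof (intro conjI ballI impI f)
    fix W g h assume W: "W \<in> Obj C" and g: "g \<in> Mor C W Y" and h: "h \<in> Mor C W Y" and eq: "f \<bullet> g = f \<bullet> h"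
    obtain Ys where dec: "simple_decomposition C W Ys" using semisimple[OF W] by blast
    then obtain i p where b: "biproduct C W {..<length Ys} ((!) Ys) i p"
      by (auto simp: simple_decomposition_def direct_sum_biproduct)
    show "g = h"
    proof (rule biproduct_ext_source[OF b obj(1) g h])
      fix j assume j: "j \<in> {..<length Ys}"
      have simple: "simple_object C (Ys ! j)" using dec j by (simp add: simple_decomposition_def)
      note jO = simple_object_in[OF simple] and i = biproductD(4)[OF b j]
      have gi: "g \<bullet> i j \<in> Mor C (Ys ! j) Y" "h \<bullet> i j \<in> Mor C (Ys ! j) Y"
        using Comp_in[OF jO W obj(1) i] g h by auto
      show "g \<bullet> i j = h \<bullet> i j"
      proof (cases "Ys ! j \<in> S")
        case True
        have "f \<bullet> (g \<bullet> i j) = f \<bullet> (h \<bullet> i j)"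
          using Comp_assoc[OF jO W obj i g f] Comp_assoc[OF jO W obj i h f] eq by simp
        from cancel[OF True gi this] show ?thesis .
      next
        case False
        hence "mult Y (Ys ! j) = 0"
          using subcategory_multiplicity[OF S Y iso_class_Irr[OF simple]] iso_class_in_classes_of[OF S simple] by auto
        with Hom_dim(2)[OF obj(1) simple] gi show ?thesis by (auto intro: has_dim_0)
      qed
    qed
  qed
next
  assume "monic C Y V f"
  thus "monic (full_subcategory C S) Y V f"
    using subcategory_closed(1)[OF S] by (auto simp: monic_def)
qed

text \<open>
  A simple summand of an object of \<open>S\<close> is again in \<open>S\<close>, so an object that is simple among those of \<open>S\<close> is
  isomorphic to it.
\<close>

lemma simple_object_subcategory:
  "simple_object (full_subcategory C S) V \<longleftrightarrow> V \<in> S \<and> simple_object C V"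
proof
  assume E: "simple_object (full_subcategory C S) V"
  hence V: "V \<in> S" by (simp add: simple_object_def)
  hence VO: "V \<in> Obj C" using subcategory_closed(1)[OF S] by blast
  have nz: "\<not> zero_object C V" using E zero_object_subcategory[OF V] by (simp add: simple_object_def)
  obtain Ys where dec: "simple_decomposition C V Ys" using semisimple[OF VO] by blast
  then obtain i p where b: "biproduct C V {..<length Ys} ((!) Ys) i p"
    by (auto simp: simple_decomposition_def direct_sum_biproduct)
  \<comment> \<open>an empty sum would make the identity of \<open>V\<close> zero\<close>
  have "Ys \<noteq> []"
  proof
    assume "Ys = []"
    hence "Id C V = Zero C V V"
      using biproduct_ext_source[OF b VO Id_in[OF VO] Zero_in[OF VO VO]] by simp
    thus False using nz zero_objectI[OF VO] by blast
  qed
  hence j: "0 \<in> {..<length Ys}" by simp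
  have simple: "simple_object C (Ys ! 0)" using dec j by (simp add: simple_decomposition_def)
  have "set Ys \<subseteq> S" using dec subcategory_closed(5)[OF S _ V] by (simp add: simple_decomposition_def)
  hence YS: "Ys ! 0 \<in> S" using j nth_mem[of 0 Ys] by auto
  have arrs: "arr (i 0) (Ys ! 0) V" "arr (p 0) V (Ys ! 0)"
    using biproductD[OF b] j VO by (auto simp: arr_def)
  have "monic C (Ys ! 0) V (i 0)"
    by (rule split_mono_monic[OF arrs]) (use biproductD(6)[OF b j j] in simp)
  hence "zero_object C (Ys ! 0) \<or> is_iso C (Ys ! 0) V (i 0)"
    using E YS monic_subcategory[OF YS V] zero_object_subcategory[OF YS] by (auto simp: simple_object_def)
  hence "is_iso C (Ys ! 0) V (i 0)" using simple by (simp add: simple_object_def)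
  hence "isomorphic C (Ys ! 0) V" using VO simple_object_in[OF simple] by (auto simp: isomorphic_def)
  from simple_object_isomorphic[OF simple this] V show "V \<in> S \<and> simple_object C V" by simp
next
  assume V: "V \<in> S \<and> simple_object C V"
  show "simple_object (full_subcategory C S) V"
    unfolding simple_object_def
  proof (intro conjI ballI allI impI)
    show "\<not> zero_object (full_subcategory C S) V"
      using V zero_object_subcategory by (simp add: simple_object_def)
    fix Y f assume Y: "Y \<in> Obj (full_subcategory C S)" and m: "monic (full_subcategory C S) Y V f"
    hence "Y \<in> S" "monic C Y V f" using monic_subcategory V by auto
    moreover from this have "Y \<in> Obj C" using subcategory_closed(1)[OF S] by blast
    ultimately show "zero_object (full_subcategory C S) Y \<or> is_iso (full_subcategory C S) Y V f"
      using V zero_object_subcategory by (auto simp: simple_object_def)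
  qed (use V in simp)
qed

lemma iso_class_subcategory: "V \<in> S \<Longrightarrow> iso_class (full_subcategory C S) V = iso_class C V"
  using isomorphic_full_subcategory[OF subcategory_closed(1)[OF S]] subcategory_isomorphic[OF S]
  unfolding iso_class_def by blast

lemma Irr_subcategory: "Irr (full_subcategory C S) = classes_of S"
proof -
  have "Irr (full_subcategory C S) = iso_class C ` {V. V \<in> S \<and> simple_object C V}"
    unfolding Irr_def simple_object_subcategory using iso_class_subcategory by auto
  also have "\<dots> = classes_of S"
  proof (intro equalityI subsetI)
    fix c assume "c \<in> classes_of S"
    hence "c \<in> Irr C" "representative c \<in> S" by (auto simp: classes_of_def)
    thus "c \<in> iso_class C ` {V. V \<in> S \<and> simple_object C V}"
      using Irr_representative[of c] by (intro image_eqI[of _ _ "representative c"]) auto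
  qed (use iso_class_in_classes_of[OF S] in auto)
  finally show ?thesis .
qed

lemma simple_decomposition_subcategory:
  assumes V: "V \<in> S"
  shows "simple_decomposition (full_subcategory C S) V = simple_decomposition C V"
proof
  fix Ys
  have "set Ys \<subseteq> S" if "direct_sum C V Ys" using subcategory_closed(5)[OF S that V] .
  thus "simple_decomposition (full_subcategory C S) V Ys = simple_decomposition C V Ys"
    unfolding simple_decomposition_def direct_sum_full_subcategory[OF subcategory_closed(1)[OF S]]
      simple_object_subcategory using V by auto
qed

lemma multiplicity_subcategory:
  "V \<in> S \<Longrightarrow> multiplicity_in (full_subcategory C S) V c = multiplicity_in C V c"
  by (simp add: multiplicity_in_def simple_decomposition_subcategory)

definition adjoint_generators :: "'o set" where
  "adjoint_generators = {Z \<in> S. \<exists>V D f. V \<in> S \<and> D \<in> S \<and> simple_object C V \<and> left_dual C V D \<and> monic C Z (V \<otimes>\<^sub>o D) f}"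

lemma multiplicity_adjoint:
  assumes V: "simple_object C V" and D: "left_dual C V D" and c: "c \<in> Irr C"
  shows "multiplicity_in C (V \<otimes>\<^sub>o D) c = fusion_coefficient (iso_class C V) (rule.dual (iso_class C V)) c"
proof -
  let ?v = "iso_class C V"
  have obj: "V \<in> Obj C" "D \<in> Obj C" using D by (auto simp: left_dual_def)
  have v: "?v \<in> Irr C" by (rule iso_class_Irr[OF V])
  have mV: "multiplicity_in C V x = (if x = ?v then 1 else 0)" if "x \<in> Irr C" for x
    using mult_simple[OF V Irr_representative(1)[OF that]] Irr_representative(2)[OF that]
      iso_class_eq_iff[OF obj(1), of "representative x"] by auto
  have mD: "multiplicity_in C D y = (if y = rule.dual ?v then 1 else 0)" if y: "y \<in> Irr C" for y
  proof -
    have "rule.dual y = ?v \<longleftrightarrow> y = rule.dual ?v"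
      using rule.dual_dual[OF y] rule.dual_dual[OF v] by metis
    thus ?thesis using multiplicity_left_dual[OF D y] mV[OF rule.dual_in[OF y]] by simp
  qed
  have "multiplicity_in C (V \<otimes>\<^sub>o D) c
      = (\<Sum>x\<in>Irr C. \<Sum>y\<in>Irr C. if x = ?v then (if y = rule.dual ?v then fusion_coefficient x y c else 0) else 0)"
    unfolding multiplicity_tensor[OF obj c] by (intro sum.cong refl) (simp add: mV mD)
  also have "\<dots> = (\<Sum>x\<in>Irr C. if x = ?v then fusion_coefficient x (rule.dual ?v) c else 0)"
    using finite_Irr v by (intro sum.cong refl) simp
  also have "\<dots> = fusion_coefficient ?v (rule.dual ?v) c" using finite_Irr v by simp
  finally show ?thesis .
qed

text \<open>
  A subobject of \<open>V \<otimes> D\<close> has no constituents other than those of \<open>V \<otimes> D\<close>, since composing with a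
  monomorphism keeps nonzero morphisms nonzero.
\<close>

lemma adjoint_generators_subset:
  assumes T: "rule.subrule T"
    and adj: "\<And>x c. x \<in> classes_of S \<Longrightarrow> rule.in_product x (rule.dual x) c \<Longrightarrow> c \<in> T"
  shows "adjoint_generators \<subseteq> objects_of T"
proof
  fix Z assume "Z \<in> adjoint_generators"
  then obtain V D f where Z: "Z \<in> S" and V: "V \<in> S" "simple_object C V" and D: "left_dual C V D"
    and m: "monic C Z (V \<otimes>\<^sub>o D) f" by (auto simp: adjoint_generators_def)
  have obj: "Z \<in> Obj C" "V \<otimes>\<^sub>o D \<in> Obj C"
    using Z subcategory_closed(1)[OF S] D Tens_in by (auto simp: left_dual_def)
  have f: "f \<in> Mor C Z (V \<otimes>\<^sub>o D)" using m by (simp add: monic_def)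
  have "c \<in> T" if c: "c \<in> Irr C" and pos: "0 < multiplicity_in C Z c" for c
  proof -
    note rc = Irr_representative(1,2)[OF c] and rcO = representative_in[OF c]
    \<comment> \<open>a nonzero map into \<open>Z\<close> stays nonzero in \<open>V \<otimes> D\<close>\<close>
    have "\<exists>g\<in>Mor C (representative c) Z. g \<noteq> Zero C (representative c) Z"
    proof (rule ccontr)
      assume zero: "\<not> ?thesis"
      have single: "Mor C (representative c) Z = {Zero C (representative c) Z}"
        using zero Zero_in[OF rcO obj(1)] by blast
      have "coordinates (Hom C (representative c) Z) ({} :: nat set) (\<lambda>_ _. 0)"
        by (auto simp: coordinates_def bij_betw_def single fun_eq_iff)
      from coordinates_has_dim[OF this]
      have "has_dim (Hom C (representative c) Z) 0" by simp
      from has_dim_unique[OF Hom_vector_space[OF rcO obj(1)] this Hom_dim(2)[OF obj(1) rc(1)]]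
      show False using pos rc(2) by simp
    qed
    then obtain g where g: "g \<in> Mor C (representative c) Z" "g \<noteq> Zero C (representative c) Z" by blast
    have "f \<bullet> g \<noteq> f \<bullet> Zero C (representative c) Z"
      using m g rcO Zero_in[OF rcO obj(1)] unfolding monic_def by blast
    hence "\<not> has_dim (Hom C (representative c) (V \<otimes>\<^sub>o D)) 0"
      using has_dim_0[OF _ Comp_in[OF rcO obj g(1) f] Comp_in[OF rcO obj Zero_in[OF rcO obj(1)] f]] by auto
    hence "mult (V \<otimes>\<^sub>o D) (representative c) \<noteq> 0"
      using Hom_dim(2)[OF obj(2) rc(1)] by metis
    hence "rule.in_product (iso_class C V) (rule.dual (iso_class C V)) c"
      using multiplicity_adjoint[OF V(2) D c] rc(2) c iso_class_Irr[OF V(2)] rule.dual_in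
      by (simp add: rule.in_product_def)
    thus ?thesis using adj iso_class_in_classes_of[OF S V(2)] V(1) by blast
  qed
  thus "Z \<in> objects_of T" using obj by (simp add: objects_of_def)
qed

text \<open>
  Conversely, every constituent of \<open>x \<otimes> x\<^sup>*\<close> is represented by a simple summand, which is a subobject.
\<close>

lemma adjoint_constituent:
  assumes T: "tensor_subcategory C T" "adjoint_generators \<subseteq> T"
    and x: "x \<in> classes_of S" and c: "rule.in_product x (rule.dual x) c"
  shows "c \<in> classes_of T"
proof -
  have xI: "x \<in> Irr C" "representative x \<in> S" using x by (auto simp: classes_of_def)
  have cI: "c \<in> Irr C" using rule.in_product_in[OF c] by blast
  note rx = Irr_representative(1,2)[OF xI(1)]
  obtain D where D: "left_dual C (representative x) D" using ex_left_dual[OF representative_in[OF xI(1)]] by blast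
  have DS: "D \<in> S" using subcategory_closed(6)[OF S D] xI(2) by simp
  let ?P = "representative x \<otimes>\<^sub>o D"
  have PS: "?P \<in> S" using subcategory_closed(3)[OF S xI(2) DS] .
  hence PO: "?P \<in> Obj C" using subcategory_closed(1)[OF S] by blast
  have pos: "0 < multiplicity_in C ?P c"
    using multiplicity_adjoint[OF rx(1) D cI] rx(2) c by (simp add: rule.in_product_def)
  obtain Ys where dec: "simple_decomposition C ?P Ys" using semisimple[OF PO] by blast
  then obtain i p where b: "biproduct C ?P {..<length Ys} ((!) Ys) i p"
    by (auto simp: simple_decomposition_def direct_sum_biproduct)
  obtain Y where "Y \<in> set Ys" "iso_class C Y = c" using pos multiplicity_pos_iff[OF dec cI] by blast
  then obtain j where j: "j \<in> {..<length Ys}" "iso_class C (Ys ! j) = c" by (auto simp: in_set_conv_nth)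
  have simple: "simple_object C (Ys ! j)" using dec j by (simp add: simple_decomposition_def)
  have "set Ys \<subseteq> S" using dec subcategory_closed(5)[OF S _ PS] by (simp add: simple_decomposition_def)
  hence YS: "Ys ! j \<in> S" using j nth_mem[of j Ys] by auto
  have arrs: "arr (i j) (Ys ! j) ?P" "arr (p j) ?P (Ys ! j)"
    using biproductD[OF b] j PO by (auto simp: arr_def)
  have "monic C (Ys ! j) ?P (i j)"
    by (rule split_mono_monic[OF arrs]) (use biproductD(6)[OF b j(1) j(1)] in simp)
  hence "Ys ! j \<in> adjoint_generators"
    unfolding adjoint_generators_def using YS xI(2) DS rx(1) D by blast
  hence "Ys ! j \<in> T" using T(2) by blast
  thus ?thesis using iso_class_in_classes_of[OF T(1) simple] j(2) by simp
qed

lemma adjoint_subcategory_full_subcategory: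
  "adjoint_subcategory (full_subcategory C S)
    = full_subcategory C (\<Inter>{T. T \<subseteq> S \<and> tensor_subcategory C T \<and> adjoint_generators \<subseteq> T})"
proof -
  have "{Z \<in> S. \<exists>V D f. simple_object (full_subcategory C S) V \<and> left_dual (full_subcategory C S) V D
        \<and> monic (full_subcategory C S) Z (V \<otimes>\<^sub>o D) f} = adjoint_generators"
  proof -
    have "monic (full_subcategory C S) Z (V \<otimes>\<^sub>o D) f = monic C Z (V \<otimes>\<^sub>o D) f" if "V \<in> S" "D \<in> S" "Z \<in> S" for Z V D f
      using monic_subcategory[OF that(3) subcategory_closed(3)[OF S that(1,2)]] .
    thus ?thesis
      unfolding adjoint_generators_def simple_object_subcategory
        left_dual_full_subcategory[OF subcategory_closed(1)[OF S]] by blast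
  qed
  thus ?thesis
    unfolding adjoint_subcategory_def generated_subcategory_def
    by (simp add: tensor_subcategory_full_subcategory[OF S] conj_assoc)
qed

text \<open>
  The conjugation-closed part of the adjoint subcategory contains the generators, so by minimality it is
  the whole adjoint subcategory.
\<close>

lemma adjoint_subcategory_normal:
  "\<exists>S'. adjoint_subcategory (full_subcategory C S) = full_subcategory C S' \<and> tensor_subcategory C S'
    \<and> S' \<subseteq> S \<and> rule.normal_in (classes_of S') (classes_of S)"
proof -
  let ?F = "{T. T \<subseteq> S \<and> tensor_subcategory C T \<and> adjoint_generators \<subseteq> T}"
  define S' where "S' = \<Inter>?F"
  have SF: "S \<in> ?F" using S by (auto simp: adjoint_generators_def)
  have S': "tensor_subcategory C S'" unfolding S'_def by (rule tensor_subcategory_Inter) (use SF in auto)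
  have sub: "S' \<subseteq> S" unfolding S'_def using SF by blast
  have gen: "adjoint_generators \<subseteq> S'" unfolding S'_def by blast
  let ?T = "rule.conj_closed (classes_of S) (classes_of S')"
  note adj = adjoint_constituent[OF S' gen]
  have T: "rule.subrule ?T"
    by (rule rule.conj_closed_subrule[OF subrule_classes_of[OF S] subrule_classes_of[OF S']]) (rule adj)
  have TS: "?T \<subseteq> classes_of S'" by (auto simp: rule.conj_closed_def)
  have "adjoint_generators \<subseteq> objects_of ?T"
    by (rule adjoint_generators_subset[OF T])
      (rule rule.adjoint_in_conj_closed[OF subrule_classes_of[OF S] subrule_classes_of[OF S'] adj])
  moreover have "objects_of ?T \<subseteq> S"
  proof -
    have "objects_of ?T \<subseteq> objects_of (classes_of S')" using TS by (auto simp: objects_of_def)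
    thus ?thesis using sub subcategory_objects_of[OF S'] by simp
  qed
  ultimately have "objects_of ?T \<in> ?F" using tensor_subcategory_objects_of[OF T] by simp
  from Inter_lower[OF this] have "S' \<subseteq> objects_of ?T" unfolding S'_def[symmetric] .
  hence "classes_of S' \<subseteq> ?T"
    using classes_of_objects_of[of ?T] rule.subruleD(1)[OF T] by (auto simp: classes_of_def)
  hence "rule.normal_in (classes_of S') (classes_of S)"
    unfolding rule.normal_in_def rule.conj_closed_def by blast
  moreover have "adjoint_subcategory (full_subcategory C S) = full_subcategory C S'"
    unfolding S'_def by (rule adjoint_subcategory_full_subcategory)
  ultimately show ?thesis using S' sub by blast
qed

end

end


section \<open>Frobenius-Perron dimensions\<close>

lemma additive_int_real:
  fixes g :: "int \<Rightarrow> real"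
  assumes add: "\<And>k l. g (k + l) = g k + g l"
  shows "g k = of_int k * g 1"
proof -
  have zero: "g 0 = 0" using add[of 0 0] by simp
  have nat: "g (int n) = of_nat n * g 1" for n
    by (induction n) (simp_all add: zero add algebra_simps)
  have neg: "g (- l) = - g l" for l using add[of l "- l"] zero by simp
  show ?thesis
  proof (cases "0 \<le> k")
    case True
    thus ?thesis using nat[of "nat k"] by simp
  next
    case False
    thus ?thesis using nat[of "nat (- k)"] neg[of "- k"] by simp
  qed
qed

text \<open>
  An additive function on the free abelian group on \<open>T\<close> is determined by its values on the basis.
\<close>

lemma additive_expansion:
  fixes \<phi> :: "('a \<Rightarrow> int) \<Rightarrow> real"
  assumes T: "finite T"
    and add: "\<And>u v. \<lbrakk>\<forall>c. c \<notin> T \<longrightarrow> u c = 0; \<forall>c. c \<notin> T \<longrightarrow> v c = 0\<rbrakk> \<Longrightarrow> \<phi> (\<lambda>c. u c + v c) = \<phi> u + \<phi> v"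
    and u: "\<forall>c. c \<notin> T \<longrightarrow> u c = 0"
  shows "\<phi> u = (\<Sum>x\<in>T. of_int (u x) * \<phi> (\<lambda>c. if c = x then 1 else 0))"
proof -
  have scale: "\<phi> (\<lambda>c. if c = x then k else 0) = of_int k * \<phi> (\<lambda>c. if c = x then 1 else 0)" if x: "x \<in> T" for x k
  proof (rule additive_int_real[of "\<lambda>k. \<phi> (\<lambda>c. if c = x then k else 0)"])
    fix k l :: int
    have "(\<lambda>c. if c = x then k + l else 0) = (\<lambda>c. (if c = x then k else 0) + (if c = x then l else 0))"
      by auto
    thus "\<phi> (\<lambda>c. if c = x then k + l else 0) = \<phi> (\<lambda>c. if c = x then k else 0) + \<phi> (\<lambda>c. if c = x then l else 0)"
      using add[of "\<lambda>c. if c = x then k else 0" "\<lambda>c. if c = x then l else 0"] x by auto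
  qed
  have zero: "\<phi> (\<lambda>c. 0) = 0" using add[of "\<lambda>c. 0" "\<lambda>c. 0"] by simp
  have expand: "\<phi> (\<lambda>c. if c \<in> U then u c else 0) = (\<Sum>x\<in>U. of_int (u x) * \<phi> (\<lambda>c. if c = x then 1 else 0))"
    if "U \<subseteq> T" for U
    using finite_subset[OF that T] that
  proof (induction U rule: finite_induct)
    case empty
    thus ?case using zero by simp
  next
    case (insert x U)
    have "(\<lambda>c. if c \<in> insert x U then u c else 0) = (\<lambda>c. (if c = x then u x else 0) + (if c \<in> U then u c else 0))"
      using insert.hyps by auto
    hence eq: "\<phi> (\<lambda>c. if c \<in> insert x U then u c else 0)
        = \<phi> (\<lambda>c. if c = x then u x else 0) + \<phi> (\<lambda>c. if c \<in> U then u c else 0)"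
      using insert.prems by (simp only:) (rule add, auto)
    have "x \<in> T" "U \<subseteq> T" using insert.prems by auto
    thus ?case unfolding eq using insert.IH insert.hyps by (simp add: scale[OF \<open>x \<in> T\<close>, of "u x"])
  qed
  have restrict: "(\<lambda>c. if c \<in> T then u c else 0) = u" using u by auto
  show ?thesis using expand[OF order_refl] unfolding restrict .
qed

context fusion_category
begin

context
  fixes S d
  assumes S: "tensor_subcategory C S" and d: "rule.character d"
begin

abbreviation "subclasses \<equiv> classes_of S"
abbreviation "subcat \<equiv> full_subcategory C S"

interpretation sub: fusion_rule subclasses fusion_coefficient "iso_class C \<one>\<^sub>o"
  by (rule rule.subrule_fusion_rule[OF subrule_classes_of[OF S]])

lemma subclassesD: "c \<in> subclasses \<Longrightarrow> c \<in> Irr C" "c \<in> subclasses \<Longrightarrow> representative c \<in> S"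
  by (auto simp: classes_of_def)

lemma K0_class_subcategory:
  "V \<in> S \<Longrightarrow> K0_class subcat V = (\<lambda>c. if c \<in> subclasses then int (multiplicity_in C V c) else 0)"
  by (simp add: K0_class_def Irr_subcategory[OF S] multiplicity_subcategory[OF S] cong: if_cong)

lemma K0_class_simple:
  assumes V: "V \<in> S" "simple_object C V"
  shows "K0_class subcat V = (\<lambda>c. if c = iso_class C V then 1 else 0)"
proof -
  have "multiplicity_in C V c = (if c = iso_class C V then 1 else 0)" if c: "c \<in> subclasses" for c
    using mult_simple[OF V(2) Irr_representative(1)[OF subclassesD(1)[OF c]]] Irr_representative(2)[OF subclassesD(1)[OF c]]
      iso_class_eq_iff[OF simple_object_in[OF V(2)], of "representative c"] by auto
  thus ?thesis using K0_class_subcategory[OF V(1)] iso_class_in_classes_of[OF S V(2)] V(1) by (auto simp: fun_eq_iff)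
qed

lemma K0_class_representative: "x \<in> subclasses \<Longrightarrow> K0_class subcat (representative x) = (\<lambda>c. if c = x then 1 else 0)"
  using K0_class_simple[of "representative x"] Irr_representative[of x] subclassesD[of x] by simp

lemma K0_class_product:
  "x \<in> subclasses \<Longrightarrow> y \<in> subclasses \<Longrightarrow> K0_class subcat (representative x \<otimes>\<^sub>o representative y) c
    = (if c \<in> subclasses then int (fusion_coefficient x y c) else 0)"
  using K0_class_subcategory[OF subcategory_closed(3)[OF S subclassesD(2) subclassesD(2)], of x y]
  by (simp add: fusion_coefficient_def)

lemma K0_carrier: "u \<in> carrier (K0 subcat) \<longleftrightarrow> (\<forall>c. c \<notin> subclasses \<longrightarrow> u c = 0)"
  by (simp add: K0_def Irr_subcategory[OF S])

lemma K0_add: "u \<oplus>\<^bsub>K0 subcat\<^esub> v = (\<lambda>c. u c + v c)"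
  by (simp add: K0_def)

lemma K0_mult: "u \<otimes>\<^bsub>K0 subcat\<^esub> v
    = (\<lambda>c. if c \<in> subclasses then \<Sum>x\<in>subclasses. \<Sum>y\<in>subclasses. u x * v y * int (fusion_coefficient x y c) else 0)"
  by (simp add: K0_def Irr_subcategory[OF S] K0_class_product fun_eq_iff cong: sum.cong if_cong)

lemma K0_one: "\<one>\<^bsub>K0 subcat\<^esub> = (\<lambda>c. if c = iso_class C \<one>\<^sub>o then 1 else 0)"
  using K0_class_simple[OF subcategory_closed(2)[OF S] simple_Unit] by (simp add: K0_def)

text \<open>
  The linear extension of \<open>d\<close>. Restricting it to the carrier selects the representative that the
  definition of the Frobenius-Perron character asks for.
\<close>

definition FP_candidate :: "('o set \<Rightarrow> int) \<Rightarrow> real" where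
  "FP_candidate = restrict (\<lambda>u. \<Sum>c\<in>subclasses. of_int (u c) * d c) (carrier (K0 subcat))"

lemma FP_candidate_class: "x \<in> subclasses \<Longrightarrow> FP_candidate (\<lambda>c. if c = x then 1 else 0) = d x"
  using sub.finite_I by (auto simp: FP_candidate_def K0_carrier if_distrib[of of_int] if_distrib[of "\<lambda>t. t * _"] cong: if_cong)

lemma sub_character: "sub.character d"
  by (rule rule.subrule_character[OF subrule_classes_of[OF S] d])

lemma FP_candidate_ring_hom: "FP_candidate \<in> ring_hom (K0 subcat) (ring_of_type_algebra :: real ring)"
proof (rule ring_hom_memI)
  fix u v assume u: "u \<in> carrier (K0 subcat)" and v: "v \<in> carrier (K0 subcat)"
  show "FP_candidate u \<in> carrier (ring_of_type_algebra :: real ring)" by (simp add: ring_of_type_algebra_def)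
  have "u \<oplus>\<^bsub>K0 subcat\<^esub> v \<in> carrier (K0 subcat)" using u v by (simp add: K0_add K0_carrier)
  thus "FP_candidate (u \<oplus>\<^bsub>K0 subcat\<^esub> v) = FP_candidate u \<oplus>\<^bsub>(ring_of_type_algebra :: real ring)\<^esub> FP_candidate v"
    using u v by (simp add: FP_candidate_def ring_of_type_algebra_def K0_add distrib_right sum.distrib)
  have uv: "u \<otimes>\<^bsub>K0 subcat\<^esub> v \<in> carrier (K0 subcat)" by (simp add: K0_mult K0_carrier)
  have "FP_candidate (u \<otimes>\<^bsub>K0 subcat\<^esub> v)
      = (\<Sum>c\<in>subclasses. \<Sum>x\<in>subclasses. \<Sum>y\<in>subclasses. of_int (u x) * of_int (v y) * (real (fusion_coefficient x y c) * d c))"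
    using uv by (simp add: FP_candidate_def K0_mult sum_distrib_right mult.assoc)
  also have "\<dots> = (\<Sum>x\<in>subclasses. \<Sum>c\<in>subclasses. \<Sum>y\<in>subclasses. of_int (u x) * of_int (v y) * (real (fusion_coefficient x y c) * d c))"
    by (rule sum.swap)
  also have "\<dots> = (\<Sum>x\<in>subclasses. \<Sum>y\<in>subclasses. \<Sum>c\<in>subclasses. of_int (u x) * of_int (v y) * (real (fusion_coefficient x y c) * d c))"
    by (intro sum.cong refl sum.swap)
  also have "\<dots> = (\<Sum>x\<in>subclasses. \<Sum>y\<in>subclasses. of_int (u x) * of_int (v y) * (d x * d y))"
    by (intro sum.cong refl) (simp add: sub.character_mult[OF sub_character] sum_distrib_left)
  also have "\<dots> = FP_candidate u * FP_candidate v"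
    using u v by (simp add: FP_candidate_def sum_product mult_ac)
  finally show "FP_candidate (u \<otimes>\<^bsub>K0 subcat\<^esub> v)
      = FP_candidate u \<otimes>\<^bsub>(ring_of_type_algebra :: real ring)\<^esub> FP_candidate v"
    by (simp add: ring_of_type_algebra_def)
next
  show "FP_candidate \<one>\<^bsub>K0 subcat\<^esub> = \<one>\<^bsub>(ring_of_type_algebra :: real ring)\<^esub>"
    unfolding K0_one FP_candidate_class[OF sub.e_in] rule.character_e[OF d]
    by (simp add: ring_of_type_algebra_def)
qed

text \<open>
  A positive ring homomorphism restricts to a character of the fusion rule on the classes in \<open>S\<close>. There
  is only one, so it is the restriction of \<open>d\<close>; in particular dimensions do not change when passing to a
  subcategory.
\<close>

lemma FP_character_subcategory: "FP_character subcat = FP_candidate"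
  unfolding FP_character_def
proof (rule the_equality)
  show "FP_candidate \<in> ring_hom (K0 subcat) (ring_of_type_algebra :: real ring)
      \<and> FP_candidate \<in> extensional (carrier (K0 subcat))
      \<and> (\<forall>V. simple_object subcat V \<longrightarrow> 0 < FP_candidate (K0_class subcat V))"
  proof (intro conjI allI impI FP_candidate_ring_hom)
    show "FP_candidate \<in> extensional (carrier (K0 subcat))" by (simp add: FP_candidate_def)
    fix V assume "simple_object subcat V"
    hence V: "V \<in> S" "simple_object C V" using simple_object_subcategory[OF S] by auto
    hence "iso_class C V \<in> subclasses" using iso_class_in_classes_of[OF S] by blast
    thus "0 < FP_candidate (K0_class subcat V)"
      using sub.character_pos[OF sub_character] by (simp add: K0_class_simple[OF V] FP_candidate_class)
  qed
next
  fix \<phi>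
  assume "\<phi> \<in> ring_hom (K0 subcat) (ring_of_type_algebra :: real ring) \<and> \<phi> \<in> extensional (carrier (K0 subcat))
      \<and> (\<forall>V. simple_object subcat V \<longrightarrow> 0 < \<phi> (K0_class subcat V))"
  hence hom: "\<phi> \<in> ring_hom (K0 subcat) (ring_of_type_algebra :: real ring)" and ext: "\<phi> \<in> extensional (carrier (K0 subcat))"
    and pos: "\<And>V. simple_object subcat V \<Longrightarrow> 0 < \<phi> (K0_class subcat V)" by auto
  let ?f = "\<lambda>x. \<phi> (\<lambda>c. if c = x then 1 else 0)"
  have add: "\<phi> (\<lambda>c. u c + v c) = \<phi> u + \<phi> v" if "\<forall>c. c \<notin> subclasses \<longrightarrow> u c = 0" "\<forall>c. c \<notin> subclasses \<longrightarrow> v c = 0" for u v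
    using ring_hom_add[OF hom, of u v] that by (simp add: K0_carrier K0_add ring_of_type_algebra_def)
  have expand: "\<phi> u = (\<Sum>x\<in>subclasses. of_int (u x) * ?f x)" if "\<forall>c. c \<notin> subclasses \<longrightarrow> u c = 0" for u
    by (rule additive_expansion[OF sub.finite_I add that]) auto
  have "sub.character ?f"
    unfolding sub.character_def
  proof (intro conjI ballI)
    fix x assume x: "x \<in> subclasses"
    hence "simple_object subcat (representative x)"
      using simple_object_subcategory[OF S] Irr_representative(1) subclassesD by blast
    from pos[OF this] show "0 < ?f x" by (simp add: K0_class_representative[OF x])
    fix y assume y: "y \<in> subclasses"
    let ?\<delta> = "\<lambda>x c. if c = x then 1 else (0 :: int)"
    have "?\<delta> x \<in> carrier (K0 subcat)" "?\<delta> y \<in> carrier (K0 subcat)" using x y by (auto simp: K0_carrier)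
    hence "?f x * ?f y = \<phi> (?\<delta> x \<otimes>\<^bsub>K0 subcat\<^esub> ?\<delta> y)"
      using ring_hom_mult[OF hom, of "?\<delta> x" "?\<delta> y"] by (simp add: ring_of_type_algebra_def)
    also have "?\<delta> x \<otimes>\<^bsub>K0 subcat\<^esub> ?\<delta> y = (\<lambda>c. if c \<in> subclasses then int (fusion_coefficient x y c) else 0)"
      using x y sub.finite_I
      by (simp add: K0_mult fun_eq_iff if_distrib[of "\<lambda>t. t * _"] if_distrib[of "\<lambda>t. _ * t"] cong: if_cong)
    also have "\<phi> \<dots> = (\<Sum>z\<in>subclasses. real (fusion_coefficient x y z) * ?f z)"
      by (subst expand) auto
    finally show "?f x * ?f y = (\<Sum>z\<in>subclasses. real (fusion_coefficient x y z) * ?f z)" .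
  qed
  hence f: "?f x = d x" if "x \<in> subclasses" for x using sub.character_unique[OF sub_character _ that] by blast
  show "\<phi> = FP_candidate"
  proof (rule extensionalityI[OF ext])
    show "FP_candidate \<in> extensional (carrier (K0 subcat))" by (simp add: FP_candidate_def)
    fix u assume u: "u \<in> carrier (K0 subcat)"
    have "\<phi> u = (\<Sum>x\<in>subclasses. of_int (u x) * d x)" using expand[of u] u f by (simp add: K0_carrier)
    thus "\<phi> u = FP_candidate u" using u by (simp add: FP_candidate_def)
  qed
qed

lemma FPdim_subcategory:
  assumes V: "V \<in> S" "simple_object C V"
  shows "FPdim subcat V = d (iso_class C V)"
proof -
  have "iso_class C V \<in> subclasses" using V iso_class_in_classes_of[OF S] by blast
  thus ?thesis
    by (simp add: FPdim_def FP_character_subcategory K0_class_simple[OF V] FP_candidate_class)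
qed

lemma FPdim_cat_subcategory: "FPdim_cat subcat = rule.dim_sum d subclasses"
proof -
  have "FPdim subcat (representative c) = d c" if c: "c \<in> subclasses" for c
    using FPdim_subcategory[OF subclassesD(2)[OF c] Irr_representative(1)[OF subclassesD(1)[OF c]]]
      Irr_representative(2)[OF subclassesD(1)[OF c]] by simp
  thus ?thesis unfolding FPdim_cat_def rule.dim_sum_def Irr_subcategory[OF S] by simp
qed

end

text \<open>
  The objects whose constituents are all isomorphic to the unit already form a tensor subcategory.
\<close>

lemma classes_of_Vec:
  assumes "full_subcategory C S = Vec_subcategory C"
  shows "classes_of S = {iso_class C \<one>\<^sub>o}"
proof -
  have "Obj (full_subcategory C S) = Obj (Vec_subcategory C)" using assms by simp
  hence S: "S = \<Inter>{T. tensor_subcategory C T \<and> {\<one>\<^sub>o} \<subseteq> T}"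
    by (simp add: Vec_subcategory_def generated_subcategory_def)
  have "tensor_subcategory C (Obj C)" by (rule tensor_subcategory_Obj) unfold_locales
  hence "tensor_subcategory C S" unfolding S by (intro tensor_subcategory_Inter) (use Unit_in in auto)
  hence e: "iso_class C \<one>\<^sub>o \<in> classes_of S" by (rule rule.subruleD(2)[OF subrule_classes_of])
  let ?T = "objects_of {iso_class C \<one>\<^sub>o}"
  have T: "tensor_subcategory C ?T" by (rule tensor_subcategory_objects_of[OF rule.subrule_e])
  moreover have "\<one>\<^sub>o \<in> ?T" by (rule subcategory_closed(2)[OF T])
  ultimately have "S \<subseteq> ?T" unfolding S by blast
  hence "classes_of S \<subseteq> classes_of ?T" by (auto simp: classes_of_def)
  also have "\<dots> = {iso_class C \<one>\<^sub>o}" by (rule classes_of_objects_of) (simp add: Unit_Irr)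
  finally show ?thesis using e by blast
qed

lemma nilpotent_rule_classes_of:
  "tensor_subcategory C S \<Longrightarrow> (adjoint_subcategory ^^ n) (full_subcategory C S) = Vec_subcategory C
    \<Longrightarrow> rule.nilpotent_rule (classes_of S)"
proof (induction n arbitrary: S)
  case 0
  thus ?case using classes_of_Vec[of S] rule.nilpotent_rule.trivial by simp
next
  case (Suc n)
  obtain S' where S': "adjoint_subcategory (full_subcategory C S) = full_subcategory C S'"
    "tensor_subcategory C S'" "S' \<subseteq> S" "rule.normal_in (classes_of S') (classes_of S)"
    using adjoint_subcategory_normal[OF Suc.prems(1)] by blast
  have "(adjoint_subcategory ^^ n) (full_subcategory C S') = Vec_subcategory C"
    using Suc.prems(2) S'(1) by (simp add: funpow_swap1)
  from Suc.IH[OF S'(2) this] show ?case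
    by (rule rule.nilpotent_rule.extend)
      (use S' Suc.prems subrule_classes_of in \<open>auto simp: classes_of_def\<close>)
qed

end

theorem corollary5p3:
  fixes C :: "('o, 'm, 'k::{alg_closed_field, field_char_0}) tensor_data" and V :: 'o
  assumes "fusion_category C" and "nilpotent C" and "simple_object C V"
  shows "FPdim_cat (adjoint_subcategory C) / (FPdim C V)\<^sup>2 \<in> \<int>"
proof -
  interpret fusion_category C by fact
  have C: "tensor_subcategory C (Obj C)" by (rule tensor_subcategory_Obj[OF assms(1)])
  have all: "classes_of (Obj C) = Irr C" using representative_in by (auto simp: classes_of_def)
  obtain S where S: "adjoint_subcategory C = full_subcategory C S" "tensor_subcategory C S"
    and nrm: "rule.normal_in (classes_of S) (Irr C)"
    using adjoint_subcategory_normal[OF C] unfolding all by auto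
  note sub = subrule_classes_of[OF S(2)]
  obtain n where n: "(adjoint_subcategory ^^ n) C = Vec_subcategory C"
    using assms(2) by (auto simp: nilpotent_def)
  have nilp: "rule.nilpotent_rule (classes_of S)"
  proof (cases n)
    case 0
    hence "classes_of (Obj C) = {iso_class C (Unit C)}" using classes_of_Vec[of "Obj C"] n by simp
    hence "classes_of S = {iso_class C (Unit C)}"
      using rule.subruleD(1,2)[OF sub] all by blast
    thus ?thesis using rule.nilpotent_rule.trivial by simp
  next
    case (Suc m)
    hence "(adjoint_subcategory ^^ m) (full_subcategory C S) = Vec_subcategory C"
      using n S(1) by (simp add: funpow_swap1)
    thus ?thesis by (rule nilpotent_rule_classes_of[OF S(2)])
  qed
  obtain d where d: "rule.character d" using rule.ex_character by blast
  have "FPdim_cat (adjoint_subcategory C) = rule.dim_sum d (classes_of S)"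
    unfolding S(1) by (rule FPdim_cat_subcategory[OF S(2) d])
  moreover have "FPdim C V = d (iso_class C V)"
    using FPdim_subcategory[OF C d simple_object_in[OF assms(3)] assms(3)] by simp
  ultimately show ?thesis
    using rule.nilpotent_rule_divisibility[OF nilp sub nrm d iso_class_Irr[OF assms(3)]] by simp
qed

end
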